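(* Let $p$ be an odd prime, let $\Gamma_{(p)}$ be the Gupta-Sidki $p$-group, let $K=[\Gamma_{(p)},\Gamma_{(p)}]$ be its derived subgroup, and for $n \geq 1$ let $K^{(\times p^n)}$ be the canonically embedded copy, as a finite-index normal subgroup of $\Gamma_{(p)}$, of the Cartesian product of $p^n$ copies of $K$. Set $C_p = 3\cdot 4^p - 2^p(p+8)+7$. Then $$\operatorname{diam}\big(\Gamma_{(p)}/K^{(\times p^n)}\big) = O_p\big(\exp(\log(C_p)\,n)\big)$$ and $$\operatorname{diam}\big(\Gamma_{(p)}/K^{(\times p^n)}\big) = O_p\Big(\big(\log|\Gamma_{(p)}:K^{(\times p^n)}|\big)^{\log(C_p)/\log(p)}\Big),$$ where the implied constants depend only on $p$ (not on $n$).
   Context: Diameter: for a finite group $G$ and a generating set $S\subseteq G$, $B_S(n)$ is the closed ball of radius $n$ about the identity in the word metric of $S$, i.e. the set of products of at most $n$ elements of $S\cup S^{-1}$; $\operatorname{diam}(G,S)=\min\{n\in\mathbb{N}: B_S(n)=G\}$; and $\operatorname{diam}(G)$ is the maximum of $\operatorname{diam}(G,S)$ over all generating sets $S$ of $G$. Tree: let $\mathcal{A}=\{0,1,\ldots,p-1\}$ and let $\mathcal{A}^*$ be the set of finite words over $\mathcal{A}$, viewed as the vertex set of the $p$-ary rooted tree $\mathcal{T}_p$. $\operatorname{Aut}(\mathcal{T}_p)$ is the group of permutations of $\mathcal{A}^*$ preserving the prefix relation, and $\operatorname{Stab}(n)$ is the kernel of its action on the set $\mathcal{A}^n$ of words of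 length $n$. An element $\phi\in\operatorname{Stab}(1)$ is identified with the tuple $(\phi_0,\ldots,\phi_{p-1})\in\operatorname{Aut}(\mathcal{T}_p)^p$ such that $\phi(iw)=i\,\phi_i(w)$ for all $i\in\mathcal{A}$, $w\in\mathcal{A}^*$. The Gupta-Sidki $p$-group $\Gamma_{(p)}$ is the subgroup of $\operatorname{Aut}(\mathcal{T}_p)$ generated by $a$ and $b$, where $a(iw)=(i+1)w$ for $0\leq i\leq p-2$ and $a((p-1)w)=0w$, and $b\in\operatorname{Stab}(1)$ is defined recursively by $b=(a,a^{-1},1,\ldots,1,b)$. For a subgroup $H\leq \operatorname{Aut}(\mathcal{T}_p)$, $H^{(\times p)}$ denotes the subgroup of those $\phi\in\operatorname{Stab}(1)$ whose coordinates $\phi_0,\ldots,\phi_{p-1}$ all lie in $H$; set $H^{(\times 1)}=H$ and $H^{(\times p^{n+1})}=(H^{(\times p^n)})^{(\times p)}$. The groups $K^{(\times p^n)}$ are finite-index normal subgroups of $\Gamma_{(p)}$. *)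

theory Defs
  imports Complex_Main "HOL-Algebra.Bij" "HOL-Algebra.Coset" "HOL-Algebra.Generated_Groups"
    "HOL-Computational_Algebra.Primes" "HOL-Library.Sublist"
begin

subsection \<open>Diameter of a finite group\<close>

definition word_ball :: "('a, 'm) monoid_scheme \<Rightarrow> 'a set \<Rightarrow> nat \<Rightarrow> 'a set" where
  "word_ball G S n = {foldr (\<otimes>\<^bsub>G\<^esub>) xs \<one>\<^bsub>G\<^esub> | xs. set xs \<subseteq> S \<union> (\<lambda>s. inv\<^bsub>G\<^esub> s) ` S \<and> length xs \<le> n}"

definition diam_wrt :: "('a, 'm) monoid_scheme \<Rightarrow> 'a set \<Rightarrow> nat" where
  "diam_wrt G S = (LEAST n. word_ball G S n = carrier G)"

(* meaningful for finite groups only: then the set below is finite and nonempty *)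
definition group_diam :: "('a, 'm) monoid_scheme \<Rightarrow> nat" where
  "group_diam G = Max {diam_wrt G S | S. S \<subseteq> carrier G \<and> generate G S = carrier G}"

subsection \<open>The rooted tree and its automorphism group\<close>

definition tree_words :: "nat \<Rightarrow> nat list set" where
  "tree_words p = lists {..<p}"

(* As in BijGroup, automorphisms are extensional functions (undefined outside tree_words p),
   so equality of group elements is equality of functions; the product is composition. *)
definition Aut_tree :: "nat \<Rightarrow> (nat list \<Rightarrow> nat list) monoid" where
  "Aut_tree p = (BijGroup (tree_words p))
     \<lparr>carrier := {f \<in> Bij (tree_words p).
        \<forall>u\<in>tree_words p. \<forall>v\<in>tree_words p. prefix (f u) (f v) \<longleftrightarrow> prefix u v}\<rparr>"

definition Stab :: "nat \<Rightarrow> nat \<Rightarrow> (nat list \<Rightarrow> nat list) set" where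
  "Stab p n = {f \<in> carrier (Aut_tree p). \<forall>w\<in>tree_words p. length w = n \<longrightarrow> f w = w}"

(* \<psi> i is the i-th coordinate of \<phi>; since elements of H are extensional,
   \<psi> i is uniquely determined by \<phi> for i < p. *)
definition tree_prod :: "nat \<Rightarrow> (nat list \<Rightarrow> nat list) set \<Rightarrow> (nat list \<Rightarrow> nat list) set" where
  "tree_prod p H = {\<phi> \<in> Stab p 1. \<exists>\<psi>. \<forall>i<p. \<psi> i \<in> H \<and> (\<forall>w\<in>tree_words p. \<phi> (i # w) = i # \<psi> i w)}"

(* tree_prod_pow p n H is the product of p ^ n copies of H, acting below level n. *)
definition tree_prod_pow ::
  "nat \<Rightarrow> nat \<Rightarrow> (nat list \<Rightarrow> nat list) set \<Rightarrow> (nat list \<Rightarrow> nat list) set" where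
  "tree_prod_pow p n H = (tree_prod p ^^ n) H"

subsection \<open>The Gupta--Sidki group\<close>

definition gs_a :: "nat \<Rightarrow> nat list \<Rightarrow> nat list" where
  "gs_a p = (\<lambda>w\<in>tree_words p. case w of [] \<Rightarrow> [] | i # v \<Rightarrow> (if i = p - 1 then 0 else i + 1) # v)"

primrec gs_b_fun :: "nat \<Rightarrow> nat list \<Rightarrow> nat list" where
  "gs_b_fun p [] = []"
| "gs_b_fun p (i # w) = i #
     (if i = 0 then gs_a p w
      else if i = 1 then (inv\<^bsub>Aut_tree p\<^esub> (gs_a p)) w
      else if i = p - 1 then gs_b_fun p w
      else w)"

(* b = (a, a^(-1), 1, ..., 1, b); for p >= 3 the cases above do not overlap *)
definition gs_b :: "nat \<Rightarrow> nat list \<Rightarrow> nat list" where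
  "gs_b p = restrict (gs_b_fun p) (tree_words p)"

definition GS_group :: "nat \<Rightarrow> (nat list \<Rightarrow> nat list) monoid" where
  "GS_group p = (Aut_tree p)\<lparr>carrier := generate (Aut_tree p) {gs_a p, gs_b p}\<rparr>"

definition GS_derived :: "nat \<Rightarrow> (nat list \<Rightarrow> nat list) set" where
  "GS_derived p = derived (GS_group p) (carrier (GS_group p))"

definition C_const :: "nat \<Rightarrow> real" where
  "C_const p = 3 * 4 ^ p - 2 ^ p * (real p + 8) + 7"

end

theory Submission
  imports Defs "HOL-Number_Theory.Cong"
begin

text \<open>Let \<open>\<Gamma>\<close> be the Gupta--Sidki group (\<open>Gam\<close> below), \<open>K\<close> its derived subgroup, \<open>D\<close> the operation that
sends a set \<open>H\<close> of automorphisms to the product of \<open>p\<close> copies of \<open>H\<close> acting below the first level,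
and \<open>V n\<close> the \<open>n\<close>-fold image of \<open>K\<close> under \<open>D\<close>. Because \<open>\<Gamma>\<close> branches
over \<open>K\<close>, the \<open>V n\<close> form a descending chain of normal subgroups of \<open>\<Gamma>\<close>. The theorem
is an approximation argument along this chain, in the spirit of Solovay and Kitaev: if every
element of \<open>V m\<close> agrees modulo \<open>V (m + 1)\<close> with a word of length at most \<open>L\<close>, then every element of
\<open>V (m + 1)\<close> agrees modulo \<open>V (m + 2)\<close> with a word of length at most \<open>5 * 2 ^ p * L\<close>. Since
\<open>5 * 2 ^ p\<close> is at most \<open>C_const p\<close>, summing the geometric series gives the first bound. Its
initial value is the diameter of \<open>\<Gamma> / V 1\<close>, which depends neither on \<open>n\<close> nor on the generating set.
The second bound follows because the index of \<open>V n\<close> is at least \<open>2\<close> to the power \<open>p ^ (n - 1)\<close>.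

The new words are products of commutators of old ones. All computations take place at one vertex
and are then carried out at all vertices of a level independently of each other
(\<open>cmt_covers_lift\<close>). Locally the structure is described by functions with values modulo \<open>p\<close>: the
exponent sums \<open>rot\<close> and \<open>expb\<close> of \<open>a\<close> and \<open>b\<close>, which are homomorphisms with common kernel \<open>K\<close> on
\<open>\<Gamma>\<close>; the exponent vector \<open>evec x\<close> of \<open>x\<close>, which lists the values of \<open>expb\<close> on the coordinates of
\<open>x\<close> and is additive on the stabiliser of the first level; and its first moment \<open>lam\<close>, which on
commutators is the determinant \<open>rot x * expb y - rot y * expb x\<close> (\<open>lam_cmt\<close>). Conjugation by \<open>a\<close>
shifts exponent vectors, so the commutator with \<open>a\<close> acts as the difference operator \<open>nab\<close>. Modulo
\<open>p\<close> this operator is nilpotent of order \<open>p\<close>, and it filters \<open>K\<close> by subgroups \<open>Wf i\<close> with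
\<open>Wf 0 = K\<close>, with \<open>Wf 1\<close> the kernel of \<open>lam\<close> on \<open>K\<close>, and with \<open>Wf (p - 1)\<close> contained in \<open>V 1\<close>.

The elements of \<open>V 1\<close> are \<open>p\<close>-tuples of elements of \<open>K\<close>, and they are approximated in three stages.
Modulo \<open>D (Wf 1)\<close> such a tuple is a vector \<open>t\<close> of values of \<open>lam\<close>. Commutators of \<open>K\<close> with an
element whose coordinates have exponents \<open>rot = 0\<close> and \<open>expb = 1\<close> realise every vector whose sum
and first moment vanish (\<open>covers_middle\<close>). The two missing dimensions come from commutators of \<open>K\<close>
with an element of \<open>b K\<close>, and such an element is available at every vertex because it is a
coordinate of an approximation on the previous level (\<open>covers_top\<close>, \<open>ones_subset\<close>); for \<open>p = 3\<close> the
commutators of elements of \<open>K\<close> alone would give only one of the three dimensions. Finally, a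
commutator with an element whose coordinates all rotate by one leads from \<open>D (Wf i)\<close> to
\<open>D (Wf (i + 1))\<close> (\<open>covers_descend\<close>). In each stage the value of the commutator, to the precision
of the stage, depends only on the known part of its entries, which is why approximate entries
suffice. A stage of the last kind turns length \<open>d\<close> into \<open>2 * d + 2 * L\<close>, and \<open>p - 2\<close> of them account
for the factor \<open>2 ^ p\<close>.\<close>

section \<open>The automorphism group of the tree\<close>

lemma Aut_tree_subgroup:
  "subgroup {f \<in> Bij (tree_words p). \<forall>u\<in>tree_words p. \<forall>v\<in>tree_words p. prefix (f u) (f v) \<longleftrightarrow> prefix u v}
     (BijGroup (tree_words p))"
  (is "subgroup ?H (BijGroup ?W)")
proof -
  interpret B: group "BijGroup ?W" by (rule group_BijGroup)
  show ?thesis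
  proof
    show "?H \<subseteq> carrier (BijGroup ?W)" by (auto simp: BijGroup_def)
    show "\<one>\<^bsub>BijGroup ?W\<^esub> \<in> ?H" by (auto simp: BijGroup_def id_Bij)
  next
    fix f g assume "f \<in> ?H" "g \<in> ?H"
    moreover have "g u \<in> ?W" if "g \<in> ?H" "u \<in> ?W" for g u using that by (auto simp: Bij_def bij_betw_def)
    ultimately show "f \<otimes>\<^bsub>BijGroup ?W\<^esub> g \<in> ?H" by (auto simp: BijGroup_def compose_Bij compose_eq)
  next
    fix f assume f: "f \<in> ?H"
    hence fB: "f \<in> Bij ?W" by simp
    have i: "inv\<^bsub>BijGroup ?W\<^esub> f = restrict (inv_into ?W f) ?W" using fB by (rule inv_BijGroup)
    have r: "restrict (inv_into ?W f) ?W \<in> Bij ?W" using fB by (rule restrict_inv_into_Bij)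
    have "prefix (inv_into ?W f u) (inv_into ?W f v) \<longleftrightarrow> prefix u v" if "u \<in> ?W" "v \<in> ?W" for u v
    proof -
      have "f ` ?W = ?W" using fB by (auto simp: Bij_def bij_betw_def)
      hence "inv_into ?W f u \<in> ?W" "inv_into ?W f v \<in> ?W" "f (inv_into ?W f u) = u" "f (inv_into ?W f v) = v"
        using that by (auto intro: inv_into_into f_inv_into_f)
      with f show ?thesis by force
    qed
    thus "inv\<^bsub>BijGroup ?W\<^esub> f \<in> ?H" using i r by auto
  qed
qed

lemma group_Aut_tree: "group (Aut_tree p)"
  unfolding Aut_tree_def
  by (rule subgroup.subgroup_is_group[OF Aut_tree_subgroup group_BijGroup])

lemma Aut_tree_iff:
  "f \<in> carrier (Aut_tree p) \<longleftrightarrow> f \<in> extensional (tree_words p) \<and> bij_betw f (tree_words p) (tree_words p) \<and>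
     (\<forall>u\<in>tree_words p. \<forall>v\<in>tree_words p. prefix (f u) (f v) \<longleftrightarrow> prefix u v)"
  by (auto simp: Aut_tree_def Bij_def)

lemma Aut_mult: "f \<in> carrier (Aut_tree p) \<Longrightarrow> g \<in> carrier (Aut_tree p) \<Longrightarrow>
    f \<otimes>\<^bsub>Aut_tree p\<^esub> g = compose (tree_words p) f g"
  by (auto simp: Aut_tree_def BijGroup_def)

lemma Aut_one: "\<one>\<^bsub>Aut_tree p\<^esub> = (\<lambda>x\<in>tree_words p. x)"
  by (auto simp: Aut_tree_def BijGroup_def)

lemma Cons_tree_words [simp]: "i # w \<in> tree_words p \<longleftrightarrow> i < p \<and> w \<in> tree_words p"
  by (auto simp: tree_words_def)

lemma Nil_tree_words [simp]: "[] \<in> tree_words p"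
  by (auto simp: tree_words_def)

locale gupta_sidki =
  fixes p :: nat
  assumes prime_p: "prime p" and odd_p: "odd p"
begin

abbreviation G where "G \<equiv> Aut_tree p"
abbreviation W where "W \<equiv> tree_words p"
abbreviation gmult (infixl "\<cdot>" 70) where "x \<cdot> y \<equiv> x \<otimes>\<^bsub>G\<^esub> y"
abbreviation ginv ("inv\<^sub>A _" [81] 80) where "inv\<^sub>A x \<equiv> inv\<^bsub>G\<^esub> x"
abbreviation gone ("\<one>\<^sub>A") where "\<one>\<^sub>A \<equiv> \<one>\<^bsub>G\<^esub>"
abbreviation a where "a \<equiv> gs_a p"
abbreviation b where "b \<equiv> gs_b p"

sublocale G: group G by (rule group_Aut_tree)

lemma p_ge_3: "3 \<le> p"
  using prime_ge_2_nat[OF prime_p] odd_p by (cases "p = 2") auto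

lemma Aut_maps: "x \<in> carrier G \<Longrightarrow> w \<in> W \<Longrightarrow> x w \<in> W"
  by (auto simp: Aut_tree_iff bij_betw_def)

lemma Aut_ext: "x \<in> carrier G \<Longrightarrow> y \<in> carrier G \<Longrightarrow> (\<And>w. w \<in> W \<Longrightarrow> x w = y w) \<Longrightarrow> x = y"
  by (auto simp: Aut_tree_iff intro: extensionalityI)

lemma Aut_mult_apply: "x \<in> carrier G \<Longrightarrow> y \<in> carrier G \<Longrightarrow> w \<in> W \<Longrightarrow> (x \<cdot> y) w = x (y w)"
  by (simp add: Aut_mult compose_eq)

lemma Aut_one_apply [simp]: "w \<in> W \<Longrightarrow> \<one>\<^sub>A w = w"
  by (simp add: Aut_one)

lemma Aut_inv_apply: "x \<in> carrier G \<Longrightarrow> w \<in> W \<Longrightarrow> (inv\<^sub>A x) (x w) = w"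
  by (metis Aut_mult_apply Aut_one_apply G.inv_closed G.l_inv)

lemma Aut_apply_inv: "x \<in> carrier G \<Longrightarrow> w \<in> W \<Longrightarrow> x ((inv\<^sub>A x) w) = w"
  by (metis Aut_mult_apply Aut_one_apply G.inv_closed G.r_inv)

lemma Aut_Nil: assumes x: "x \<in> carrier G" shows "x [] = []"
proof -
  have inj: "inj_on x W" using x by (auto simp: Aut_tree_iff bij_betw_def)
  have "prefix (x []) v" if v: "v \<in> W" for v
  proof -
    have "x ((inv\<^sub>A x) v) = v" using Aut_apply_inv x v by blast
    moreover have "(inv\<^sub>A x) v \<in> W" using x v Aut_maps by blast
    ultimately show ?thesis using x by (metis Aut_tree_iff Nil_prefix Nil_tree_words)
  qed
  from this[of "[]"] show ?thesis by simp
qed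

text \<open>The section of an automorphism at the vertex \<open>i\<close> of the first level.\<close>
definition sec :: "(nat list \<Rightarrow> nat list) \<Rightarrow> nat \<Rightarrow> nat list \<Rightarrow> nat list" where
  "sec x i = (\<lambda>w\<in>W. tl (x (i # w)))"

text \<open>Wreath recursion: \<open>x\<close> rotates the first level by \<open>s\<close> and has the sections \<open>\<psi> i\<close>. All
automorphisms considered have such a form, since \<open>a\<close> and \<open>b\<close> have one; it replaces computations
with words by computations with \<open>s\<close> and \<open>\<psi>\<close>.\<close>
definition wreath_form :: "(nat list \<Rightarrow> nat list) \<Rightarrow> nat \<Rightarrow> (nat \<Rightarrow> nat list \<Rightarrow> nat list) \<Rightarrow> bool" where
  "wreath_form x s \<psi> \<longleftrightarrow> x \<in> carrier G \<and>
     (\<forall>i<p. \<psi> i \<in> carrier G \<and> (\<forall>w\<in>W. x (i # w) = ((i + s) mod p) # \<psi> i w))"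

lemma wreath_formD: "wreath_form x s \<psi> \<Longrightarrow> x \<in> carrier G"
  "wreath_form x s \<psi> \<Longrightarrow> i < p \<Longrightarrow> \<psi> i \<in> carrier G"
  "wreath_form x s \<psi> \<Longrightarrow> i < p \<Longrightarrow> w \<in> W \<Longrightarrow> x (i # w) = ((i + s) mod p) # \<psi> i w"
  by (auto simp: wreath_form_def)

lemma wreath_form_sec:
  assumes "wreath_form x s \<psi>" "i < p" shows "sec x i = \<psi> i"
proof -
  have "\<psi> i \<in> extensional W" using assms by (auto simp: wreath_form_def Aut_tree_iff)
  thus ?thesis using assms by (auto simp: sec_def wreath_form_def intro: extensionalityI)
qed

lemma wreath_form_mult:
  assumes x: "wreath_form x s \<psi>" and y: "wreath_form y t \<chi>"
  shows "wreath_form (x \<cdot> y) (s + t) (\<lambda>i. \<psi> ((i + t) mod p) \<cdot> \<chi> i)"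
proof -
  have lt: "k mod p < p" for k using p_ge_3 by simp
  have 1: "((i + t) mod p + s) mod p = (i + (s + t)) mod p" for i
    by (metis add.assoc add.commute mod_add_left_eq)
  note xD = wreath_formD[OF x] and yD = wreath_formD[OF y]
  show ?thesis
    unfolding wreath_form_def
  proof (intro conjI allI impI ballI)
    show "x \<cdot> y \<in> carrier G" using xD(1) yD(1) by (rule G.m_closed)
    fix i assume i: "i < p"
    show "\<psi> ((i + t) mod p) \<cdot> \<chi> i \<in> carrier G" using xD(2)[OF lt] yD(2)[OF i] by (rule G.m_closed)
    fix w assume w: "w \<in> W"
    have "(x \<cdot> y) (i # w) = x (((i + t) mod p) # \<chi> i w)"
      using Aut_mult_apply[OF xD(1) yD(1)] yD(3)[OF i w] i w by simp
    also have "\<dots> = ((i + (s + t)) mod p) # \<psi> ((i + t) mod p) (\<chi> i w)"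
      using xD(3)[OF lt Aut_maps[OF yD(2)[OF i] w]] by (simp only: 1)
    also have "\<psi> ((i + t) mod p) (\<chi> i w) = (\<psi> ((i + t) mod p) \<cdot> \<chi> i) w"
      using Aut_mult_apply[OF xD(2)[OF lt] yD(2)[OF i] w] by simp
    finally show "(x \<cdot> y) (i # w) = ((i + (s + t)) mod p) # (\<psi> ((i + t) mod p) \<cdot> \<chi> i) w" .
  qed
qed

lemma wreath_form_inv:
  assumes x: "wreath_form x s \<psi>" and s: "s \<le> p"
  shows "wreath_form (inv\<^sub>A x) (p - s) (\<lambda>i. inv\<^sub>A (\<psi> ((i + (p - s)) mod p)))"
  unfolding wreath_form_def
proof (intro conjI allI impI ballI)
  have lt: "k mod p < p" for k using p_ge_3 by simp
  note xD = wreath_formD[OF x]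
  show "inv\<^sub>A x \<in> carrier G" using xD by simp
  fix i assume i: "i < p"
  let ?k = "(i + (p - s)) mod p"
  show "inv\<^sub>A (\<psi> ?k) \<in> carrier G" using xD lt by simp
  fix w assume w: "w \<in> W"
  have \<psi>k: "\<psi> ?k \<in> carrier G" by (rule xD(2)[OF lt])
  have v: "(inv\<^sub>A (\<psi> ?k)) w \<in> W" using Aut_maps[OF G.inv_closed[OF \<psi>k] w] .
  have "x (?k # (inv\<^sub>A (\<psi> ?k)) w) = ((?k + s) mod p) # \<psi> ?k ((inv\<^sub>A (\<psi> ?k)) w)"
    by (rule xD(3)[OF lt v])
  also have "(?k + s) mod p = i" using s i by (simp add: mod_add_left_eq)
  also have "\<psi> ?k ((inv\<^sub>A (\<psi> ?k)) w) = w" by (rule Aut_apply_inv[OF \<psi>k w])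
  finally have e: "x (?k # (inv\<^sub>A (\<psi> ?k)) w) = i # w" .
  have "?k # (inv\<^sub>A (\<psi> ?k)) w \<in> W" using v lt by simp
  from Aut_inv_apply[OF xD(1) this]
  show "(inv\<^sub>A x) (i # w) = ?k # (inv\<^sub>A (\<psi> ?k)) w"
    by (simp only: e)
qed

definition tup :: "(nat \<Rightarrow> nat list \<Rightarrow> nat list) \<Rightarrow> nat list \<Rightarrow> nat list" where
  "tup \<psi> = (\<lambda>w\<in>W. case w of [] \<Rightarrow> [] | i # v \<Rightarrow> i # \<psi> i v)"

text \<open>A criterion for building automorphisms by wreath recursion: a permutation of the first
level together with an automorphism below each of its vertices.\<close>
lemma Aut_caseI:
  assumes ext: "x \<in> extensional W" and nil: "x [] = []"
    and \<pi>: "bij_betw \<pi> {..<p} {..<p}" and \<psi>: "\<And>i. i < p \<Longrightarrow> \<psi> i \<in> carrier G"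
    and step: "\<And>i w. i < p \<Longrightarrow> w \<in> W \<Longrightarrow> x (i # w) = \<pi> i # \<psi> i w"
  shows "x \<in> carrier G"
proof -
  have \<pi>W: "\<pi> i < p" if "i < p" for i using \<pi> that by (auto simp: bij_betw_def)
  have inW: "x w \<in> W" if "w \<in> W" for w
    using that Aut_maps[OF \<psi>] by (cases w) (auto simp: nil step \<pi>W)
  have pre: "prefix (x u) (x v) \<longleftrightarrow> prefix u v" if "u \<in> W" "v \<in> W" for u v
  proof (cases u)
    case Nil thus ?thesis by (simp add: nil)
  next
    case u: (Cons i u')
    show ?thesis
    proof (cases v)
      case Nil thus ?thesis using u that by (simp add: nil step)
    next
      case v: (Cons j v')
      have "\<pi> i = \<pi> j \<longleftrightarrow> i = j" using \<pi> u v that by (auto simp: bij_betw_def inj_on_def)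
      moreover have "prefix (\<psi> i u') (\<psi> i v') \<longleftrightarrow> prefix u' v'"
        using \<psi>[of i] u v that by (auto simp: Aut_tree_iff)
      ultimately show ?thesis using u v that by (auto simp: step)
    qed
  qed
  have inj: "inj_on x W"
    by (rule inj_onI) (metis pre prefix_order.eq_iff)
  have surj: "w \<in> x ` W" if wW: "w \<in> W" for w
  proof (cases w)
    case Nil thus ?thesis using nil by (metis Nil_tree_words image_iff)
  next
    case (Cons j v)
    then obtain i where i: "i < p" "\<pi> i = j" using \<pi> wW unfolding bij_betw_def
      by (metis Cons_tree_words imageE lessThan_iff)
    let ?v = "(inv\<^sub>A (\<psi> i)) v"
    have v: "v \<in> W" using Cons wW by simp
    have vW: "?v \<in> W" using Aut_maps[OF G.inv_closed[OF \<psi>[OF i(1)]] v] .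
    have "x (i # ?v) = w" using step[OF i(1) vW] i v Cons Aut_apply_inv[OF \<psi>[OF i(1)] v] by simp
    moreover have "i # ?v \<in> W" using i vW by simp
    ultimately show ?thesis by blast
  qed
  show ?thesis unfolding Aut_tree_iff bij_betw_def using ext inj surj inW pre by blast
qed

lemma tup_wreath:
  assumes "\<And>i. i < p \<Longrightarrow> \<psi> i \<in> carrier G" shows "wreath_form (tup \<psi>) 0 \<psi>"
proof -
  have "tup \<psi> \<in> carrier G"
    by (rule Aut_caseI[where \<pi> = id and \<psi> = \<psi>]) (use assms in \<open>auto simp: tup_def\<close>)
  thus ?thesis using assms by (auto simp: wreath_form_def tup_def)
qed

lemma a_wreath: "wreath_form a 1 (\<lambda>_. \<one>\<^sub>A)"
proof -
  have m: "(i + 1) mod p = (if i = p - 1 then 0 else i + 1)" if "i < p" for i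
    using that p_ge_3 by (auto simp: mod_if)
  have bij: "bij_betw (\<lambda>i. (i + 1) mod p) {..<p} {..<p}"
  proof (rule bij_betw_imageI)
    show inj: "inj_on (\<lambda>i. (i + 1) mod p) {..<p}" using m by (auto simp: inj_on_def split: if_splits)
    show "(\<lambda>i. (i + 1) mod p) ` {..<p} = {..<p}"
      by (rule endo_inj_surj[OF _ _ inj]) (use p_ge_3 in auto)
  qed
  have st: "a (i # w) = ((i + 1) mod p) # \<one>\<^sub>A w" if "i < p" "w \<in> W" for i w
    using that m[OF that(1)] by (simp add: gs_a_def)
  have "a \<in> carrier G"
    by (rule Aut_caseI[where \<pi> = "\<lambda>i. (i + 1) mod p" and \<psi> = "\<lambda>_. \<one>\<^sub>A"])
      (use bij st in \<open>auto simp: gs_a_def\<close>)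
  thus ?thesis using st by (auto simp: wreath_form_def)
qed

definition b_tup :: "nat \<Rightarrow> nat list \<Rightarrow> nat list" where
  "b_tup i = (if i = 0 then a else if i = 1 then inv\<^sub>A a else if i = p - 1 then b else \<one>\<^sub>A)"

text \<open>The criterion above cannot be applied to \<open>b\<close>, because \<open>b\<close> occurs among its own sections;
bijectivity is proved by induction on the length of words instead.\<close>
lemma b_Aut: "b \<in> carrier G"
proof -
  let ?f = "gs_b_fun p"
  have aA: "a \<in> carrier G" using a_wreath wreath_formD by blast
  define c where "c i = (if i = 0 then a else if i = 1 then inv\<^sub>A a else \<one>\<^sub>A)" for i :: nat
  have cA: "c i \<in> carrier G" for i using aA by (simp add: c_def)
  have step: "?f (i # w) = i # (if i = p - 1 then ?f w else c i w)" if "w \<in> W" for i w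
    using that p_ge_3 by (auto simp: c_def)
  have inW: "w \<in> W \<Longrightarrow> ?f w \<in> W" for w
  proof (induction w)
    case (Cons i w)
    thus ?case using step[of w i] Aut_maps[OF cA] by auto
  qed simp
  have pre: "u \<in> W \<Longrightarrow> v \<in> W \<Longrightarrow> prefix (?f u) (?f v) \<longleftrightarrow> prefix u v" for u v
  proof (induction u arbitrary: v)
    case (Cons i u)
    show ?case
    proof (cases v)
      case Nil thus ?thesis using Cons step[of u i] by (simp del: gs_b_fun.simps(2))
    next
      case (Cons j v')
      have "prefix (c i u) (c i v') \<longleftrightarrow> prefix u v'" 
        using cA[of i] Cons Cons.prems Cons_tree_words unfolding Aut_tree_iff \<open>v = j # v'\<close> 
        using \<open>i # u \<in> W\<close> \<open>v \<in> W\<close> by auto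
      thus ?thesis using Cons.IH[of v'] \<open>i # u \<in> W\<close> \<open>v \<in> W\<close> Cons step[of u i] step[of v' j]
        by (auto simp del: gs_b_fun.simps(2))
    qed
  qed simp
  have inj: "inj_on ?f W"
    by (rule inj_onI) (metis pre prefix_order.eq_iff)
  have surj: "w \<in> W \<Longrightarrow> w \<in> ?f ` W" for w
  proof (induction w)
    case Nil thus ?case by (force intro: image_eqI[of _ _ "[]"])
  next
    case (Cons i w)
    hence w: "w \<in> W" and i: "i < p" by auto
    obtain v where v: "v \<in> W" "w = (if i = p - 1 then ?f v else c i v)"
    proof (cases "i = p - 1")
      case True thus ?thesis using Cons w that by auto
    next
      case False
      thus ?thesis using that[of "(inv\<^sub>A (c i)) w"] Aut_maps[OF G.inv_closed[OF cA] w]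
          Aut_apply_inv[OF cA w] by auto
    qed
    have "?f (i # v) = i # w" using step[OF v(1), of i] v by simp
    moreover have "i # v \<in> W" using v i by simp
    ultimately show ?case by (metis image_eqI)
  qed
  have "bij_betw ?f W W" unfolding bij_betw_def using inj surj inW by blast
  hence "bij_betw b W W" unfolding gs_b_def by (simp add: bij_betw_restrict_eq)
  moreover have "prefix (b u) (b v) \<longleftrightarrow> prefix u v" if "u \<in> W" "v \<in> W" for u v
    using pre that by (simp add: gs_b_def)
  ultimately show ?thesis unfolding Aut_tree_iff by (auto simp: gs_b_def)
qed

lemma b_wreath: "wreath_form b 0 b_tup"
proof -
  have aA: "a \<in> carrier G" using a_wreath wreath_formD by blast
  have "b (i # w) = i # b_tup i w" if "i < p" "w \<in> W" for i w
    using that p_ge_3 by (auto simp: b_tup_def gs_b_def)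
  thus ?thesis using aA b_Aut by (auto simp: wreath_form_def b_tup_def)
qed


section \<open>Periodic functions modulo p\<close>

definition eqp :: "int \<Rightarrow> int \<Rightarrow> bool" (infix "\<simeq>" 50) where
  "x \<simeq> y \<longleftrightarrow> [x = y] (mod int p)"

lemma eqp_refl [simp, intro]: "x \<simeq> x" by (simp add: eqp_def)
lemma eqp_sym: "x \<simeq> y \<Longrightarrow> y \<simeq> x" by (simp add: eqp_def cong_sym)
lemma eqp_trans [trans]: "x \<simeq> y \<Longrightarrow> y \<simeq> z \<Longrightarrow> x \<simeq> z" unfolding eqp_def by (rule cong_trans)
lemma eqp_add: "x \<simeq> y \<Longrightarrow> x' \<simeq> y' \<Longrightarrow> x + x' \<simeq> y + y'" unfolding eqp_def by (rule cong_add)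
lemma eqp_diff: "x \<simeq> y \<Longrightarrow> x' \<simeq> y' \<Longrightarrow> x - x' \<simeq> y - y'" unfolding eqp_def by (rule cong_diff)
lemma eqp_mult: "x \<simeq> y \<Longrightarrow> x' \<simeq> y' \<Longrightarrow> x * x' \<simeq> y * y'" unfolding eqp_def by (rule cong_mult)
lemma eqp_sum: "(\<And>i. i \<in> A \<Longrightarrow> u i \<simeq> v i) \<Longrightarrow> sum u A \<simeq> sum v A" unfolding eqp_def by (rule cong_sum)
lemma eqp_dvd: "x \<simeq> y \<longleftrightarrow> int p dvd x - y" by (simp add: eqp_def cong_iff_dvd_diff)
lemma eqp_diff_0: "x - y \<simeq> 0 \<longleftrightarrow> x \<simeq> y" by (simp add: eqp_dvd)
lemma eqp_mod: "x \<simeq> y \<longleftrightarrow> x mod int p = y mod int p" by (simp add: eqp_def cong_def)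
lemma eqp_neg: assumes "0 \<simeq> x + y" shows "y \<simeq> - x"
proof -
  have "int p dvd - (x + y)" using assms by (simp add: eqp_dvd)
  hence "int p dvd x + y" by (simp only: dvd_minus_iff)
  thus ?thesis by (simp add: eqp_dvd add.commute)
qed

definition cyc :: "(int \<Rightarrow> int) \<Rightarrow> bool" where
  "cyc u \<longleftrightarrow> (\<forall>j. u (j + int p) \<simeq> u j)"

abbreviation csum :: "(int \<Rightarrow> int) \<Rightarrow> int" where
  "csum u \<equiv> (\<Sum>j\<in>{0..<int p}. u j)"

lemma p_pos: "0 < int p" using p_ge_3 by simp

lemma cyc_mod: assumes "cyc u" shows "u (j mod int p) \<simeq> u j"
proof -
  have n: "u (j + int n * int p) \<simeq> u j" for j n
  proof (induction n)
    case (Suc n)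
    have "u (j + int (Suc n) * int p) = u (j + int n * int p + int p)" by (simp add: algebra_simps)
    also have "\<dots> \<simeq> u (j + int n * int p)" using assms by (simp add: cyc_def)
    finally show ?case using Suc eqp_trans by blast
  qed simp
  show ?thesis
  proof (cases "j \<ge> 0")
    case True
    have "j = j mod int p + int (nat (j div int p)) * int p" using True p_pos by (simp add: pos_imp_zdiv_nonneg_iff)
    thus ?thesis using n[of "j mod int p" "nat (j div int p)"] by (simp add: eqp_sym)
  next
    case False
    hence "j div int p < 0" using p_pos by (simp add: pos_imp_zdiv_neg_iff)
    hence "j mod int p = j + int (nat (- (j div int p))) * int p"
      by (simp add: minus_div_mult_eq_mod[symmetric])
    thus ?thesis using n[of j "nat (- (j div int p))"] by simp
  qed
qed

lemma cyc_cong: assumes "cyc u" "i \<simeq> j" shows "u i \<simeq> u j"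
  using cyc_mod[OF assms(1), of i] cyc_mod[OF assms(1), of j] assms(2) by (simp add: eqp_mod)

lemma csum_cong: "(\<And>j. u j \<simeq> v j) \<Longrightarrow> csum u \<simeq> csum v"
  by (intro eqp_sum) auto

text \<open>Sums over a full period are invariant under translation. This turns the cocycle
identities below into homomorphism identities.\<close>
lemma csum_shift: assumes "cyc u" shows "csum (\<lambda>j. u (j + s)) \<simeq> csum u"
proof -
  have "csum (\<lambda>j. u (j + s)) \<simeq> csum (\<lambda>j. u ((j + s) mod int p))"
    using cyc_mod[OF assms] by (intro csum_cong) (rule eqp_sym)
  also have "csum (\<lambda>j. u ((j + s) mod int p)) = csum u"
    by (rule sum.reindex_bij_witness[where i = "\<lambda>j. (j - s) mod int p" and j = "\<lambda>j. (j + s) mod int p"])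
      (use p_pos in \<open>auto simp: mod_simps\<close>)
  finally show ?thesis .
qed

lemma cyc_shift: "cyc u \<Longrightarrow> cyc (\<lambda>j. u (j + s))"
  unfolding cyc_def
proof
  fix j assume u: "\<forall>j. u (j + int p) \<simeq> u j"
  have e: "j + int p + s = (j + s) + int p" by simp
  show "u (j + int p + s) \<simeq> u (j + s)" unfolding e using u by blast
qed

lemma cyc_add: "cyc u \<Longrightarrow> cyc v \<Longrightarrow> cyc (\<lambda>j. u j + v j)"
  by (auto simp: cyc_def intro: eqp_add)
lemma cyc_diff: "cyc u \<Longrightarrow> cyc v \<Longrightarrow> cyc (\<lambda>j. u j - v j)"
  by (auto simp: cyc_def intro: eqp_diff)
lemma cyc_mult: "cyc u \<Longrightarrow> cyc v \<Longrightarrow> cyc (\<lambda>j. u j * v j)"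
  by (auto simp: cyc_def intro: eqp_mult)
lemma cyc_const: "cyc (\<lambda>j. c)" by (simp add: cyc_def)
lemma cyc_id: "cyc (\<lambda>j. j)" by (simp add: cyc_def eqp_mod)

lemmas cyc_intros = cyc_add cyc_diff cyc_mult cyc_const cyc_id

section \<open>The Gupta--Sidki group\<close>

definition Gam :: "(nat list \<Rightarrow> nat list) set" where "Gam = generate G {a, b}"

definition rot :: "(nat list \<Rightarrow> nat list) \<Rightarrow> int" where "rot x = int (hd (x [0]))"

text \<open>The sections with an integer index read modulo \<open>p\<close>, so that a rotation of the first level
becomes a translation of the index (see \<open>sc_mult\<close> below).\<close>
definition sc :: "(nat list \<Rightarrow> nat list) \<Rightarrow> int \<Rightarrow> nat list \<Rightarrow> nat list" where
  "sc x j = sec x (nat (j mod int p))"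

lemma a_carrier [simp]: "a \<in> carrier G" using a_wreath wreath_formD by blast
lemma b_carrier [simp]: "b \<in> carrier G" by (rule b_Aut)

lemma Gam_subgroup: "subgroup Gam G"
  unfolding Gam_def by (rule G.generate_is_subgroup) simp

lemma Gam_carrier [simp]: "x \<in> Gam \<Longrightarrow> x \<in> carrier G"
  by (rule subgroup.mem_carrier[OF Gam_subgroup])
lemma Gam_mult [simp]: "x \<in> Gam \<Longrightarrow> y \<in> Gam \<Longrightarrow> x \<cdot> y \<in> Gam"
  by (rule subgroup.m_closed[OF Gam_subgroup])
lemma Gam_inv [simp]: "x \<in> Gam \<Longrightarrow> inv\<^sub>A x \<in> Gam"
  by (rule subgroup.m_inv_closed[OF Gam_subgroup])
lemma Gam_one [simp]: "\<one>\<^sub>A \<in> Gam"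
  by (rule subgroup.one_closed[OF Gam_subgroup])
lemma Gam_gens [simp]: "a \<in> Gam" "b \<in> Gam"
  by (auto simp: Gam_def intro: generate.incl)
lemma Gam_pow [simp]: "x \<in> Gam \<Longrightarrow> x [^]\<^bsub>G\<^esub> (n::nat) \<in> Gam"
  by (induction n) auto

lemma Gam_induct [consumes 1, case_names one a b inv_a inv_b mult]:
  assumes "x \<in> Gam" "P \<one>\<^sub>A" "P a" "P b" "P (inv\<^sub>A a)" "P (inv\<^sub>A b)"
    "\<And>x y. x \<in> Gam \<Longrightarrow> y \<in> Gam \<Longrightarrow> P x \<Longrightarrow> P y \<Longrightarrow> P (x \<cdot> y)"
  shows "P x"
  using assms(1) unfolding Gam_def
  by (induction rule: generate.induct) (use assms(2-) in \<open>auto simp: Gam_def\<close>)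

lemma one_wreath: "wreath_form \<one>\<^sub>A 0 (\<lambda>_. \<one>\<^sub>A)"
  by (simp add: wreath_form_def)

lemma Gam_wreath_ex:
  assumes "x \<in> Gam" shows "\<exists>s \<psi>. s \<le> p \<and> wreath_form x s \<psi> \<and> (\<forall>i<p. \<psi> i \<in> Gam)"
proof -
  have red: "wreath_form x (s mod p) \<psi>" if "wreath_form x s \<psi>" for x s \<psi>
    using that by (simp add: wreath_form_def mod_add_right_eq)
  have lt: "k mod p < p" for k using p_ge_3 by simp
  have inv: "\<exists>s \<psi>. s \<le> p \<and> wreath_form (inv\<^sub>A x) s \<psi> \<and> (\<forall>i<p. \<psi> i \<in> Gam)"
    if "s \<le> p \<and> wreath_form x s \<psi> \<and> (\<forall>i<p. \<psi> i \<in> Gam)" for x s \<psi>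
    using wreath_form_inv[of x s \<psi>] that lt by (intro exI[of _ "p - s"] exI[of _ "\<lambda>i. inv\<^sub>A (\<psi> ((i + (p - s)) mod p))"]) auto
  have a': "1 \<le> p \<and> wreath_form a 1 (\<lambda>_. \<one>\<^sub>A) \<and> (\<forall>i<p. \<one>\<^sub>A \<in> Gam)" using a_wreath p_ge_3 by auto
  have b': "0 \<le> p \<and> wreath_form b 0 b_tup \<and> (\<forall>i<p. b_tup i \<in> Gam)" using b_wreath
    by (auto simp: b_tup_def)
  show ?thesis using assms
  proof (induction rule: Gam_induct)
    case one show ?case by (intro exI[of _ 0] exI[of _ "\<lambda>_. \<one>\<^sub>A"]) (simp add: one_wreath)
  next
    case a show ?case using a' by blast
  next
    case b show ?case using b' by blast
  next
    case inv_a show ?case using inv[OF a'] .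
  next
    case inv_b show ?case using inv[OF b'] .
  next
    case (mult x y)
    then obtain s \<psi> t \<chi> where *: "wreath_form x s \<psi>" "\<forall>i<p. \<psi> i \<in> Gam" "wreath_form y t \<chi>" "\<forall>i<p. \<chi> i \<in> Gam"
      by blast
    have "wreath_form (x \<cdot> y) ((s + t) mod p) (\<lambda>i. \<psi> ((i + t) mod p) \<cdot> \<chi> i)"
      using wreath_form_mult[OF *(1,3)] by (rule red)
    moreover have "\<forall>i<p. \<psi> ((i + t) mod p) \<cdot> \<chi> i \<in> Gam" using *(2,4) lt by simp
    moreover have "(s + t) mod p \<le> p" using lt less_imp_le by blast
    ultimately show ?case by blast
  qed
qed

lemma wreath_form_rot: assumes "wreath_form x s \<psi>" shows "rot x = int (s mod p)"
  using wreath_formD(3)[OF assms, of 0 "[]"] p_ge_3 by (simp add: rot_def)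

lemma Gam_wreath:
  assumes "x \<in> Gam"
  shows "wreath_form x (nat (rot x)) (sec x)" "i < p \<Longrightarrow> sec x i \<in> Gam"
proof -
  obtain s \<psi> where *: "wreath_form x s \<psi>" "\<forall>i<p. \<psi> i \<in> Gam" using Gam_wreath_ex[OF assms] by blast
  show "wreath_form x (nat (rot x)) (sec x)"
    using *(1) wreath_form_sec[OF *(1)] by (simp add: wreath_form_def wreath_form_rot[OF *(1)] mod_add_right_eq)
  show "i < p \<Longrightarrow> sec x i \<in> Gam" using * wreath_form_sec by simp
qed

lemma nat_mod_less: "nat (j mod int p) < p"
  using p_pos by (simp add: nat_less_iff)

lemma sc_Gam [simp]: "x \<in> Gam \<Longrightarrow> sc x j \<in> Gam"
  unfolding sc_def using Gam_wreath(2) nat_mod_less by blast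

lemma sc_cyc: "sc x (j + int p) = sc x j" by (simp add: sc_def)

lemma sc_mod: "i \<simeq> j \<Longrightarrow> sc x i = sc x j" by (simp add: sc_def eqp_mod)

lemma rot_range: assumes "x \<in> Gam" shows "0 \<le> rot x \<and> rot x < int p"
proof -
  obtain s \<psi> where "wreath_form x s \<psi>" using Gam_wreath_ex[OF assms] by blast
  from wreath_form_rot[OF this] show ?thesis using p_ge_3 by simp
qed

lemma rot_mult: assumes "x \<in> Gam" "y \<in> Gam" shows "rot (x \<cdot> y) \<simeq> rot x + rot y"
proof -
  have "rot (x \<cdot> y) = int ((nat (rot x) + nat (rot y)) mod p)"
    by (rule wreath_form_rot[OF wreath_form_mult[OF Gam_wreath(1) Gam_wreath(1)]]) fact+
  thus ?thesis using rot_range[OF assms(1)] rot_range[OF assms(2)] by (simp add: eqp_mod zmod_int)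
qed

lemma sc_mult: assumes "x \<in> Gam" "y \<in> Gam"
  shows "sc (x \<cdot> y) j = sc x (j + rot y) \<cdot> sc y j"
proof -
  let ?i = "nat (j mod int p)"
  have "sec (x \<cdot> y) ?i = sec x ((?i + nat (rot y)) mod p) \<cdot> sec y ?i"
    using wreath_form_sec[OF wreath_form_mult[OF Gam_wreath(1)[OF assms(1)] Gam_wreath(1)[OF assms(2)]] nat_mod_less] .
  also have "(?i + nat (rot y)) mod p = nat ((j + rot y) mod int p)"
  proof -
    have "int ((?i + nat (rot y)) mod p) = (j + rot y) mod int p"
      using rot_range[OF assms(2)] p_pos by (simp add: zmod_int mod_add_left_eq)
    thus ?thesis by linarith
  qed
  finally show ?thesis by (simp add: sc_def)
qed

lemma rot_one [simp]: "rot \<one>\<^sub>A = 0" using wreath_form_rot[OF one_wreath] by simp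
lemma rot_a [simp]: "rot a = 1" using wreath_form_rot[OF a_wreath] p_ge_3 by simp
lemma rot_b [simp]: "rot b = 0" using wreath_form_rot[OF b_wreath] by simp

lemma sc_one [simp]: "sc \<one>\<^sub>A j = \<one>\<^sub>A"
  unfolding sc_def by (rule wreath_form_sec[OF one_wreath nat_mod_less])
lemma sc_a [simp]: "sc a j = \<one>\<^sub>A"
  unfolding sc_def by (rule wreath_form_sec[OF a_wreath nat_mod_less])
lemma sc_b: "sc b j = b_tup (nat (j mod int p))"
  unfolding sc_def by (rule wreath_form_sec[OF b_wreath nat_mod_less])

text \<open>A cocycle for the action of the group on coordinates vanishes as soon as it vanishes on the
two generators. All identities between exponents are verified in this way.\<close>
lemma cocycle_zero:
  assumes F: "\<And>x y j. x \<in> Gam \<Longrightarrow> y \<in> Gam \<Longrightarrow> F (x \<cdot> y) j \<simeq> F x (j + rot y) + F y j"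
    and a: "\<And>j. F a j \<simeq> 0" and b: "\<And>j. F b j \<simeq> 0" and x: "x \<in> Gam"
  shows "F x j \<simeq> 0"
proof -
  have one: "F \<one>\<^sub>A j \<simeq> 0" for j
    using F[of "\<one>\<^sub>A" "\<one>\<^sub>A" j] by (simp add: eqp_dvd)
  have inv: "F (inv\<^sub>A y) j \<simeq> 0" if y: "y \<in> Gam" and 0: "\<And>j. F y j \<simeq> 0" for y j
  proof -
    have "0 \<simeq> F y (j + rot (inv\<^sub>A y)) + F (inv\<^sub>A y) j"
      using F[of y "inv\<^sub>A y" j] one[of j] y by (simp add: G.r_inv eqp_mod)
    also have "\<dots> \<simeq> 0 + F (inv\<^sub>A y) j" by (intro eqp_add 0 eqp_refl)
    finally show ?thesis by (simp add: eqp_sym)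
  qed
  have mult: "F (x \<cdot> y) j \<simeq> 0" if "x \<in> Gam" "y \<in> Gam" "\<And>j. F x j \<simeq> 0" "\<And>j. F y j \<simeq> 0" for x y j
    using F[OF that(1,2), of j] eqp_add[OF that(3)[of "j + rot y"] that(4)[of j]] by (simp add: eqp_mod)
  from x have "\<forall>j. F x j \<simeq> 0"
    by (induction rule: Gam_induct) (auto intro: one a b inv mult)
  thus ?thesis ..
qed

lemma hom_zero:
  assumes F: "\<And>x y. x \<in> Gam \<Longrightarrow> y \<in> Gam \<Longrightarrow> f (x \<cdot> y) \<simeq> f x + f y"
    and a: "f a \<simeq> 0" and b: "f b \<simeq> 0" and x: "x \<in> Gam"
  shows "f x \<simeq> 0"
  by (rule cocycle_zero[where F = "\<lambda>x j. f x" and j = 0, OF F a b x])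

lemma rot_sc_mult:
  assumes "x \<in> Gam" "y \<in> Gam"
  shows "rot (sc (x \<cdot> y) j) \<simeq> rot (sc x (j + rot y)) + rot (sc y j)"
  using assms by (simp add: sc_mult rot_mult)

lemma cyc_rot_sc: "cyc (\<lambda>j. rot (sc x j))" by (simp add: cyc_def sc_cyc)

lemma rot_inv: assumes "x \<in> Gam" shows "rot (inv\<^sub>A x) \<simeq> - rot x"
  using rot_mult[OF assms Gam_inv[OF assms]] assms by (intro eqp_neg) (simp add: G.r_inv)

lemma rot_sc_b:
  "rot (sc b j) \<simeq> (if j mod int p = 0 then 1 else if j mod int p = 1 then -1 else 0)"
proof -
  have "nat (j mod int p) = 0 \<longleftrightarrow> j mod int p = 0" "nat (j mod int p) = 1 \<longleftrightarrow> j mod int p = 1"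
    using p_pos pos_mod_sign[of "int p" j] by linarith+
  thus ?thesis using rot_inv[of a] by (auto simp: sc_b b_tup_def)
qed

lemma csum_two:
  assumes "\<And>j. 0 \<le> j \<Longrightarrow> j < int p \<Longrightarrow> u j \<simeq> (if j = 0 then c else if j = 1 then d else 0)"
  shows "csum u \<simeq> c + d"
proof -
  have "csum u \<simeq> csum (\<lambda>j. if j = 0 then c else if j = 1 then d else 0)"
    by (intro eqp_sum) (use assms in auto)
  also have "csum (\<lambda>j. if j = 0 then c else if j = 1 then d else 0) =
     (\<Sum>j\<in>{0, 1::int}. if j = 0 then c else if j = 1 then d else 0)"
    by (rule sum.mono_neutral_right) (use p_ge_3 in auto)
  finally show ?thesis by simp
qed

text \<open>The rotations in the sections of \<open>b\<close> are \<open>1\<close>, \<open>-1\<close> and \<open>0\<close>, and they add up to zero. This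
makes the weighted sum in the next definition independent of the point where the indices start.\<close>
lemma csum_rot_sc: assumes "x \<in> Gam" shows "csum (\<lambda>j. rot (sc x j)) \<simeq> 0"
proof (rule hom_zero[where f = "\<lambda>x. csum (\<lambda>j. rot (sc x j))", OF _ _ _ assms])
  fix x y assume xy: "x \<in> Gam" "y \<in> Gam"
  have "csum (\<lambda>j. rot (sc (x \<cdot> y) j)) \<simeq> csum (\<lambda>j. rot (sc x (j + rot y)) + rot (sc y j))"
    by (intro csum_cong rot_sc_mult xy)
  also have "\<dots> = csum (\<lambda>j. rot (sc x (j + rot y))) + csum (\<lambda>j. rot (sc y j))"
    by (rule sum.distrib)
  also have "\<dots> \<simeq> csum (\<lambda>j. rot (sc x j)) + csum (\<lambda>j. rot (sc y j))"
    by (intro eqp_add csum_shift cyc_rot_sc eqp_refl)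
  finally show "csum (\<lambda>j. rot (sc (x \<cdot> y) j)) \<simeq> csum (\<lambda>j. rot (sc x j)) + csum (\<lambda>j. rot (sc y j))" .
next
  have "csum (\<lambda>j. rot (sc b j)) \<simeq> 1 + (-1)"
  proof (rule csum_two)
    fix j assume "0 \<le> j" "j < int p"
    thus "rot (sc b j) \<simeq> (if j = 0 then 1 else if j = 1 then -1 else 0)" using rot_sc_b[of j] by (simp split: if_splits)
  qed
  thus "csum (\<lambda>j. rot (sc b j)) \<simeq> 0" by simp
qed simp

text \<open>The exponent sum of \<open>b\<close>, read off from the action on the second level: the sections of \<open>b\<close>
rotate by \<open>1\<close> at \<open>0\<close> and by \<open>-1\<close> at \<open>1\<close>, so the negative of the first moment is \<open>1\<close> for \<open>b\<close> and
\<open>0\<close> for \<open>a\<close>.\<close>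
definition expb :: "(nat list \<Rightarrow> nat list) \<Rightarrow> int" where
  "expb x = - csum (\<lambda>j. j * rot (sc x j))"

lemma expb_mult: assumes xy: "x \<in> Gam" "y \<in> Gam" shows "expb (x \<cdot> y) \<simeq> expb x + expb y"
proof -
  have "csum (\<lambda>j. j * rot (sc (x \<cdot> y) j)) \<simeq>
      csum (\<lambda>j. (j + rot y) * rot (sc x (j + rot y)) - rot y * rot (sc x (j + rot y)) + j * rot (sc y j))"
  proof (rule csum_cong)
    fix j
    have "j * rot (sc (x \<cdot> y) j) \<simeq> j * (rot (sc x (j + rot y)) + rot (sc y j))"
      by (intro eqp_mult eqp_refl rot_sc_mult xy)
    thus "j * rot (sc (x \<cdot> y) j) \<simeq> (j + rot y) * rot (sc x (j + rot y))
       - rot y * rot (sc x (j + rot y)) + j * rot (sc y j)"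
      by (simp add: algebra_simps)
  qed
  also have "\<dots> = csum (\<lambda>j. (j + rot y) * rot (sc x (j + rot y)))
      - rot y * csum (\<lambda>j. rot (sc x (j + rot y))) + csum (\<lambda>j. j * rot (sc y j))"
    by (simp add: sum.distrib sum_subtractf sum_distrib_left)
  also have "\<dots> \<simeq> csum (\<lambda>j. j * rot (sc x j)) - rot y * 0 + csum (\<lambda>j. j * rot (sc y j))"
    by (intro eqp_add eqp_diff eqp_mult eqp_refl
        csum_shift[where u = "\<lambda>j. j * rot (sc x j)"] cyc_intros cyc_rot_sc
        eqp_trans[OF csum_shift[where u = "\<lambda>j. rot (sc x j)"]] csum_rot_sc xy)
  finally have "0 - csum (\<lambda>j. j * rot (sc (x \<cdot> y) j)) \<simeq>
      0 - (csum (\<lambda>j. j * rot (sc x j)) - rot y * 0 + csum (\<lambda>j. j * rot (sc y j)))"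
    by (intro eqp_diff eqp_refl)
  thus ?thesis by (simp add: expb_def)
qed

lemma expb_one [simp]: "expb \<one>\<^sub>A = 0" and expb_a [simp]: "expb a = 0"
  by (simp_all add: expb_def)

lemma expb_b: "expb b \<simeq> 1"
proof -
  have "csum (\<lambda>j. j * rot (sc b j)) \<simeq> 0 + (-1)"
  proof (rule csum_two)
    fix j assume "0 \<le> j" "j < int p"
    thus "j * rot (sc b j) \<simeq> (if j = 0 then 0 else if j = 1 then -1 else 0)"
      using eqp_mult[OF eqp_refl[of j] rot_sc_b[of j]] by (auto split: if_splits)
  qed
  hence "0 - csum (\<lambda>j. j * rot (sc b j)) \<simeq> 0 - (0 + (-1))" by (intro eqp_diff eqp_refl)
  thus ?thesis by (simp add: expb_def)
qed

lemma expb_inv: assumes "x \<in> Gam" shows "expb (inv\<^sub>A x) \<simeq> - expb x"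
  using expb_mult[OF assms Gam_inv[OF assms]] assms by (intro eqp_neg) (simp add: G.r_inv)

text \<open>Exponent vectors: modulo \<open>D K\<close>, an element of the group that fixes the first level is the product of
the conjugates \<open>a\<^sup>j b a\<^sup>-\<^sup>j\<close> raised to the powers \<open>evec x j\<close>. The index is shifted by one because
the section \<open>b\<close> of \<open>b\<close> sits at position \<open>p - 1\<close>, that is, at \<open>-1\<close>.\<close>
definition evec :: "(nat list \<Rightarrow> nat list) \<Rightarrow> int \<Rightarrow> int" where
  "evec x j = expb (sc x (j - 1))"

lemma cyc_evec: "cyc (evec x)"
  using sc_mod[of "j + int p - 1" "j - 1" x for j] by (simp add: cyc_def evec_def eqp_dvd)

lemma evec_mult: assumes "x \<in> Gam" "y \<in> Gam"
  shows "evec (x \<cdot> y) j \<simeq> evec x (j + rot y) + evec y j"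
  using assms expb_mult[of "sc x (j - 1 + rot y)" "sc y (j - 1)"]
  by (simp add: evec_def sc_mult algebra_simps)

lemma evec_one [simp]: "evec \<one>\<^sub>A j = 0" by (simp add: evec_def)
lemma evec_a [simp]: "evec a j = 0" by (simp add: evec_def)

lemma evec_b: "evec b j \<simeq> (if j mod int p = 0 then 1 else 0)"
proof -
  have r: "nat ((j - 1) mod int p) = p - 1 \<longleftrightarrow> j mod int p = 0"
  proof -
    have "nat ((j - 1) mod int p) = p - 1 \<longleftrightarrow> (j - 1) mod int p = (int p - 1) mod int p"
      using p_ge_3 by (subst mod_pos_pos_trivial[of "int p - 1"]) (auto simp: nat_eq_iff)
    also have "\<dots> \<longleftrightarrow> int p dvd j" 
      by (simp add: mod_eq_dvd_iff)
    finally show ?thesis by (simp add: dvd_eq_mod_eq_0)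
  qed
  have "p - 1 \<noteq> 0" "p - 1 \<noteq> 1" using p_ge_3 by auto
  moreover have "expb (inv\<^sub>A a) \<simeq> 0" using expb_inv[of a] by simp
  ultimately show ?thesis using r expb_b by (auto simp: evec_def sc_b b_tup_def)
qed

lemma csum_evec: assumes "x \<in> Gam" shows "csum (evec x) \<simeq> expb x"
proof -
  have "csum (evec x) - expb x \<simeq> 0"
  proof (rule hom_zero[where f = "\<lambda>x. csum (evec x) - expb x", OF _ _ _ assms])
    fix x y assume xy: "x \<in> Gam" "y \<in> Gam"
    have "csum (evec (x \<cdot> y)) \<simeq> csum (\<lambda>j. evec x (j + rot y) + evec y j)"
      by (intro csum_cong evec_mult xy)
    also have "\<dots> = csum (\<lambda>j. evec x (j + rot y)) + csum (evec y)" by (rule sum.distrib)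
    also have "\<dots> \<simeq> csum (evec x) + csum (evec y)"
      by (intro eqp_add csum_shift cyc_evec eqp_refl)
    finally have "csum (evec (x \<cdot> y)) - expb (x \<cdot> y) \<simeq> csum (evec x) + csum (evec y) - (expb x + expb y)"
      by (intro eqp_diff expb_mult xy)
    thus "csum (evec (x \<cdot> y)) - expb (x \<cdot> y) \<simeq> csum (evec x) - expb x + (csum (evec y) - expb y)"
      by (simp add: algebra_simps)
  next
    have "csum (evec b) \<simeq> 1 + 0" 
    proof (rule csum_two)
      fix j assume "0 \<le> j" "j < int p"
      thus "evec b j \<simeq> (if j = 0 then 1 else if j = 1 then 0 else 0)" using evec_b[of j] by (simp split: if_splits)
    qed
    thus "csum (evec b) - expb b \<simeq> 0" using expb_b by (metis add.right_neutral eqp_diff_0 eqp_sym eqp_trans)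
  qed simp
  thus ?thesis by (simp add: eqp_diff_0)
qed

text \<open>The conjugate with number \<open>j\<close> contributes \<open>a\<close> to the coordinate \<open>j\<close> and its inverse to the
coordinate \<open>j + 1\<close>. Hence the vector determines both exponents of every coordinate.\<close>
lemma rot_sc_evec: assumes "x \<in> Gam" shows "rot (sc x j) \<simeq> evec x j - evec x (j - 1)"
proof -
  have "rot (sc x j) - (evec x j - evec x (j - 1)) \<simeq> 0"
  proof (rule cocycle_zero[where F = "\<lambda>x j. rot (sc x j) - (evec x j - evec x (j - 1))", OF _ _ _ assms])
    fix x y j assume xy: "x \<in> Gam" "y \<in> Gam"
    have "rot (sc (x \<cdot> y) j) - (evec (x \<cdot> y) j - evec (x \<cdot> y) (j - 1)) \<simeq>
      (rot (sc x (j + rot y)) + rot (sc y j)) - ((evec x (j + rot y) + evec y j)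
         - (evec x (j - 1 + rot y) + evec y (j - 1)))"
      by (intro eqp_diff rot_sc_mult evec_mult xy)
    thus "rot (sc (x \<cdot> y) j) - (evec (x \<cdot> y) j - evec (x \<cdot> y) (j - 1)) \<simeq>
      rot (sc x (j + rot y)) - (evec x (j + rot y) - evec x (j + rot y - 1)) +
         (rot (sc y j) - (evec y j - evec y (j - 1)))" by (simp add: algebra_simps)
  next
    fix j
    have 1: "j mod int p = 1 \<longleftrightarrow> (j - 1) mod int p = 0"
      using p_ge_3 mod_eq_dvd_iff[of j "int p" 1] by (simp add: dvd_eq_mod_eq_0)
    have "evec b j - evec b (j - 1) \<simeq> (if j mod int p = 0 then 1 else 0) - (if (j - 1) mod int p = 0 then 1 else 0)"
      by (intro eqp_diff evec_b)
    also have "\<dots> = (if j mod int p = 0 then 1 else if j mod int p = 1 then -1 else 0)"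
      unfolding 1[symmetric] by auto
    finally have "evec b j - evec b (j - 1) \<simeq> (if j mod int p = 0 then 1 else if j mod int p = 1 then -1 else 0)" .
    hence "evec b j - evec b (j - 1) \<simeq> rot (sc b j)" using rot_sc_b[of j] by (metis eqp_sym eqp_trans)
    thus "rot (sc b j) - (evec b j - evec b (j - 1)) \<simeq> 0"
      by (simp add: eqp_diff_0 eqp_sym)
  qed simp
  thus ?thesis by (simp add: eqp_diff_0)
qed

text \<open>On \<open>K\<close> this is a homomorphism whose kernel is the next term of the lower central series.
On the whole group the defect computed in the next lemma is that of a Heisenberg group.\<close>
definition lam :: "(nat list \<Rightarrow> nat list) \<Rightarrow> int" where
  "lam x = csum (\<lambda>j. j * evec x j)"

lemma lam_mult: assumes xy: "x \<in> Gam" "y \<in> Gam"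
  shows "lam (x \<cdot> y) \<simeq> lam x + lam y - rot y * expb x"
proof -
  have "lam (x \<cdot> y) \<simeq> csum (\<lambda>j. (j + rot y) * evec x (j + rot y) - rot y * evec x (j + rot y) + j * evec y j)"
    unfolding lam_def
  proof (rule csum_cong)
    fix j
    have "j * evec (x \<cdot> y) j \<simeq> j * (evec x (j + rot y) + evec y j)"
      by (intro eqp_mult eqp_refl evec_mult xy)
    thus "j * evec (x \<cdot> y) j \<simeq> (j + rot y) * evec x (j + rot y) - rot y * evec x (j + rot y) + j * evec y j"
      by (simp add: algebra_simps)
  qed
  also have "\<dots> = csum (\<lambda>j. (j + rot y) * evec x (j + rot y)) - rot y * csum (\<lambda>j. evec x (j + rot y)) + lam y"
    by (simp add: sum.distrib sum_subtractf sum_distrib_left lam_def)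
  also have "\<dots> \<simeq> lam x - rot y * expb x + lam y"
    unfolding lam_def
    by (intro eqp_add eqp_diff eqp_mult eqp_refl
        csum_shift[where u = "\<lambda>j. j * evec x j"] cyc_intros cyc_evec
        eqp_trans[OF csum_shift[where u = "evec x"]] csum_evec xy)
  finally show ?thesis by (simp add: algebra_simps)
qed

end

section \<open>Generators of a group and its derived subgroup\<close>

lemma (in group) generate_commutes:
  assumes "z \<in> carrier G" "S \<subseteq> carrier G" "\<And>s. s \<in> S \<Longrightarrow> s \<otimes> z = z \<otimes> s" "x \<in> generate G S"
  shows "x \<otimes> z = z \<otimes> x"
  using assms(4)
proof (induction rule: generate.induct)
  case (inv h)
  hence h: "h \<in> carrier G" using assms by auto
  have "z \<otimes> h = h \<otimes> z" using assms(3)[OF inv] by simp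
  have "inv h \<otimes> z = inv h \<otimes> (z \<otimes> h) \<otimes> inv h" using h assms(1) by (simp add: m_assoc)
  also have "\<dots> = inv h \<otimes> (h \<otimes> z) \<otimes> inv h" by (simp only: \<open>z \<otimes> h = h \<otimes> z\<close>)
  also have "\<dots> = z \<otimes> inv h" using h assms(1) by (simp add: m_assoc[symmetric])
  finally show ?case .
next
  case (eng h1 h2)
  have c: "h1 \<in> carrier G" "h2 \<in> carrier G" using eng generate_in_carrier[OF assms(2)] by auto
  have "h1 \<otimes> h2 \<otimes> z = h1 \<otimes> (z \<otimes> h2)" using c assms(1) eng by (simp add: m_assoc)
  also have "\<dots> = z \<otimes> (h1 \<otimes> h2)" using c assms(1) eng by (simp add: m_assoc[symmetric])
  finally show ?case .
qed (use assms in auto)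

text \<open>Two generators that commute modulo a normal subgroup make the quotient abelian.\<close>
lemma (in group) derived_subset_of_two_generators:
  assumes H: "H \<lhd> G" and u: "u \<in> carrier G" and v: "v \<in> carrier G" and gen: "generate G {u, v} = carrier G"
    and comm: "u \<otimes> v \<otimes> inv u \<otimes> inv v \<in> H"
  shows "derived G (carrier G) \<subseteq> H"
proof (rule derived_minimal[OF H])
  interpret H: normal H G by (rule H)
  interpret Q: group "G Mod H" by (rule H.factorgroup_is_group)
  interpret \<phi>: group_hom G "G Mod H" "\<lambda>x. H #> x"
    by unfold_locales (rule H.r_coset_hom_Mod)
  let ?\<phi> = "\<lambda>x. H #> x"
  have "u \<otimes> v = (u \<otimes> v \<otimes> inv u \<otimes> inv v) \<otimes> (v \<otimes> u)" using u v by (simp add: m_assoc) (simp add: m_assoc[symmetric])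
  hence "?\<phi> (u \<otimes> v) = ?\<phi> (v \<otimes> u)"
    using coset_mult_assoc[OF H.subset, of "u \<otimes> v \<otimes> inv u \<otimes> inv v" "v \<otimes> u"] coset_join2[OF _ H.subgroup_axioms comm] u v
    by simp
  hence uv: "?\<phi> u \<otimes>\<^bsub>G Mod H\<^esub> ?\<phi> v = ?\<phi> v \<otimes>\<^bsub>G Mod H\<^esub> ?\<phi> u"
    using u v \<phi>.hom_mult by metis
  have uvc: "?\<phi> u \<in> carrier (G Mod H)" "?\<phi> v \<in> carrier (G Mod H)" using u v \<phi>.hom_closed by auto
  have carr: "generate (G Mod H) {?\<phi> u, ?\<phi> v} = carrier (G Mod H)"
    using \<phi>.generate_img[of "{u, v}"] u v gen by (simp add: carrier_FactGroup)
  have *: "x \<otimes>\<^bsub>G Mod H\<^esub> s = s \<otimes>\<^bsub>G Mod H\<^esub> x" if "x \<in> carrier (G Mod H)" "s \<in> {?\<phi> u, ?\<phi> v}" for x s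
    by (rule Q.generate_commutes[where S = "{?\<phi> u, ?\<phi> v}"]) (use uvc uv that carr in \<open>auto simp del: mult_FactGroup\<close>)
  show "comm_group (G Mod H)"
  proof (rule Q.group_comm_groupI)
    fix x y assume xy: "x \<in> carrier (G Mod H)" "y \<in> carrier (G Mod H)"
    show "x \<otimes>\<^bsub>G Mod H\<^esub> y = y \<otimes>\<^bsub>G Mod H\<^esub> x"
      by (rule Q.generate_commutes[where S = "{?\<phi> u, ?\<phi> v}"]) (use uvc * xy carr in \<open>auto simp del: mult_FactGroup\<close>)
  qed
qed

context gupta_sidki
begin

section \<open>The first level stabiliser and its coordinates\<close>

abbreviation St where "St \<equiv> Stab p (Suc 0)"

abbreviation D :: "(nat list \<Rightarrow> nat list) set \<Rightarrow> (nat list \<Rightarrow> nat list) set" where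
  "D \<equiv> tree_prod p"

lemma Stab_wreath: assumes x: "x \<in> St" shows "wreath_form x 0 (sec x)"
proof -
  have xG: "x \<in> carrier G" using x by (simp add: Stab_def)
  have x1: "x [i] = [i]" if "i < p" for i using x that by (simp add: Stab_def)
  have pre: "prefix (x u) (x v) \<longleftrightarrow> prefix u v" if "u \<in> W" "v \<in> W" for u v using xG that by (simp add: Aut_tree_iff)
  have Cons: "x (i # w) = i # sec x i w" if iw: "i < p" "w \<in> W" for i w
  proof -
    have "prefix (x [i]) (x (i # w))" using pre[of "[i]" "i # w"] iw by simp
    thus ?thesis using x1[OF iw(1)] iw by (auto simp: sec_def prefix_def)
  qed
  have "sec x i \<in> carrier G" if i: "i < p" for i
    unfolding Aut_tree_iff
  proof (intro conjI ballI)
    show "sec x i \<in> extensional W" by (simp add: sec_def)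
    show pres: "prefix (sec x i u) (sec x i v) \<longleftrightarrow> prefix u v" if "u \<in> W" "v \<in> W" for u v
      using pre[of "i # u" "i # v"] that i by (simp add: Cons)
    have "inj_on (sec x i) W"
    proof (rule inj_onI)
      fix u v assume "u \<in> W" "v \<in> W" "sec x i u = sec x i v"
      thus "u = v" using pres[of u v] pres[of v u] by (simp add: prefix_order.eq_iff)
    qed
    moreover have "sec x i w \<in> W" if "w \<in> W" for w
      using Aut_maps[OF xG, of "i # w"] that i by (simp add: Cons)
    moreover have "v \<in> sec x i ` W" if v: "v \<in> W" for v
    proof -
      let ?z = "(inv\<^sub>A x) (i # v)"
      have z: "?z \<in> W" using Aut_maps[OF G.inv_closed[OF xG], of "i # v"] v i by simp
      have xz: "x ?z = i # v" using Aut_apply_inv[OF xG, of "i # v"] v i by simp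
      have "prefix [i] ?z" using pre[of "[i]" ?z] z xz x1[OF i] i by simp
      then obtain w where w: "?z = i # w" by (auto simp: prefix_def)
      hence "w \<in> W" using z by simp
      moreover have "sec x i w = v" using Cons[OF i \<open>w \<in> W\<close>] xz w by simp
      ultimately show ?thesis by blast
    qed
    ultimately show "bij_betw (sec x i) W W" unfolding bij_betw_def by blast
  qed
  thus ?thesis using xG Cons by (simp add: wreath_form_def)
qed

lemma wreath_Stab: assumes "wreath_form x 0 \<psi>" shows "x \<in> St"
proof -
  have "x w = w" if w: "w \<in> W" "length w = 1" for w
  proof -
    obtain i where i: "w = [i]" using w(2) by (cases w) auto
    hence "i < p" using w by simp
    thus ?thesis using wreath_formD(3)[OF assms, of i "[]"] wreath_formD(2)[OF assms, of i] i by (simp add: Aut_Nil)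
  qed
  thus ?thesis using wreath_formD(1)[OF assms] by (simp add: Stab_def)
qed

lemma Stab_carrier: "x \<in> St \<Longrightarrow> x \<in> carrier G" by (simp add: Stab_def)

lemma Stab_sc_carrier: "x \<in> St \<Longrightarrow> sc x j \<in> carrier G"
  unfolding sc_def using wreath_formD(2)[OF Stab_wreath nat_mod_less] .

lemma Stab_mult: assumes "x \<in> St" "y \<in> St" shows "x \<cdot> y \<in> St"
  using wreath_form_mult[OF Stab_wreath[OF assms(1)] Stab_wreath[OF assms(2)]] by (simp add: wreath_Stab)

lemma Stab_sc_mult: assumes "x \<in> St" "y \<in> St" shows "sc (x \<cdot> y) j = sc x j \<cdot> sc y j"
  using wreath_form_sec[OF wreath_form_mult[OF Stab_wreath[OF assms(1)] Stab_wreath[OF assms(2)]] nat_mod_less] nat_mod_less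
  by (simp add: sc_def)

lemma Stab_inv: assumes "x \<in> St" shows "inv\<^sub>A x \<in> St"
proof -
  have "wreath_form (inv\<^sub>A x) p (\<lambda>i. inv\<^sub>A (sec x ((i + p) mod p)))"
    using wreath_form_inv[OF Stab_wreath[OF assms]] by simp
  hence "wreath_form (inv\<^sub>A x) 0 (\<lambda>i. inv\<^sub>A (sec x ((i + p) mod p)))"
    by (simp add: wreath_form_def)
  thus ?thesis by (rule wreath_Stab)
qed

lemma Stab_one: "\<one>\<^sub>A \<in> St" using wreath_Stab[OF one_wreath] .

lemma Stab_sc_inv: assumes "x \<in> St" shows "sc (inv\<^sub>A x) j = inv\<^sub>A (sc x j)"
proof -
  have "sc (inv\<^sub>A x) j \<cdot> sc x j = \<one>\<^sub>A"
    using Stab_sc_mult[OF Stab_inv[OF assms] assms, of j] Stab_carrier[OF assms] by (simp add: G.l_inv)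
  thus ?thesis by (rule G.inv_equality[symmetric, OF _ Stab_sc_carrier[OF assms] Stab_sc_carrier[OF Stab_inv[OF assms]]])
qed

lemma Stab_ext: assumes "x \<in> St" "y \<in> St" "\<And>j. sc x j = sc y j" shows "x = y"
proof (rule Aut_ext[OF Stab_carrier[OF assms(1)] Stab_carrier[OF assms(2)]])
  fix w assume w: "w \<in> W"
  show "x w = y w"
  proof (cases w)
    case Nil thus ?thesis using assms by (simp add: Aut_Nil Stab_carrier)
  next
    case (Cons i v)
    hence i: "i < p" and v: "v \<in> W" using w by auto
    have "sec x i = sec y i" using assms(3)[of "int i"] i by (simp add: sc_def)
    thus ?thesis using wreath_formD(3)[OF Stab_wreath[OF assms(1)] i v] wreath_formD(3)[OF Stab_wreath[OF assms(2)] i v] Cons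
      by simp
  qed
qed

lemma tree_prod_iff:
  assumes "H \<subseteq> carrier G"
  shows "x \<in> D H \<longleftrightarrow> x \<in> St \<and> (\<forall>j. sc x j \<in> H)"
proof
  assume "x \<in> D H"
  then obtain \<psi> where x: "x \<in> St" and \<psi>: "\<forall>i<p. \<psi> i \<in> H \<and> (\<forall>w\<in>W. x (i # w) = i # \<psi> i w)"
    by (auto simp: tree_prod_def)
  hence "wreath_form x 0 \<psi>" using assms by (auto simp: wreath_form_def Stab_def)
  from wreath_form_sec[OF this] \<psi> x show "x \<in> St \<and> (\<forall>j. sc x j \<in> H)"
    using nat_mod_less by (simp add: sc_def)
next
  assume x: "x \<in> St \<and> (\<forall>j. sc x j \<in> H)"
  have "sec x i \<in> H" if "i < p" for i using x[THEN conjunct2, rule_format, of "int i"] that by (simp add: sc_def)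
  moreover have "x (i # w) = i # sec x i w" if "i < p" "w \<in> W" for i w
    using wreath_formD(3)[OF Stab_wreath] x that by simp
  ultimately show "x \<in> D H" using x by (auto simp: tree_prod_def intro!: exI[of _ "sec x"])
qed

lemma tree_prod_carrier: "D H \<subseteq> carrier G"
  by (auto simp: tree_prod_def Stab_def)

lemma tree_prod_mono: "H \<subseteq> H' \<Longrightarrow> D H \<subseteq> D H'"
  unfolding tree_prod_def by blast

text \<open>Coordinates of elements of \<open>D H\<close> can be prescribed independently; this is what allows the
same construction at all vertices of a level simultaneously.\<close>
lemma tree_prod_ex:
  assumes H: "H \<subseteq> carrier G" and \<psi>: "\<And>j. 0 \<le> j \<Longrightarrow> j < int p \<Longrightarrow> \<psi> j \<in> H"
  obtains x where "x \<in> D H" "\<And>j. sc x j = \<psi> (j mod int p)"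
proof -
  let ?x = "tup (\<lambda>i. \<psi> (int i))"
  have w: "wreath_form ?x 0 (\<lambda>i. \<psi> (int i))" by (rule tup_wreath) (use H \<psi> in auto)
  have s: "sc ?x j = \<psi> (j mod int p)" for j
    unfolding sc_def using wreath_form_sec[OF w nat_mod_less, of j] p_pos by simp
  have "?x \<in> D H" unfolding tree_prod_iff[OF H] using wreath_Stab[OF w] s \<psi> p_pos by simp
  thus ?thesis using s that by blast
qed

lemma Gam_Stab: assumes "x \<in> Gam" "rot x \<simeq> 0" shows "x \<in> St"
proof -
  have "rot x = 0" using assms rot_range[OF assms(1)] by (simp add: eqp_mod)
  thus ?thesis using wreath_Stab[of x] Gam_wreath(1)[OF assms(1)] by simp
qed

lemma a_pow: "a [^]\<^bsub>G\<^esub> n \<in> Gam" "rot (a [^]\<^bsub>G\<^esub> (n::nat)) \<simeq> int n" "sc (a [^]\<^bsub>G\<^esub> n) j = \<one>\<^sub>A"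
proof -
  show *: "a [^]\<^bsub>G\<^esub> n \<in> Gam" for n :: nat by simp
  show "rot (a [^]\<^bsub>G\<^esub> n) \<simeq> int n"
  proof (induction n)
    case (Suc n)
    have "rot (a [^]\<^bsub>G\<^esub> Suc n) \<simeq> rot (a [^]\<^bsub>G\<^esub> n) + rot a" using rot_mult[OF *[of n], of a] by simp
    also have "\<dots> \<simeq> int n + 1" using Suc by (intro eqp_add) auto
    finally show ?case by (simp add: add.commute)
  qed simp
  show "sc (a [^]\<^bsub>G\<^esub> n) j = \<one>\<^sub>A"
    by (induction n arbitrary: j) (simp_all add: sc_mult[OF *])
qed

lemma a_order: "a [^]\<^bsub>G\<^esub> p = \<one>\<^sub>A"
proof (rule Stab_ext)
  have "rot (a [^]\<^bsub>G\<^esub> p) \<simeq> 0" using a_pow(2)[of p] by (simp add: eqp_mod)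
  thus "a [^]\<^bsub>G\<^esub> p \<in> St" by (intro Gam_Stab) simp_all
qed (simp_all add: Stab_one a_pow)

lemma Stab_pow: "x \<in> St \<Longrightarrow> x [^]\<^bsub>G\<^esub> (n::nat) \<in> St"
  by (induction n) (simp_all add: Stab_one Stab_mult)

lemma Stab_sc_pow: "x \<in> St \<Longrightarrow> sc (x [^]\<^bsub>G\<^esub> (n::nat)) j = sc x j [^]\<^bsub>G\<^esub> n"
  by (induction n) (simp_all add: Stab_sc_mult Stab_pow)

lemma b_Stab: "b \<in> St" by (intro Gam_Stab) simp_all

text \<open>The sections of the \<open>p\<close>-th power of \<open>b\<close> are trivial, except for the last, which is that power
again; hence it fixes every word, by induction on the length.\<close>
lemma b_order: "b [^]\<^bsub>G\<^esub> p = \<one>\<^sub>A"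
proof -
  let ?c = "b [^]\<^bsub>G\<^esub> p"
  have c: "?c \<in> St" by (rule Stab_pow[OF b_Stab])
  have sec: "sec ?c i = (if i = p - 1 then ?c else \<one>\<^sub>A)" if "i < p" for i
  proof -
    have "sec ?c i = b_tup i [^]\<^bsub>G\<^esub> p"
      using Stab_sc_pow[OF b_Stab, of p "int i"] sc_b[of "int i"] that by (simp add: sc_def[of _ "int i"])
    moreover have "inv\<^sub>A a [^]\<^bsub>G\<^esub> p = \<one>\<^sub>A" using G.nat_pow_inv[of a p] a_order by simp
    ultimately show ?thesis using a_order p_ge_3 by (auto simp: b_tup_def)
  qed
  have "?c w = w" if "w \<in> W" for w
    using that
  proof (induction w)
    case Nil thus ?case by (simp add: Aut_Nil[OF Stab_carrier[OF c]])
  next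
    case (Cons i w)
    hence "i < p" "w \<in> W" "?c w = w" by auto
    thus ?case using wreath_formD(3)[OF Stab_wreath[OF c], of i w] sec[of i] by simp
  qed
  thus ?thesis by (intro Aut_ext[OF Stab_carrier[OF c]]) simp_all
qed

section \<open>The derived subgroup\<close>

abbreviation GS where "GS \<equiv> GS_group p"

lemma GS_eq: "GS = G\<lparr>carrier := Gam\<rparr>" by (simp add: GS_group_def Gam_def)
lemma GS_carrier [simp]: "carrier GS = Gam" by (simp add: GS_eq)
lemma GS_mult [simp]: "x \<otimes>\<^bsub>GS\<^esub> y = x \<cdot> y" by (simp add: GS_eq)
lemma GS_one [simp]: "\<one>\<^bsub>GS\<^esub> = \<one>\<^sub>A" by (simp add: GS_eq)
lemma GS_inv [simp]: "x \<in> Gam \<Longrightarrow> inv\<^bsub>GS\<^esub> x = inv\<^sub>A x"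
  unfolding GS_eq by (rule G.m_inv_consistent[OF Gam_subgroup])

lemma group_GS: "group GS" unfolding GS_eq by (rule G.subgroup_imp_group[OF Gam_subgroup])

sublocale GS: group GS by (rule group_GS)

lemma GS_generate: "S \<subseteq> Gam \<Longrightarrow> generate GS S = generate G S"
  unfolding GS_eq by (rule G.generate_consistent[OF _ Gam_subgroup])

lemma GS_subgroupI: "subgroup H G \<Longrightarrow> H \<subseteq> Gam \<Longrightarrow> subgroup H GS"
  unfolding GS_eq by (rule G.subgroup_incl[OF _ Gam_subgroup])

definition K :: "(nat list \<Rightarrow> nat list) set" where
  "K = {x \<in> Gam. rot x \<simeq> 0 \<and> expb x \<simeq> 0}"

lemma K_Gam: "x \<in> K \<Longrightarrow> x \<in> Gam" by (simp add: K_def)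

lemma K_carrier: "K \<subseteq> carrier G" using Gam_carrier by (auto simp: K_def)

lemma K_subgroup: "subgroup K G"
proof
  show "K \<subseteq> carrier G" by (rule K_carrier)
  show "\<one>\<^sub>A \<in> K" by (simp add: K_def)
next
  fix x y assume xy: "x \<in> K" "y \<in> K"
  have "rot x + rot y \<simeq> 0 + 0" "expb x + expb y \<simeq> 0 + 0"
    using xy unfolding K_def by (intro eqp_add; simp)+
  hence "rot (x \<cdot> y) \<simeq> 0" "expb (x \<cdot> y) \<simeq> 0"
    using eqp_trans[OF rot_mult[of x y]] eqp_trans[OF expb_mult[of x y]] xy by (simp_all add: K_def)
  thus "x \<cdot> y \<in> K" using xy by (simp add: K_def)
next
  fix x assume x: "x \<in> K"
  have x': "x \<in> Gam" "rot x \<simeq> 0" "expb x \<simeq> 0" using x by (simp_all add: K_def)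
  have neg: "- u \<simeq> 0" if "u \<simeq> 0" for u using eqp_diff[OF eqp_refl[of 0] that] by simp
  show "inv\<^sub>A x \<in> K"
    using x' eqp_trans[OF rot_inv[OF x'(1)] neg[OF x'(2)]] eqp_trans[OF expb_inv[OF x'(1)] neg[OF x'(3)]]
    by (simp add: K_def)
qed

lemma comm_K: assumes xy: "x \<in> Gam" "y \<in> Gam"
  shows "x \<cdot> y \<cdot> inv\<^sub>A x \<cdot> inv\<^sub>A y \<in> K"
proof -
  have "rot (x \<cdot> y \<cdot> inv\<^sub>A x \<cdot> inv\<^sub>A y) \<simeq> rot x + rot y + - rot x + - rot y"
    using xy by (intro eqp_trans[OF rot_mult] eqp_add rot_inv) auto
  moreover have "expb (x \<cdot> y \<cdot> inv\<^sub>A x \<cdot> inv\<^sub>A y) \<simeq> expb x + expb y + - expb x + - expb y"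
    using xy by (intro eqp_trans[OF expb_mult] eqp_add expb_inv) auto
  ultimately show ?thesis using xy by (simp add: K_def)
qed

text \<open>Modulo the derived subgroup every element is \<open>a\<^sup>i b\<^sup>j\<close> with \<open>i\<close> and \<open>j\<close> congruent to its two
exponents. Both generators have order \<open>p\<close>, so vanishing exponents force the product to be trivial.\<close>
lemma derived_eq_K: "derived GS Gam = K"
proof
  show "derived GS Gam \<subseteq> K"
    unfolding derived_def
    by (rule GS.generate_subgroup_incl[OF _ GS_subgroupI[OF K_subgroup]]) (use comm_K K_Gam in auto)
  let ?N = "derived GS Gam"
  interpret N: normal ?N GS using GS.derived_self_is_normal by simp
  interpret Q: comm_group "GS Mod ?N" using GS.derived_quot_is_comm_group by simp
  let ?\<phi> = "\<lambda>x. ?N #>\<^bsub>GS\<^esub> x"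
  interpret \<phi>: group_hom GS "GS Mod ?N" ?\<phi> by unfold_locales (rule N.r_coset_hom_Mod)
  have \<phi>c: "?\<phi> x \<in> carrier (GS Mod ?N)" if "x \<in> Gam" for x using \<phi>.hom_closed that by simp
  have \<phi>m: "?\<phi> (x \<cdot> y) = ?\<phi> x \<otimes>\<^bsub>GS Mod ?N\<^esub> ?\<phi> y" if "x \<in> Gam" "y \<in> Gam" for x y
    using \<phi>.hom_mult[of x y] that by simp
  have \<phi>i: "?\<phi> (inv\<^sub>A x) = inv\<^bsub>GS Mod ?N\<^esub> ?\<phi> x" if "x \<in> Gam" for x
    using \<phi>.hom_inv[of x] that by simp
  have \<phi>1: "?\<phi> \<one>\<^sub>A = \<one>\<^bsub>GS Mod ?N\<^esub>" using \<phi>.hom_one by simp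
  let ?P = "\<lambda>x i j. i \<simeq> rot x \<and> j \<simeq> expb x \<and> ?\<phi> x = ?\<phi> a [^]\<^bsub>GS Mod ?N\<^esub> i \<otimes>\<^bsub>GS Mod ?N\<^esub> ?\<phi> b [^]\<^bsub>GS Mod ?N\<^esub> j"
  note [simp del] = mult_FactGroup one_FactGroup
  have neg: "x \<simeq> y \<Longrightarrow> - x \<simeq> - y" for x y using eqp_diff[of 0 0 x y] by simp
  have P: "\<exists>i j :: int. ?P x i j" if "x \<in> Gam" for x
    using that
  proof (induction rule: Gam_induct)
    case one show ?case by (intro exI[of _ 0]) (simp add: \<phi>1)
  next
    case a show ?case by (intro exI[of _ 1] exI[of _ 0]) (simp add: \<phi>c)
  next
    case b show ?case using expb_b by (intro exI[of _ 0] exI[of _ 1]) (simp add: \<phi>c eqp_sym)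
  next
    case inv_a
    show ?case
      by (intro exI[of _ "-1"] exI[of _ 0])
        (use rot_inv[of a] expb_inv[of a] in \<open>simp add: \<phi>c \<phi>i Q.int_pow_neg eqp_sym\<close>)
  next
    case inv_b
    have "- 1 \<simeq> expb (inv\<^sub>A b)" using eqp_trans[OF expb_inv[of b] neg[OF expb_b]] by (simp add: eqp_sym)
    thus ?case
      by (intro exI[of _ 0] exI[of _ "-1"])
        (use rot_inv[of b] in \<open>simp add: \<phi>c \<phi>i Q.int_pow_neg eqp_sym\<close>)
  next
    case (mult x y)
    then obtain i j k l :: int where P: "?P x i j" "?P y k l" by blast
    have "i + k \<simeq> rot (x \<cdot> y)" "j + l \<simeq> expb (x \<cdot> y)"
      using P mult(1,2) eqp_trans[OF eqp_add eqp_sym[OF rot_mult]] eqp_trans[OF eqp_add eqp_sym[OF expb_mult]] by auto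
    moreover have "?\<phi> (x \<cdot> y) = ?\<phi> a [^]\<^bsub>GS Mod ?N\<^esub> (i + k) \<otimes>\<^bsub>GS Mod ?N\<^esub> ?\<phi> b [^]\<^bsub>GS Mod ?N\<^esub> (j + l)"
      using P mult(1,2) by (simp add: \<phi>m Q.int_pow_mult \<phi>c Q.m_ac)
    ultimately show ?case by blast
  qed
  have ord: "?\<phi> c [^]\<^bsub>GS Mod ?N\<^esub> i = \<one>\<^bsub>GS Mod ?N\<^esub>" if c: "c \<in> Gam" "c [^]\<^bsub>G\<^esub> p = \<one>\<^sub>A" and i: "i \<simeq> 0" for c and i :: int
  proof -
    have pw: "?\<phi> (c [^]\<^bsub>G\<^esub> n) = ?\<phi> c [^]\<^bsub>GS Mod ?N\<^esub> n" for n :: nat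
      by (induction n) (use c in \<open>simp_all add: \<phi>m \<phi>1\<close>)
    obtain k where k: "i = int p * k" using i by (auto simp: eqp_dvd)
    have "?\<phi> c [^]\<^bsub>GS Mod ?N\<^esub> i = (?\<phi> c [^]\<^bsub>GS Mod ?N\<^esub> int p) [^]\<^bsub>GS Mod ?N\<^esub> k"
      unfolding k using Q.int_pow_pow[OF \<phi>c[OF c(1)], of "int p" k] by (simp add: mult.commute)
    also have "?\<phi> c [^]\<^bsub>GS Mod ?N\<^esub> int p = \<one>\<^bsub>GS Mod ?N\<^esub>" using pw[of p] c(2) \<phi>1 by (simp add: int_pow_int)
    finally show ?thesis by simp
  qed
  show "K \<subseteq> ?N"
  proof
    fix x assume x: "x \<in> K"
    then obtain i j :: int where ij: "?P x i j" using P[OF K_Gam] by blast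
    have "i \<simeq> 0" "j \<simeq> 0" using ij x eqp_trans by (auto simp: K_def)
    hence "?\<phi> x = \<one>\<^bsub>GS Mod ?N\<^esub>" using ij ord[of a i] ord[of b j] a_order b_order by simp
    hence "?N #>\<^bsub>GS\<^esub> x = ?N" by (simp add: one_FactGroup)
    thus "x \<in> ?N" using GS.rcos_self[of x ?N] N.subgroup_axioms K_Gam[OF x] by simp
  qed
qed

lemma GS_derived_eq: "GS_derived p = K"
  unfolding GS_derived_def using derived_eq_K by simp


lemma Stab_rot: "x \<in> St \<Longrightarrow> rot x = 0"
  using wreath_form_rot[OF Stab_wreath] by simp

lemma rot_neg: "x \<in> Gam \<Longrightarrow> rot x \<simeq> 0 \<Longrightarrow> rot x = 0"
  using rot_range by (simp add: eqp_mod)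

text \<open>Conjugation by the \<open>n\<close>-th power of \<open>a\<close>, for \<open>n \<le> p\<close>, written without inverses.\<close>
definition a_shift :: "nat \<Rightarrow> (nat list \<Rightarrow> nat list) \<Rightarrow> nat list \<Rightarrow> nat list" where
  "a_shift n y = a [^]\<^bsub>G\<^esub> n \<cdot> y \<cdot> a [^]\<^bsub>G\<^esub> (p - n)"

lemma a_shift:
  assumes "y \<in> Gam" "n \<le> p"
  shows "a_shift n y \<in> Gam"
    "rot (a_shift n y) \<simeq> rot y"
    "sc (a_shift n y) j = sc y (j - int n)"
  unfolding a_shift_def
proof -
  have pw: "a [^]\<^bsub>G\<^esub> m \<in> Gam" for m :: nat by (rule a_pow)
  show "a [^]\<^bsub>G\<^esub> n \<cdot> y \<cdot> a [^]\<^bsub>G\<^esub> (p - n) \<in> Gam" using assms pw by simp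
  have "rot (a [^]\<^bsub>G\<^esub> n \<cdot> y \<cdot> a [^]\<^bsub>G\<^esub> (p - n)) \<simeq> int n + rot y + int (p - n)"
    using assms pw by (intro eqp_trans[OF rot_mult] eqp_add a_pow) auto
  also have "\<dots> \<simeq> rot y" using assms by (simp add: eqp_dvd of_nat_diff)
  finally show "rot (a [^]\<^bsub>G\<^esub> n \<cdot> y \<cdot> a [^]\<^bsub>G\<^esub> (p - n)) \<simeq> rot y" .
  have "sc (a [^]\<^bsub>G\<^esub> n \<cdot> y \<cdot> a [^]\<^bsub>G\<^esub> (p - n)) j = sc y (j + rot (a [^]\<^bsub>G\<^esub> (p - n)))"
    using assms pw by (simp add: sc_mult a_pow(3))
  also have "\<dots> = sc y (j - int n)"
  proof (rule sc_mod)
    have "j + rot (a [^]\<^bsub>G\<^esub> (p - n)) \<simeq> j + int (p - n)" by (intro eqp_add a_pow eqp_refl)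
    also have "\<dots> \<simeq> j - int n" using assms by (simp add: eqp_dvd of_nat_diff)
    finally show "j + rot (a [^]\<^bsub>G\<^esub> (p - n)) \<simeq> j - int n" .
  qed
  finally show "sc (a [^]\<^bsub>G\<^esub> n \<cdot> y \<cdot> a [^]\<^bsub>G\<^esub> (p - n)) j = sc y (j - int n)" .
qed

lemma nat_mod_pred: "nat ((j - 1) mod int p) = (if nat (j mod int p) = 0 then p - 1 else nat (j mod int p) - 1)"
proof -
  have m: "0 \<le> j mod int p" "j mod int p < int p" using p_pos by auto
  have "(j - 1) mod int p = (if j mod int p = 0 then int p - 1 else j mod int p - 1)"
  proof (cases "j mod int p = 0")
    case True
    have "(j - 1) mod int p = (j mod int p - 1) mod int p" by (simp add: mod_diff_left_eq)
    thus ?thesis using True p_ge_3 by (simp add: zmod_minus1)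
  next
    case False
    have "(j - 1) mod int p = (j mod int p - 1) mod int p" by (simp add: mod_diff_left_eq)
    also have "\<dots> = j mod int p - 1" by (rule mod_pos_pos_trivial) (use m False in linarith)+
    finally show ?thesis using False by simp
  qed
  moreover have "nat (j mod int p) = 0 \<longleftrightarrow> j mod int p = 0" using m by linarith
  moreover have "j mod int p = 0 \<or> 0 < j mod int p" using m by linarith
  ultimately show ?thesis using p_ge_3 by (elim disjE) (simp_all add: nat_diff_distrib del: nat_0_iff)
qed

section \<open>The group branches over its derived subgroup\<close>

text \<open>The generator \<open>b\<close> has section \<open>a\<close> at the vertex \<open>0\<close>, and its conjugate by \<open>a\<close> has section \<open>b\<close>
there. So any conjugation in one coordinate is induced by the group.\<close>
lemma sections_subdirect: assumes "g \<in> Gam" shows "\<exists>y\<in>Gam. y \<in> St \<and> sc y 0 = g"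
proof -
  have inv: "\<exists>y\<in>Gam. y \<in> St \<and> sc y 0 = inv\<^sub>A g" if "\<exists>y\<in>Gam. y \<in> St \<and> sc y 0 = g" for g
    using that Stab_inv Stab_sc_inv Gam_inv by fastforce
  have a: "\<exists>y\<in>Gam. y \<in> St \<and> sc y 0 = a" by (intro bexI[of _ b]) (simp_all add: b_Stab sc_b b_tup_def)
  let ?y = "a_shift 1 b"
  have "sc ?y 0 = sc b (0 - 1)" using a_shift(3)[of b 1 0] p_ge_3 by simp
  also have "\<dots> = b" unfolding sc_b nat_mod_pred using p_ge_3 by (auto simp: b_tup_def)
  finally have "sc ?y 0 = b" .
  moreover have "?y \<in> Gam" "?y \<in> St" using a_shift(1,2)[of b 1] p_ge_3 by (auto intro!: Gam_Stab)
  ultimately have b: "\<exists>y\<in>Gam. y \<in> St \<and> sc y 0 = b" by blast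
  show ?thesis
    using assms
  proof (induction rule: Gam_induct)
    case one show ?case by (intro bexI[of _ "\<one>\<^sub>A"]) (simp_all add: Stab_one)
  next
    case (mult x y)
    then obtain x' y' where "x' \<in> Gam" "x' \<in> St" "sc x' 0 = x" "y' \<in> Gam" "y' \<in> St" "sc y' 0 = y" by blast
    thus ?case by (intro bexI[of _ "x' \<cdot> y'"]) (simp_all add: Stab_mult Stab_sc_mult)
  qed (use a b inv in blast)+
qed

definition single :: "(nat list \<Rightarrow> nat list) \<Rightarrow> nat list \<Rightarrow> nat list" where
  "single k = tup (\<lambda>i. if i = 0 then k else \<one>\<^sub>A)"

lemma single_wreath: "k \<in> carrier G \<Longrightarrow> wreath_form (single k) 0 (\<lambda>i. if i = 0 then k else \<one>\<^sub>A)"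
  unfolding single_def by (rule tup_wreath) simp

lemma single_Stab: "k \<in> carrier G \<Longrightarrow> single k \<in> St"
  using wreath_Stab[OF single_wreath] by simp

lemma single_sc: "k \<in> carrier G \<Longrightarrow> sc (single k) j = (if nat (j mod int p) = 0 then k else \<one>\<^sub>A)"
  unfolding sc_def using wreath_form_sec[OF single_wreath nat_mod_less] by simp

text \<open>The elements whose copy in the coordinate \<open>0\<close> belongs to the group form a normal subgroup, by
the subdirect property, so it is enough to find the commutator of one generating pair among them.
For \<open>p \<ge> 5\<close> the commutator of \<open>b\<close> with its conjugate \<open>y\<close> by \<open>a\<close> is supported in the coordinate \<open>0\<close>,
where it is the commutator of \<open>a\<close> and \<open>b\<close>. For \<open>p = 3\<close> the supports overlap, but \<open>b y\<close> and its
conjugate by \<open>a\<close> meet only in the coordinate \<open>0\<close>, with the entries \<open>a b\<close> and \<open>b a\<^sup>-\<^sup>1\<close>. These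
generate the group because their product in reverse order is the square of \<open>b\<close>, which has order three.\<close>
lemma K_single: assumes "k \<in> K" shows "single k \<in> Gam"
proof -
  define H where "H = {k \<in> Gam. single k \<in> Gam}"
  have mult: "single (x \<cdot> y) = single x \<cdot> single y" if "x \<in> carrier G" "y \<in> carrier G" for x y
    by (rule Stab_ext) (use that in \<open>simp_all add: single_Stab Stab_mult Stab_sc_mult single_sc\<close>)
  have inv: "single (inv\<^sub>A x) = inv\<^sub>A (single x)" if "x \<in> carrier G" for x
    by (rule Stab_ext) (use that in \<open>simp_all add: single_Stab Stab_inv Stab_sc_inv single_sc\<close>)
  have one: "single \<one>\<^sub>A = \<one>\<^sub>A"
    by (rule Stab_ext) (simp_all add: single_Stab Stab_one single_sc)
  have sub: "subgroup H G"
    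
  proof (rule G.subgroupI)
    have "\<one>\<^sub>A \<in> H" by (simp add: H_def one)
    thus "H \<noteq> {}" by blast
  qed (auto simp: H_def mult inv)
  have norm: "H \<lhd> GS"
  proof (rule GS.normal_invI[OF GS_subgroupI[OF sub]])
    show "H \<subseteq> Gam" by (auto simp: H_def)
    fix x h assume x: "x \<in> carrier GS" and h: "h \<in> H"
    hence xG: "x \<in> Gam" and hG: "h \<in> Gam" by (auto simp: H_def)
    obtain y where y: "y \<in> Gam" "y \<in> St" "sc y 0 = x" using sections_subdirect[OF xG] by blast
    have e: "sc y j = x" if "nat (j mod int p) = 0" for j
      using y(3) that by (simp add: sc_def)
    have "single (x \<cdot> h \<cdot> inv\<^sub>A x) = y \<cdot> single h \<cdot> inv\<^sub>A y"
      by (rule Stab_ext)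
        (use xG hG y in \<open>auto simp: single_Stab Stab_mult Stab_inv Stab_sc_mult Stab_sc_inv single_sc e\<close>)
    moreover have "single h \<in> Gam" using h by (simp add: H_def)
    ultimately show "x \<otimes>\<^bsub>GS\<^esub> h \<otimes>\<^bsub>GS\<^esub> inv\<^bsub>GS\<^esub> x \<in> H" using xG hG y by (simp add: H_def)
  qed
  let ?y = "a_shift 1 b"
  have yG: "?y \<in> Gam" and yS: "?y \<in> St" using a_shift(1,2)[of b 1] p_ge_3 by (auto intro!: Gam_Stab)
  have scy: "sc ?y j = sc b (j - 1)" for j using a_shift(3)[of b 1 j] p_ge_3 by simp
  have scy': "sc ?y j = (if nat (j mod int p) = 0 then b else if nat (j mod int p) = 1 then a
      else if nat (j mod int p) = 2 then inv\<^sub>A a else \<one>\<^sub>A)" for j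
    using nat_mod_less[of j] p_ge_3 unfolding scy sc_b nat_mod_pred by (auto simp: b_tup_def)
  have comm: "\<And>u v. u \<in> carrier G \<Longrightarrow> v \<in> carrier G \<Longrightarrow> u \<cdot> v = v \<cdot> u \<Longrightarrow>
     u \<cdot> v \<cdot> inv\<^sub>A u \<cdot> inv\<^sub>A v = \<one>\<^sub>A"
    by (simp add: G.m_assoc[symmetric] G.inv_solve_right')
  have "derived GS Gam \<subseteq> H"
  proof (cases "p = 3")
    case False
    hence p5: "p - 1 > 2" "p > 3" using p_ge_3 by auto
    have "single (a \<cdot> b \<cdot> inv\<^sub>A a \<cdot> inv\<^sub>A b) = b \<cdot> ?y \<cdot> inv\<^sub>A b \<cdot> inv\<^sub>A ?y"
      (is "?l = ?r")
    proof (rule Stab_ext)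
      show "?l \<in> St" by (simp add: single_Stab)
      show "?r \<in> St" by (simp only: yS Stab_mult Stab_inv b_Stab)
      fix j
      have "sc ?r j = sc b j \<cdot> sc ?y j \<cdot> inv\<^sub>A (sc b j) \<cdot> inv\<^sub>A (sc ?y j)"
        by (simp only: yS Stab_mult Stab_inv b_Stab Stab_sc_mult Stab_sc_inv)
      also have "\<dots> = sc ?l j"
        unfolding scy' sc_b using p5 by (auto simp: b_tup_def single_sc comm)
      finally show "sc ?l j = sc ?r j" ..
    qed
    moreover have "?r \<in> Gam" using yG by simp
    ultimately have "a \<cdot> b \<cdot> inv\<^sub>A a \<cdot> inv\<^sub>A b \<in> H" by (simp add: H_def)
    moreover have "generate GS {a, b} = carrier GS" using GS_generate[of "{a, b}"] by (simp add: Gam_def[symmetric])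
    ultimately show ?thesis using GS.derived_subset_of_two_generators[OF norm, of a b] by simp
  next
    case p3: True
    have i012: "nat (j mod int p) = 0 \<or> nat (j mod int p) = 1 \<or> nat (j mod int p) = 2" for j
      using nat_mod_less[of j] p3 by linarith
    have p1: "p - 1 = 2" using p3 by simp
    have bt: "b_tup 0 = a" "b_tup (Suc 0) = inv\<^sub>A a" "b_tup 2 = b" unfolding b_tup_def p1 by simp_all
    let ?u = "a \<cdot> b" and ?v = "b \<cdot> inv\<^sub>A a"
    let ?x = "b \<cdot> ?y"
    let ?x' = "a_shift 1 ?x"
    have xG: "?x \<in> Gam" using yG by simp
    have xS: "?x \<in> St" by (simp only: yS Stab_mult b_Stab)
    have x'G: "?x' \<in> Gam" and x'S: "?x' \<in> St"
      using a_shift(1,2)[OF xG, of 1] p_ge_3 Stab_rot[OF xS] by (auto intro!: Gam_Stab)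
    have scx: "sc ?x j = (if nat (j mod int p) = 0 then ?u else if nat (j mod int p) = 1 then \<one>\<^sub>A else ?v)" for j
    proof -
      have "sc ?x j = sc b j \<cdot> sc ?y j" by (simp only: yS b_Stab Stab_sc_mult)
      also have "\<dots> = (if nat (j mod int p) = 0 then ?u else if nat (j mod int p) = 1 then \<one>\<^sub>A else ?v)"
        unfolding scy' sc_b using i012[of j] by (elim disjE) (simp_all add: bt G.l_inv)
      finally show ?thesis .
    qed
    have scx': "sc ?x' j = (if nat (j mod int p) = 0 then ?v else if nat (j mod int p) = 1 then ?u else \<one>\<^sub>A)" for j
    proof -
      have "sc ?x' j = sc ?x (j - 1)" using a_shift(3)[OF xG, of 1 j] p_ge_3 by simp
      thus ?thesis unfolding scx nat_mod_pred p1 using i012[of j] by (elim disjE) simp_all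
    qed
    have "single (?u \<cdot> ?v \<cdot> inv\<^sub>A ?u \<cdot> inv\<^sub>A ?v) = ?x \<cdot> ?x' \<cdot> inv\<^sub>A ?x \<cdot> inv\<^sub>A ?x'"
      (is "?l = ?r")
    proof (rule Stab_ext)
      show "?l \<in> St" by (simp add: single_Stab)
      show "?r \<in> St" by (simp only: xS x'S Stab_mult Stab_inv)
      fix j
      have "sc ?r j = sc ?x j \<cdot> sc ?x' j \<cdot> inv\<^sub>A (sc ?x j) \<cdot> inv\<^sub>A (sc ?x' j)"
        by (simp only: xS x'S Stab_mult Stab_inv Stab_sc_mult Stab_sc_inv)
      also have "\<dots> = sc ?l j"
        unfolding scx scx' by (auto simp: single_sc G.r_inv)
      finally show "sc ?l j = sc ?r j" ..
    qed
    moreover have "?r \<in> Gam" using xG x'G by (simp only: Gam_mult Gam_inv)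
    ultimately have uvH: "?u \<cdot> ?v \<cdot> inv\<^sub>A ?u \<cdot> inv\<^sub>A ?v \<in> H"
      by (simp only: H_def mem_Collect_eq Gam_mult Gam_inv Gam_gens)
    have "generate GS {?u, ?v} = carrier GS"
    proof -
      let ?E = "generate G {?u, ?v}"
      have E: "subgroup ?E G" by (rule G.generate_is_subgroup) simp
      have uE: "?u \<in> ?E" and vE: "?v \<in> ?E" by (auto intro: generate.incl)
      have "?v \<cdot> ?u = b [^]\<^bsub>G\<^esub> (2::nat)" by (simp add: G.m_assoc numeral_2_eq_2) (simp add: G.m_assoc[symmetric])
      hence b2: "b [^]\<^bsub>G\<^esub> (2::nat) \<in> ?E" using subgroup.m_closed[OF E vE uE] by simp
      have "b [^]\<^bsub>G\<^esub> (2::nat) \<cdot> b [^]\<^bsub>G\<^esub> (2::nat) = b [^]\<^bsub>G\<^esub> (3 + 1::nat)" by (subst G.nat_pow_mult) simp_all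
      also have "\<dots> = b [^]\<^bsub>G\<^esub> p \<cdot> b [^]\<^bsub>G\<^esub> (1::nat)" using G.nat_pow_mult[OF b_carrier, of p 1] p3 by metis
      also have "\<dots> = b" by (simp add: b_order)
      finally have bE: "b \<in> ?E" using subgroup.m_closed[OF E b2 b2] by simp
      have "?u \<cdot> inv\<^sub>A b = a" by (simp add: G.m_assoc)
      hence "a \<in> ?E" using subgroup.m_closed[OF E uE subgroup.m_inv_closed[OF E bE]] by simp
      hence "generate G {a, b} \<subseteq> ?E" using bE by (intro G.generate_subgroup_incl[OF _ E]) simp
      moreover have "?E \<subseteq> Gam" by (rule G.generate_subgroup_incl[OF _ Gam_subgroup]) simp
      moreover have "generate GS {?u, ?v} = ?E" by (rule GS_generate) simp
      ultimately show ?thesis unfolding GS_carrier Gam_def[symmetric] by blast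
    qed
    thus ?thesis using GS.derived_subset_of_two_generators[OF norm, of ?u ?v] uvH
      by (simp only: GS_carrier GS_mult GS_inv Gam_mult Gam_inv Gam_gens)
  qed
  thus ?thesis using assms derived_eq_K by (auto simp: H_def)
qed

text \<open>An element of \<open>D K\<close> is the product of its coordinates, each of which is moved to the
coordinate \<open>0\<close> by a power of \<open>a\<close>.\<close>
lemma tree_prod_K_Gam: assumes x: "x \<in> D K" shows "x \<in> Gam"
proof -
  have xS: "x \<in> St" and xK: "\<And>j. sc x j \<in> K" using x tree_prod_iff[OF K_carrier] by auto
  have xc: "sc x j \<in> carrier G" for j using xK K_carrier by blast
  let ?P = "\<lambda>n. tup (\<lambda>i. if i < n then sec x i else \<one>\<^sub>A)"
  have w: "wreath_form (?P n) 0 (\<lambda>i. if i < n then sec x i else \<one>\<^sub>A)" for n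
    by (rule tup_wreath) (use wreath_formD(2)[OF Stab_wreath[OF xS]] in auto)
  have PS: "?P n \<in> St" for n using wreath_Stab[OF w] by simp
  have Psc: "sc (?P n) j = (if nat (j mod int p) < n then sc x j else \<one>\<^sub>A)" for n j
    using wreath_form_sec[OF w nat_mod_less, of n j] unfolding sc_def by simp
  have "n \<le> p \<Longrightarrow> ?P n \<in> Gam" for n
  proof (induction n)
    case 0
    have "?P 0 = \<one>\<^sub>A" by (rule Stab_ext[OF PS Stab_one]) (use Psc[of 0] in simp)
    thus ?case by (simp only: Gam_one)
  next
    case (Suc n)
    let ?s = "single (sc x (int n))"
    let ?z = "a_shift n ?s"
    have s: "?s \<in> Gam" by (rule K_single[OF xK])
    have n: "n \<le> p" "n < p" using Suc by auto
    have zG: "?z \<in> Gam" by (rule a_shift[OF s n(1)])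
    have zS: "?z \<in> St" using a_shift(2)[OF s n(1)] Stab_rot[OF single_Stab[OF xc]] zG by (intro Gam_Stab) auto
    have m: "nat ((j - int n) mod int p) = 0 \<longleftrightarrow> nat (j mod int p) = n" for j
    proof -
      have "nat ((j - int n) mod int p) = 0 \<longleftrightarrow> (j - int n) mod int p = 0"
        using pos_mod_sign[OF p_pos, of "j - int n"] by linarith
      also have "\<dots> \<longleftrightarrow> j mod int p = int n"
        using n(2) mod_eq_dvd_iff[of j "int p" "int n"] by (simp add: dvd_eq_mod_eq_0)
      also have "\<dots> \<longleftrightarrow> nat (j mod int p) = n" using pos_mod_sign[OF p_pos, of j] by auto
      finally show ?thesis .
    qed
    have zsc: "sc ?z j = (if nat (j mod int p) = n then sc x j else \<one>\<^sub>A)" for j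
    proof -
      have "sc ?z j = (if nat (j mod int p) = n then sc x (int n) else \<one>\<^sub>A)"
        unfolding a_shift(3)[OF s n(1)] single_sc[OF xc] m ..
      moreover have "nat (j mod int p) = n \<Longrightarrow> sc x (int n) = sc x j"
        using n(2) by (auto simp: sc_def)
      ultimately show ?thesis by simp
    qed
    have "?P (Suc n) = ?P n \<cdot> ?z"
    proof (rule Stab_ext[OF PS Stab_mult[OF PS zS]])
      fix j show "sc (?P (Suc n)) j = sc (?P n \<cdot> ?z) j"
        unfolding Stab_sc_mult[OF PS zS] Psc zsc using xc[of j] by auto
    qed
    thus ?case using Suc.IH[OF n(1)] zG by (simp only: Gam_mult)
  qed
  moreover have "?P p = x" by (rule Stab_ext[OF PS xS]) (simp only: Psc nat_mod_less if_True)
  ultimately show ?thesis by force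
qed

lemma expb_zero_of_K: assumes "\<And>j. rot (sc x j) = 0" shows "expb x = 0"
  using assms by (simp add: expb_def)

lemma tree_prod_K_subset: "D K \<subseteq> K"
proof
  fix x assume x: "x \<in> D K"
  have xS: "x \<in> St" and xK: "\<And>j. sc x j \<in> K" using x tree_prod_iff[OF K_carrier] by auto
  have "rot (sc x j) = 0" for j using xK[of j] rot_neg by (simp add: K_def)
  hence "expb x = 0" by (rule expb_zero_of_K)
  thus "x \<in> K" using tree_prod_K_Gam[OF x] Stab_rot[OF xS] by (simp add: K_def)
qed

section \<open>The normal series\<close>

lemma tree_prod_subgroup: assumes H: "subgroup H G" shows "subgroup (D H) G"
proof (rule G.subgroupI)
  note iff = tree_prod_iff[OF subgroup.subset[OF H]]
  show "D H \<subseteq> carrier G" by (rule tree_prod_carrier)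
  have "\<one>\<^sub>A \<in> D H" unfolding iff by (simp add: Stab_one subgroup.one_closed[OF H])
  thus "D H \<noteq> {}" by blast
  show "inv\<^sub>A x \<in> D H" if "x \<in> D H" for x
    using that unfolding iff by (simp add: Stab_inv Stab_sc_inv subgroup.m_inv_closed[OF H])
  show "x \<cdot> y \<in> D H" if "x \<in> D H" "y \<in> D H" for x y
    using that unfolding iff by (simp add: Stab_mult Stab_sc_mult subgroup.m_closed[OF H])
qed

lemma sc_inv: assumes y: "y \<in> Gam" shows "sc (inv\<^sub>A y) j = inv\<^sub>A (sc y (j + rot (inv\<^sub>A y)))"
proof -
  have "sc y (j + rot (inv\<^sub>A y)) \<cdot> sc (inv\<^sub>A y) j = \<one>\<^sub>A"
    using sc_mult[OF y Gam_inv[OF y], of j] y by simp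
  hence "inv\<^sub>A (sc (inv\<^sub>A y) j) = sc y (j + rot (inv\<^sub>A y))"
    using y by (intro G.inv_equality) auto
  thus ?thesis using y by (metis G.inv_inv Gam_carrier Gam_inv sc_Gam)
qed

lemma tree_prod_normal:
  assumes N: "N \<subseteq> Gam" "D N \<subseteq> Gam" and norm: "\<And>g h. g \<in> Gam \<Longrightarrow> h \<in> N \<Longrightarrow> g \<cdot> h \<cdot> inv\<^sub>A g \<in> N"
    and y: "y \<in> Gam" and x: "x \<in> D N"
  shows "y \<cdot> x \<cdot> inv\<^sub>A y \<in> D N"
proof -
  have NG: "N \<subseteq> carrier G" using N(1) Gam_carrier by blast
  have xS: "x \<in> St" and xN: "\<And>j. sc x j \<in> N" and xG: "x \<in> Gam" using x tree_prod_iff[OF NG] N(2) by auto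
  let ?z = "y \<cdot> x \<cdot> inv\<^sub>A y"
  have zG: "?z \<in> Gam" using y xG by simp
  have "rot ?z \<simeq> rot y + rot x + - rot y" using y xG by (intro eqp_trans[OF rot_mult] eqp_add rot_inv) auto
  hence zS: "?z \<in> St" using Stab_rot[OF xS] zG by (intro Gam_Stab) auto
  have "sc ?z j \<in> N" for j
  proof -
    let ?r = "j + rot (inv\<^sub>A y)"
    have "sc ?z j = sc y (?r + rot x) \<cdot> sc x ?r \<cdot> inv\<^sub>A (sc y ?r)"
      using y xG by (simp add: sc_mult sc_inv)
    thus ?thesis using Stab_rot[OF xS] norm[OF sc_Gam[OF y] xN] by simp
  qed
  thus ?thesis unfolding tree_prod_iff[OF NG] using zS by blast
qed

definition V :: "nat \<Rightarrow> (nat list \<Rightarrow> nat list) set" where "V n = (D ^^ n) K"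

lemma V_0: "V 0 = K" and V_Suc: "V (Suc n) = D (V n)" by (simp_all add: V_def)

lemma V_subset: "V n \<subseteq> K"
proof (induction n)
  case (Suc n)
  have "D (V n) \<subseteq> D K" by (rule tree_prod_mono[OF Suc])
  thus ?case using tree_prod_K_subset by (simp add: V_Suc)
qed (simp add: V_0)

lemma V_Gam: "V n \<subseteq> Gam" using V_subset K_Gam by blast

lemma V_subgroup: "subgroup (V n) G"
  by (induction n) (simp_all add: V_0 V_Suc K_subgroup tree_prod_subgroup)

lemma K_normal: assumes "g \<in> Gam" "h \<in> K" shows "g \<cdot> h \<cdot> inv\<^sub>A g \<in> K"
proof -
  have h: "h \<in> Gam" "rot h \<simeq> 0" "expb h \<simeq> 0" using assms by (auto simp: K_def)
  have "rot (g \<cdot> h \<cdot> inv\<^sub>A g) \<simeq> rot g + 0 + - rot g"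
    using assms h by (intro eqp_trans[OF rot_mult] eqp_add rot_inv) auto
  moreover have "expb (g \<cdot> h \<cdot> inv\<^sub>A g) \<simeq> expb g + 0 + - expb g"
    using assms h by (intro eqp_trans[OF expb_mult] eqp_add expb_inv) auto
  ultimately show ?thesis using assms h by (simp add: K_def)
qed

lemma V_normal: "g \<in> Gam \<Longrightarrow> h \<in> V n \<Longrightarrow> g \<cdot> h \<cdot> inv\<^sub>A g \<in> V n"
proof (induction n arbitrary: g h)
  case (Suc n)
  show ?case
    using tree_prod_normal[of "V n" g h] Suc V_Gam[of n] V_Gam[of "Suc n"] by (simp add: V_Suc)
qed (simp add: V_0 K_normal)

section \<open>Realising exponent vectors\<close>

lemma evec_mult0: assumes "x \<in> Gam" "y \<in> Gam" "rot y \<simeq> 0"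
  shows "evec (x \<cdot> y) j \<simeq> evec x j + evec y j"
  using evec_mult[OF assms(1,2), of j] rot_neg[OF assms(2,3)] by simp

text \<open>The conjugates of \<open>b\<close> by powers of \<open>a\<close> have the unit vectors as exponent vectors.\<close>
lemma evec_ex:
  assumes u: "cyc u"
  shows "\<exists>k\<in>Gam. rot k \<simeq> 0 \<and> (\<forall>j. evec k j \<simeq> u j)"
proof -
  have "n \<le> p \<Longrightarrow> \<exists>k\<in>Gam. rot k \<simeq> 0 \<and> (\<forall>j. evec k j \<simeq> (if j mod int p < int n then u j else 0))" for n
  proof (induction n)
    case 0
    have "\<not> j mod int p < 0" for j using pos_mod_sign[OF p_pos, of j] by linarith
    thus ?case by (intro bexI[of _ "\<one>\<^sub>A"]) simp_all
  next
    case (Suc n)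
    hence n: "n \<le> p" "n < p" by auto
    obtain k where k: "k \<in> Gam" "rot k \<simeq> 0" "\<And>j. evec k j \<simeq> (if j mod int p < int n then u j else 0)"
      using Suc.IH[OF n(1)] by blast
    let ?c = "a_shift n b"
    have c: "?c \<in> Gam" "rot ?c \<simeq> 0" using a_shift(1,2)[of b n] n by auto
    have ec: "evec ?c j \<simeq> (if j mod int p = int n then 1 else 0)" for j
    proof -
      have "evec ?c j = evec b (j - int n)" using a_shift(3)[of b n "j - 1"] n by (simp add: evec_def algebra_simps)
      moreover have "(j - int n) mod int p = 0 \<longleftrightarrow> j mod int p = int n"
        using n(2) mod_eq_dvd_iff[of j "int p" "int n"] by (simp add: dvd_eq_mod_eq_0)
      ultimately show ?thesis using evec_b[of "j - int n"] by simp
    qed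
    let ?m = "nat (u (int n) mod int p)"
    have cp: "?c [^]\<^bsub>G\<^esub> m \<in> Gam \<and> rot (?c [^]\<^bsub>G\<^esub> m) \<simeq> 0 \<and> (\<forall>j. evec (?c [^]\<^bsub>G\<^esub> m) j \<simeq> int m * evec ?c j)" for m :: nat
    proof (induction m)
      case (Suc m)
      have "rot (?c [^]\<^bsub>G\<^esub> m \<cdot> ?c) \<simeq> 0 + 0" using Suc c by (intro eqp_trans[OF rot_mult] eqp_add) auto
      moreover have "evec (?c [^]\<^bsub>G\<^esub> m \<cdot> ?c) j \<simeq> int m * evec ?c j + evec ?c j" for j
        using Suc c by (intro eqp_trans[OF evec_mult0] eqp_add eqp_refl) auto
      ultimately show ?case using Suc c by (simp add: algebra_simps)
    qed simp
    have "evec (k \<cdot> ?c [^]\<^bsub>G\<^esub> ?m) j \<simeq> (if j mod int p < int (Suc n) then u j else 0)" for j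
    proof -
      have "evec (k \<cdot> ?c [^]\<^bsub>G\<^esub> ?m) j \<simeq> (if j mod int p < int n then u j else 0) + int ?m * (if j mod int p = int n then 1 else 0)"
        using k cp[of ?m] by (intro eqp_trans[OF evec_mult0] eqp_add k eqp_trans[OF cp[THEN conjunct2, THEN conjunct2, rule_format]] eqp_mult ec eqp_refl) auto
      also have "\<dots> \<simeq> (if j mod int p < int (Suc n) then u j else 0)"
      proof (cases "j mod int p = int n")
        case True
        have "int ?m = u (int n) mod int p" using p_pos by simp
        also have "\<dots> \<simeq> u (int n)" by (simp add: eqp_mod)
        also have "\<dots> \<simeq> u j" using cyc_mod[OF u, of j] True by simp
        finally show ?thesis using True by simp
      qed auto
      finally show ?thesis .
    qed
    moreover have "rot (k \<cdot> ?c [^]\<^bsub>G\<^esub> ?m) \<simeq> 0 + 0" using k cp[of ?m] by (intro eqp_trans[OF rot_mult] eqp_add) auto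
    ultimately show ?case using k(1) cp[of ?m] by (intro bexI[of _ "k \<cdot> ?c [^]\<^bsub>G\<^esub> ?m"]) (auto simp del: of_nat_Suc)
  qed
  from this[of p] show ?thesis using p_pos by simp
qed


section \<open>Finite differences modulo p\<close>

text \<open>Summation by parts; there are no boundary terms because the sums run over a full period.\<close>
lemma csum_parts:
  assumes "cyc f" "cyc w"
  shows "csum (\<lambda>j. (f j - f (j - 1)) * w j) \<simeq> csum (\<lambda>j. f j * (w j - w (j + 1)))"
proof -
  have "csum (\<lambda>j. f (j - 1) * w j) \<simeq> csum (\<lambda>j. f j * w (j + 1))"
    using csum_shift[where u = "\<lambda>j. f j * w (j + 1)" and s = "-1"] assms cyc_shift[OF assms(2), of 1] by (simp add: cyc_mult)
  hence "csum (\<lambda>j. f j * w j) - csum (\<lambda>j. f (j - 1) * w j) \<simeq> csum (\<lambda>j. f j * w j) - csum (\<lambda>j. f j * w (j + 1))"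
    by (intro eqp_diff eqp_refl)
  thus ?thesis by (simp add: sum_subtractf algebra_simps)
qed

definition half :: int where "half = (int p + 1) div 2"

lemma half: "2 * half \<simeq> 1"
proof -
  have "even (int p + 1)" using odd_p by simp
  hence "2 * half = int p + 1" unfolding half_def by (rule dvd_mult_div_cancel)
  thus ?thesis by (simp add: eqp_dvd)
qed

lemma eqp_double_0: assumes "2 * x \<simeq> 0" shows "x \<simeq> 0"
proof -
  have "1 * x \<simeq> 2 * half * x" by (intro eqp_mult eqp_sym[OF half] eqp_refl)
  also have "2 * half * x = half * (2 * x)" by simp
  also have "\<dots> \<simeq> half * 0" by (intro eqp_mult assms eqp_refl)
  finally show ?thesis by simp
qed

lemma csum_1: "csum (\<lambda>j. c) \<simeq> 0" by (simp add: eqp_dvd)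

text \<open>Comparing the sum of squares with its translate shows that twice the sum vanishes, and \<open>p\<close>
is odd.\<close>
lemma csum_id: "csum (\<lambda>j. j) \<simeq> 0"
proof (rule eqp_double_0)
  have "csum (\<lambda>j. (j + 1) * (j + 1)) \<simeq> csum (\<lambda>j. j * j)"
    by (rule csum_shift[where u = "\<lambda>j. j * j"]) (intro cyc_intros)
  moreover have "csum (\<lambda>j. (j + 1) * (j + 1)) = csum (\<lambda>j. j * j) + 2 * csum (\<lambda>j. j) + int p"
    by (simp add: algebra_simps sum.distrib sum_distrib_left)
  ultimately have "int p dvd 2 * csum (\<lambda>j. j) + int p" by (simp add: eqp_dvd)
  thus "2 * csum (\<lambda>j. j) \<simeq> 0" unfolding eqp_dvd by (simp only: dvd_add_triv_right_iff diff_0_right)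
qed

text \<open>The sum of a solution is determined up to \<open>p\<close> times the constant of integration, hence
modulo \<open>p\<close>; it has to vanish for a second summation.\<close>
lemma antidifference:
  assumes t: "cyc t" and s: "csum t \<simeq> 0"
  shows "\<exists>u. cyc u \<and> (\<forall>j. u j - u (j - 1) \<simeq> t j) \<and> csum u \<simeq> - csum (\<lambda>j. j * t j)"
proof -
  define u where "u j = (\<Sum>i\<in>{0..j mod int p}. t i)" for j
  have u: "cyc u" by (simp add: cyc_def u_def)
  have d: "u j - u (j - 1) \<simeq> t j" for j
  proof (cases "j mod int p = 0")
    case True
    have "(j - 1) mod int p = (j mod int p - 1) mod int p" by (simp add: mod_diff_left_eq)
    also have "\<dots> = int p - 1" using True p_ge_3 by (simp add: zmod_minus1)
    finally have e: "u (j - 1) = csum t" by (simp add: u_def) (rule sum.cong; auto)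
    have "u j - u (j - 1) \<simeq> t (j mod int p) - 0" unfolding e using s True by (intro eqp_diff) (simp_all add: u_def)
    also have "\<dots> \<simeq> t j" using cyc_mod[OF t] by simp
    finally show ?thesis .
  next
    case False
    have m: "0 \<le> j mod int p" "j mod int p < int p" using p_pos by auto
    have "(j - 1) mod int p = (j mod int p - 1) mod int p" by (simp add: mod_diff_left_eq)
    also have "\<dots> = j mod int p - 1" by (rule mod_pos_pos_trivial) (use m False in linarith)+
    finally have e: "u (j - 1) = (\<Sum>i\<in>{0..j mod int p - 1}. t i)" by (simp add: u_def)
    have "{0..j mod int p} = insert (j mod int p) {0..j mod int p - 1}" using m by auto
    hence "u j = t (j mod int p) + u (j - 1)" unfolding e by (simp add: u_def)
    thus ?thesis using cyc_mod[OF t] by simp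
  qed
  have "csum (\<lambda>j. j * t j) \<simeq> csum (\<lambda>j. (u j - u (j - 1)) * j)"
    by (intro csum_cong) (simp add: mult.commute[of _ "_ :: int"], intro eqp_mult eqp_refl eqp_sym[OF d])
  also have "\<dots> \<simeq> csum (\<lambda>j. u j * (j - (j + 1)))" by (rule csum_parts[OF u cyc_id])
  also have "\<dots> = - csum u" by (simp add: sum_negf)
  finally have "- csum u \<simeq> csum (\<lambda>j. j * t j)" by (rule eqp_sym)
  hence "0 - (- csum u) \<simeq> 0 - csum (\<lambda>j. j * t j)" by (intro eqp_diff eqp_refl)
  thus ?thesis using u d by auto
qed

text \<open>The backward difference, that is, the effect on exponent vectors of commutation with \<open>a\<close>.\<close>
definition nab :: "(int \<Rightarrow> int) \<Rightarrow> int \<Rightarrow> int" where "nab u = (\<lambda>j. u j - u (j - 1))"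

lemma cyc_nab: "cyc u \<Longrightarrow> cyc (nab u)"
  unfolding nab_def using cyc_shift[of u "-1"] by (intro cyc_diff) simp_all

lemma cyc_nab_pow: "cyc u \<Longrightarrow> cyc ((nab ^^ n) u)"
  by (induction n) (simp_all add: cyc_nab)

lemma nab_cong: "(\<And>j. u j \<simeq> v j) \<Longrightarrow> nab u j \<simeq> nab v j"
  unfolding nab_def by (intro eqp_diff)

lemma nab_diff: "nab (\<lambda>j. u j - v j) j = nab u j - nab v j"
  by (simp add: nab_def)

lemma nab_pow_binomial: "(nab ^^ n) u j = (\<Sum>i\<le>n. (-1) ^ i * int (n choose i) * u (j - int i))"
proof (induction n arbitrary: j)
  case (Suc n)
  let ?c = "\<lambda>n i. (-1) ^ i * int (n choose i)"
  have "(\<Sum>i\<le>Suc n. ?c (Suc n) i * u (j - int i)) =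
      u j + (\<Sum>i\<le>n. ?c (Suc n) (Suc i) * u (j - int (Suc i)))"
    by (subst sum.atMost_Suc_shift) simp
  also have "(\<Sum>i\<le>n. ?c (Suc n) (Suc i) * u (j - int (Suc i))) =
      (\<Sum>i\<le>n. ?c n (Suc i) * u (j - int (Suc i))) - (\<Sum>i\<le>n. ?c n i * u (j - 1 - int i))"
    unfolding sum_subtractf[symmetric]
  proof (rule sum.cong)
    fix i
    have "int (Suc n choose Suc i) = int (n choose i) + int (n choose Suc i)" by simp
    moreover have "j - int (Suc i) = j - 1 - int i" by simp
    ultimately show "?c (Suc n) (Suc i) * u (j - int (Suc i)) = ?c n (Suc i) * u (j - int (Suc i)) - ?c n i * u (j - 1 - int i)"
      by (simp only: power_Suc ring_distribs)
  qed simp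
  also have "u j + (\<dots>) = (u j + (\<Sum>i\<le>n. ?c n (Suc i) * u (j - int (Suc i)))) - (\<Sum>i\<le>n. ?c n i * u (j - 1 - int i))"
    by simp
  also have "u j + (\<Sum>i\<le>n. ?c n (Suc i) * u (j - int (Suc i))) = (\<Sum>i\<le>Suc n. ?c n i * u (j - int i))"
    by (subst sum.atMost_Suc_shift) simp
  also have "\<dots> = (\<Sum>i\<le>n. ?c n i * u (j - int i))" by simp
  finally show ?case using Suc[of j] Suc[of "j - 1"] by (simp add: nab_def)
qed simp

text \<open>In characteristic \<open>p\<close> the \<open>p\<close>-th power of \<open>1\<close> minus the translation is \<open>1\<close> minus the
\<open>p\<close>-th power of the translation, which vanishes on functions of period \<open>p\<close>.\<close>
lemma nab_pow_p: assumes "cyc u" shows "(nab ^^ p) u j \<simeq> 0"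
proof -
  have "(nab ^^ p) u j \<simeq> (\<Sum>i\<le>p. if i = 0 then u j else if i = p then - u j else 0)"
    unfolding nab_pow_binomial
  proof (rule eqp_sum)
    fix i assume "i \<in> {..p}"
    then consider "i = 0" | "i = p" | "0 < i" "i < p" by fastforce
    thus "(-1) ^ i * int (p choose i) * u (j - int i) \<simeq> (if i = 0 then u j else if i = p then - u j else 0)"
    proof cases
      case 2
      have "(-1) * u (j - int p) \<simeq> (-1) * u j"
        using cyc_cong[OF assms, of "j - int p" j] by (intro eqp_mult eqp_refl) (simp add: eqp_dvd)
      thus ?thesis using 2 odd_p p_ge_3 by simp
    next
      case 3
      hence "p dvd (p choose i)" using prime_p by (intro dvd_choose_prime) auto
      hence "int p dvd int (p choose i)" by simp
      thus ?thesis using 3 by (simp add: eqp_dvd)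
    qed simp
  qed
  also have "(\<Sum>i\<le>p. if i = 0 then u j else if i = p then - u j else 0) =
      (\<Sum>i\<in>{0, p}. if i = 0 then u j else if i = p then - u j else 0)"
    by (rule sum.mono_neutral_right) auto
  also have "\<dots> = 0" using p_ge_3 by simp
  finally show ?thesis .
qed

section \<open>Commutator coverings\<close>

definition cmt :: "(nat list \<Rightarrow> nat list) \<Rightarrow> (nat list \<Rightarrow> nat list) \<Rightarrow> nat list \<Rightarrow> nat list" where
  "cmt x y = x \<cdot> y \<cdot> inv\<^sub>A x \<cdot> inv\<^sub>A y"

text \<open>Every element of \<open>X\<close> is a commutator \<open>[k, g]\<close> modulo \<open>Y\<close>, where \<open>g\<close> is any prescribed element
of \<open>A\<close> and \<open>k\<close> is chosen in \<open>B\<close>; moreover \<open>k\<close> may be replaced by anything that agrees with it modulo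
\<open>N\<close>. The order of the quantifiers matters: \<open>k\<close> may depend on \<open>g\<close>, of which only a coset is under
control.\<close>
definition cmt_covers where
  "cmt_covers X A B N Y \<longleftrightarrow> (\<forall>x\<in>X. \<forall>g\<in>A. \<exists>k\<in>B. \<forall>k'\<in>carrier G.
     inv\<^sub>A k' \<cdot> k \<in> N \<longrightarrow> inv\<^sub>A (cmt k' g) \<cdot> x \<in> Y)"

text \<open>\<open>A\<close> is a union of left cosets of \<open>N\<close>, so approximations of its elements modulo \<open>N\<close> remain in it.\<close>
definition saturated where
  "saturated A N \<longleftrightarrow> (\<forall>g\<in>A. \<forall>z\<in>carrier G. inv\<^sub>A z \<cdot> g \<in> N \<longrightarrow> z \<in> A)"

lemma quot_St: assumes "k \<in> St" "k' \<in> carrier G" "inv\<^sub>A k' \<cdot> k \<in> St" shows "k' \<in> St"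
proof -
  have "k \<cdot> inv\<^sub>A (inv\<^sub>A k' \<cdot> k) = k'"
    using assms Stab_carrier by (simp add: G.inv_mult_group G.m_assoc[symmetric])
  thus ?thesis using Stab_mult[OF assms(1) Stab_inv[OF assms(3)]] by simp
qed

text \<open>The relation only involves the group operations, which act coordinatewise on \<open>D\<close>, so the
choices for the coordinates can be made separately.\<close>
lemma cmt_covers_lift:
  assumes "cmt_covers X A B N Y"
    and sub: "X \<subseteq> carrier G" "A \<subseteq> carrier G" "B \<subseteq> carrier G" "N \<subseteq> carrier G" "Y \<subseteq> carrier G"
  shows "cmt_covers (D X) (D A) (D B) (D N) (D Y)"
  unfolding cmt_covers_def
proof (intro ballI)
  fix x g assume x: "x \<in> D X" and g: "g \<in> D A"
  have xS: "x \<in> St" and xX: "\<And>j. sc x j \<in> X" using x tree_prod_iff[OF sub(1)] by auto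
  have gS: "g \<in> St" and gA: "\<And>j. sc g j \<in> A" using g tree_prod_iff[OF sub(2)] by auto
  have "\<forall>j. \<exists>k\<in>B. \<forall>k'\<in>carrier G. inv\<^sub>A k' \<cdot> k \<in> N \<longrightarrow> inv\<^sub>A (cmt k' (sc g j)) \<cdot> sc x j \<in> Y"
    using assms(1) xX gA unfolding cmt_covers_def by blast
  then obtain \<kappa> where \<kappa>: "\<And>j. \<kappa> j \<in> B"
    "\<And>j k'. k' \<in> carrier G \<Longrightarrow> inv\<^sub>A k' \<cdot> \<kappa> j \<in> N \<Longrightarrow> inv\<^sub>A (cmt k' (sc g j)) \<cdot> sc x j \<in> Y"
    by metis
  obtain k where k: "k \<in> D B" "\<And>j. sc k j = \<kappa> (j mod int p)"
    using tree_prod_ex[OF sub(3), of \<kappa>] \<kappa>(1) by blast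
  have kS: "k \<in> St" using k tree_prod_iff[OF sub(3)] by auto
  show "\<exists>k\<in>D B. \<forall>k'\<in>carrier G. inv\<^sub>A k' \<cdot> k \<in> D N \<longrightarrow> inv\<^sub>A (cmt k' g) \<cdot> x \<in> D Y"
  proof (intro bexI[OF _ k(1)] ballI impI)
    fix k' assume k': "k' \<in> carrier G" "inv\<^sub>A k' \<cdot> k \<in> D N"
    have q: "inv\<^sub>A k' \<cdot> k \<in> St" and qN: "\<And>j. sc (inv\<^sub>A k' \<cdot> k) j \<in> N"
      using k'(2) tree_prod_iff[OF sub(4)] by auto
    have k'S: "k' \<in> St" by (rule quot_St[OF kS k'(1) q])
    have "sc (inv\<^sub>A (cmt k' g) \<cdot> x) j \<in> Y" for j
    proof -
      have m: "sc k' (j mod int p) = sc k' j" "sc g (j mod int p) = sc g j" "sc x (j mod int p) = sc x j"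
        by (simp_all add: sc_def)
      have "inv\<^sub>A (sc k' j) \<cdot> \<kappa> (j mod int p) \<in> N"
        using qN[of j] k(2) by (simp add: Stab_sc_mult Stab_sc_inv Stab_inv k'S kS)
      from \<kappa>(2)[OF Stab_sc_carrier[OF k'S] this]
      have "inv\<^sub>A (cmt (sc k' j) (sc g j)) \<cdot> sc x j \<in> Y" by (simp only: m)
      thus ?thesis by (simp only: cmt_def Stab_sc_mult Stab_sc_inv Stab_mult Stab_inv k'S gS xS)
    qed
    moreover have "inv\<^sub>A (cmt k' g) \<cdot> x \<in> St" by (simp only: cmt_def Stab_mult Stab_inv k'S gS xS)
    ultimately show "inv\<^sub>A (cmt k' g) \<cdot> x \<in> D Y" using tree_prod_iff[OF sub(5)] by blast
  qed
qed

lemma saturated_lift: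
  assumes "saturated A N" and sub: "A \<subseteq> carrier G" "N \<subseteq> carrier G"
  shows "saturated (D A) (D N)"
  unfolding saturated_def
proof (intro ballI impI)
  fix g z assume g: "g \<in> D A" and z: "z \<in> carrier G" "inv\<^sub>A z \<cdot> g \<in> D N"
  have gS: "g \<in> St" and gA: "\<And>j. sc g j \<in> A" using g tree_prod_iff[OF sub(1)] by auto
  have q: "inv\<^sub>A z \<cdot> g \<in> St" and qN: "\<And>j. sc (inv\<^sub>A z \<cdot> g) j \<in> N"
    using z(2) tree_prod_iff[OF sub(2)] by auto
  have zS: "z \<in> St" by (rule quot_St[OF gS z(1) q])
  have "sc z j \<in> A" for j
    using assms(1) gA[of j] qN[of j] Stab_sc_carrier[OF zS, of j] unfolding saturated_def
    by (simp add: Stab_sc_mult Stab_sc_inv Stab_inv zS gS)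
  thus "z \<in> D A" using tree_prod_iff[OF sub(1)] zS by blast
qed

lemma D_pow_carrier: "X \<subseteq> carrier G \<Longrightarrow> (D ^^ n) X \<subseteq> carrier G"
  by (cases n) (simp_all add: tree_prod_carrier)

lemma D_pow_mono: "X \<subseteq> Y \<Longrightarrow> (D ^^ n) X \<subseteq> (D ^^ n) Y"
  by (induction n) (simp_all add: tree_prod_mono)

lemma cmt_covers_lift_pow:
  assumes "cmt_covers X A B N Y"
    and sub: "X \<subseteq> carrier G" "A \<subseteq> carrier G" "B \<subseteq> carrier G" "N \<subseteq> carrier G" "Y \<subseteq> carrier G"
  shows "cmt_covers ((D ^^ n) X) ((D ^^ n) A) ((D ^^ n) B) ((D ^^ n) N) ((D ^^ n) Y)"
  by (induction n) (simp_all add: assms(1) cmt_covers_lift D_pow_carrier sub)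

lemma saturated_lift_pow:
  assumes "saturated A N" and sub: "A \<subseteq> carrier G" "N \<subseteq> carrier G"
  shows "saturated ((D ^^ n) A) ((D ^^ n) N)"
  by (induction n) (simp_all add: assms(1) saturated_lift D_pow_carrier sub)

lemma D_pow_nonempty: assumes "X \<noteq> {}" "X \<subseteq> carrier G" shows "(D ^^ n) X \<noteq> {}"
proof (induction n)
  case (Suc n)
  then obtain x where "x \<in> (D ^^ n) X" by blast
  thus ?case using tree_prod_ex[OF D_pow_carrier[OF assms(2)], of "\<lambda>_. x" n] by auto
qed (use assms in simp)

section \<open>Commutators and exponents\<close>

lemma cmt_mult: "x \<in> carrier G \<Longrightarrow> y \<in> carrier G \<Longrightarrow> cmt x y \<cdot> (y \<cdot> x) = x \<cdot> y"
  unfolding cmt_def by (simp add: G.m_assoc) (simp add: G.m_assoc[symmetric])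

lemma cmt_K: "x \<in> Gam \<Longrightarrow> y \<in> Gam \<Longrightarrow> cmt x y \<in> K"
  unfolding cmt_def by (rule comm_K)

text \<open>Compare the values of \<open>lam\<close> on \<open>x y\<close> and on \<open>y x\<close>, which differ by the commutator.\<close>
lemma lam_cmt: assumes xy: "x \<in> Gam" "y \<in> Gam"
  shows "lam (cmt x y) \<simeq> rot x * expb y - rot y * expb x"
proof -
  let ?z = "cmt x y"
  have z: "?z \<in> Gam" "expb ?z \<simeq> 0" using cmt_K[OF xy] by (auto simp: K_def)
  have "lam x + lam y - rot y * expb x \<simeq> lam (x \<cdot> y)" by (rule eqp_sym[OF lam_mult[OF xy]])
  also have "\<dots> = lam (?z \<cdot> (y \<cdot> x))" using xy by (simp add: cmt_mult)
  also have "\<dots> \<simeq> lam ?z + lam (y \<cdot> x) - rot (y \<cdot> x) * expb ?z" using xy z by (intro lam_mult) auto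
  also have "\<dots> \<simeq> lam ?z + (lam y + lam x - rot x * expb y) - rot (y \<cdot> x) * 0"
    by (intro eqp_diff eqp_add eqp_mult eqp_refl lam_mult z xy)
  finally have "int p dvd lam x + lam y - rot y * expb x - (lam ?z + (lam y + lam x - rot x * expb y))"
    by (simp add: eqp_dvd)
  hence "int p dvd - (lam ?z - (rot x * expb y - rot y * expb x))" by (simp add: algebra_simps)
  thus ?thesis unfolding eqp_dvd by (simp only: dvd_minus_iff)
qed

lemma lam_K_quot: assumes "c \<in> K" "x \<in> K" shows "lam (inv\<^sub>A c \<cdot> x) \<simeq> lam x - lam c"
proof -
  have G: "c \<in> Gam" "x \<in> Gam" "expb c \<simeq> 0" using assms by (auto simp: K_def)
  let ?y = "inv\<^sub>A c \<cdot> x"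
  have y: "?y \<in> Gam" using G by simp
  have "c \<cdot> ?y = x" using G by (simp add: G.m_assoc[symmetric])
  hence "lam x \<simeq> lam c + lam ?y - rot ?y * expb c" using lam_mult[OF G(1) y] by simp
  also have "\<dots> \<simeq> lam c + lam ?y - rot ?y * 0"
    by (rule eqp_diff[OF eqp_refl eqp_mult[OF eqp_refl G(3)]])
  finally have "lam x \<simeq> lam c + lam ?y" by simp
  hence "lam x - lam c \<simeq> lam c + lam ?y - lam c" by (rule eqp_diff[OF _ eqp_refl])
  hence "lam x - lam c \<simeq> lam ?y" by simp
  thus ?thesis by (rule eqp_sym)
qed

lemma D_K_evec: assumes "d \<in> D K" shows "evec d j \<simeq> 0"
proof -
  have "sc d (j - 1) \<in> K" using assms tree_prod_iff[OF K_carrier] by blast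
  thus ?thesis by (simp add: evec_def K_def)
qed

lemma D_K_rot: assumes "d \<in> D K" shows "rot d = 0"
  using assms tree_prod_iff[OF K_carrier] Stab_rot by blast

lemma quot_evec:
  assumes k: "k \<in> Gam" "rot k \<simeq> 0" and k': "k' \<in> carrier G" and d: "inv\<^sub>A k' \<cdot> k \<in> Gam" "rot (inv\<^sub>A k' \<cdot> k) \<simeq> 0"
  shows "k' \<in> Gam" "rot k' \<simeq> 0" "evec k j \<simeq> evec k' j + evec (inv\<^sub>A k' \<cdot> k) j"
proof -
  let ?d = "inv\<^sub>A k' \<cdot> k"
  have "k \<cdot> inv\<^sub>A ?d = k'" using k k' by (simp add: G.inv_mult_group G.m_assoc[symmetric])
  thus k'G: "k' \<in> Gam" using Gam_mult[OF k(1) Gam_inv[OF d(1)]] by simp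
  have e: "k = k' \<cdot> ?d" using k k' by (simp add: G.m_assoc[symmetric])
  have "rot k' + 0 = rot k' + rot ?d" using rot_neg[OF d] by simp
  also have "\<dots> \<simeq> rot k" using rot_mult[OF k'G d(1)] e by (simp add: eqp_sym)
  also have "\<dots> \<simeq> 0" by (rule k)
  finally show "rot k' \<simeq> 0" by simp
  show "evec k j \<simeq> evec k' j + evec ?d j" using evec_mult0[OF k'G d, of j] e by simp
qed

text \<open>The vector of values of \<open>lam\<close> on the coordinates of a commutator in terms of the exponent
vectors \<open>u\<close> and \<open>f\<close> of its entries: in each coordinate \<open>lam\<close> is a determinant of exponents. It
depends on \<open>k\<close> only through \<open>u\<close>, hence only on \<open>k\<close> modulo \<open>D K\<close>.\<close>
lemma cmt_sections:
  assumes k: "k \<in> Gam" "rot k \<simeq> 0" and g: "g \<in> Gam" "rot g \<simeq> 0" and x: "x \<in> D K"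
    and k': "k' \<in> carrier G" "inv\<^sub>A k' \<cdot> k \<in> D K"
    and u: "\<And>j. evec k j \<simeq> u j" and f: "\<And>j. evec g j \<simeq> f j"
  shows "inv\<^sub>A (cmt k' g) \<cdot> x \<in> D K"
    "lam (sc (inv\<^sub>A (cmt k' g) \<cdot> x) j) \<simeq>
      lam (sc x j) - ((u j - u (j - 1)) * f (j + 1) - (f j - f (j - 1)) * u (j + 1))"
proof -
  have d: "inv\<^sub>A k' \<cdot> k \<in> Gam" "rot (inv\<^sub>A k' \<cdot> k) \<simeq> 0"
    using tree_prod_K_Gam[OF k'(2)] D_K_rot[OF k'(2)] by simp_all
  note q = quot_evec[OF k k'(1) d]
  have e': "evec k' j \<simeq> u j" for j
  proof -
    have "u j \<simeq> evec k j" by (rule eqp_sym[OF u])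
    also have "\<dots> \<simeq> evec k' j + evec (inv\<^sub>A k' \<cdot> k) j" by (rule q)
    also have "\<dots> \<simeq> evec k' j + 0" by (intro eqp_add eqp_refl D_K_evec k')
    finally show ?thesis by (simp add: eqp_sym)
  qed
  have k'S: "k' \<in> St" and gS: "g \<in> St" using q g Gam_Stab by auto
  have xS: "x \<in> St" and xK: "\<And>j. sc x j \<in> K" using x tree_prod_iff[OF K_carrier] by auto
  have cS: "cmt k' g \<in> St" by (simp only: cmt_def Stab_mult Stab_inv k'S gS)
  have csc: "sc (cmt k' g) j = cmt (sc k' j) (sc g j)" for j
    by (simp only: cmt_def Stab_sc_mult Stab_sc_inv Stab_mult Stab_inv k'S gS)
  have cK: "cmt (sc k' j) (sc g j) \<in> K" for j using q g by (intro cmt_K) auto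
  have "cmt k' g \<in> D K" unfolding tree_prod_iff[OF K_carrier] using cS csc cK by simp
  thus "inv\<^sub>A (cmt k' g) \<cdot> x \<in> D K"
    using tree_prod_subgroup[OF K_subgroup] x by (meson subgroup.m_closed subgroup.m_inv_closed)
  have "lam (sc (inv\<^sub>A (cmt k' g) \<cdot> x) j) = lam (inv\<^sub>A (cmt (sc k' j) (sc g j)) \<cdot> sc x j)"
    by (simp only: Stab_sc_mult Stab_sc_inv Stab_inv cS xS csc)
  also have "\<dots> \<simeq> lam (sc x j) - lam (cmt (sc k' j) (sc g j))" by (rule lam_K_quot[OF cK xK])
  also have "\<dots> \<simeq> lam (sc x j) - (rot (sc k' j) * expb (sc g j) - rot (sc g j) * expb (sc k' j))"
    using q g by (intro eqp_diff eqp_refl lam_cmt) auto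
  also have "\<dots> = lam (sc x j) - (rot (sc k' j) * evec g (j + 1) - rot (sc g j) * evec k' (j + 1))"
    by (simp add: evec_def)
  also have "\<dots> \<simeq> lam (sc x j) - ((u j - u (j - 1)) * f (j + 1) - (f j - f (j - 1)) * u (j + 1))"
    using q g by (intro eqp_diff eqp_refl eqp_mult e' f eqp_trans[OF rot_sc_evec]) auto
  finally show "lam (sc (inv\<^sub>A (cmt k' g) \<cdot> x) j) \<simeq>
      lam (sc x j) - ((u j - u (j - 1)) * f (j + 1) - (f j - f (j - 1)) * u (j + 1))" .
qed

text \<open>The coset \<open>b K\<close>.\<close>
definition Gam01 where "Gam01 = {x \<in> Gam. rot x \<simeq> 0 \<and> expb x \<simeq> 1}"
text \<open>The coset of the first level stabiliser that contains \<open>a\<close>.\<close>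
definition Gam1 where "Gam1 = {x \<in> Gam. rot x \<simeq> 1}"
text \<open>The tuples in \<open>D K\<close> whose vector of \<open>lam\<close>-values is a second difference of a periodic
function, a subgroup of codimension two modulo \<open>D (Wf 1)\<close>.\<close>
definition U where "U = {y \<in> D K. csum (\<lambda>j. lam (sc y j)) \<simeq> 0 \<and> csum (\<lambda>j. j * lam (sc y j)) \<simeq> 0}"
text \<open>Modulo \<open>D K\<close> this is the image of the first level stabiliser under \<open>i + 1\<close> commutations
with \<open>a\<close>.\<close>
definition Wf where
  "Wf i = {x \<in> Gam. rot x \<simeq> 0 \<and> (\<exists>u. cyc u \<and> (\<forall>j. evec x j \<simeq> (nab ^^ Suc i) u j))}"

lemma cyc_lam_sc: "cyc (\<lambda>j. lam (sc x j))" by (simp add: cyc_def sc_cyc)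

lemma K_evecI: assumes "k \<in> Gam" "rot k \<simeq> 0" "\<And>j. evec k j \<simeq> u j" "csum u \<simeq> 0" shows "k \<in> K"
proof -
  have "expb k \<simeq> csum (evec k)" by (rule eqp_sym[OF csum_evec[OF assms(1)]])
  also have "\<dots> \<simeq> csum u" by (intro csum_cong assms)
  also have "\<dots> \<simeq> 0" by fact
  finally show ?thesis using assms by (simp add: K_def)
qed

text \<open>The exponent vector \<open>f\<close> of \<open>g\<close> is an unknown vector with sum \<open>1\<close>. Among the commutators with
\<open>g\<close>, a constant vector \<open>u = 1\<close> changes the sum of the \<open>lam\<close>-values by \<open>0\<close> and their first moment by
\<open>1\<close>, while \<open>u = j\<close> changes the sum by \<open>2\<close>, whatever \<open>f\<close> is. So the sum and the first moment of the
given tuple are matched by some \<open>u = \<alpha> j + \<beta>\<close>.\<close>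
lemma covers_top: "cmt_covers (D K) Gam01 K (D K) U"
  unfolding cmt_covers_def
proof (intro ballI)
  fix x g assume x: "x \<in> D K" and g: "g \<in> Gam01"
  define t where "t j = lam (sc x j)" for j
  define f where "f = evec g"
  have gG: "g \<in> Gam" "rot g \<simeq> 0" using g by (auto simp: Gam01_def)
  have f: "cyc f" by (simp add: f_def cyc_evec)
  have "csum f \<simeq> expb g" unfolding f_def by (rule csum_evec[OF gG(1)])
  also have "\<dots> \<simeq> 1" using g by (simp add: Gam01_def)
  finally have f1: "csum f \<simeq> 1" .
  \<comment> \<open>\<open>u = j\<close> contributes \<open>2\<close> to the sum, hence the division by two; its contribution to the first moment is \<open>Q\<close>, which \<open>\<beta>\<close> corrects.\<close>
  define \<alpha> where "\<alpha> = half * csum t"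
  define Q where "Q = csum (\<lambda>j. j * f (j + 1)) + 2 * csum (\<lambda>j. f j * (j + 1))"
  define \<beta> where "\<beta> = csum (\<lambda>j. j * t j) - \<alpha> * Q"
  define u where "u j = \<alpha> * j + \<beta>" for j
  define T where "T j = (u j - u (j - 1)) * f (j + 1) - (f j - f (j - 1)) * u (j + 1)" for j
  have T: "T j = \<alpha> * f (j + 1) - (f j - f (j - 1)) * u (j + 1)" for j
    unfolding T_def by (simp add: u_def algebra_simps)
  have u: "cyc u" "cyc (\<lambda>j. u (j + 1))" unfolding u_def by (intro cyc_intros)+
  have f_shift: "csum (\<lambda>j. f (j + 1)) \<simeq> csum f" by (rule csum_shift[OF f])
  have sum0: "csum T \<simeq> csum t"
  proof -
    have "csum T = \<alpha> * csum (\<lambda>j. f (j + 1)) - csum (\<lambda>j. (f j - f (j - 1)) * u (j + 1))"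
      unfolding T by (simp add: sum_subtractf sum_distrib_left)
    also have "\<dots> \<simeq> \<alpha> * csum f - csum (\<lambda>j. f j * (u (j + 1) - u (j + 1 + 1)))"
      by (intro eqp_diff eqp_mult eqp_refl f_shift csum_parts[where w = "\<lambda>j. u (j + 1)"] f u)
    also have "\<dots> = \<alpha> * csum f + \<alpha> * csum f"
      unfolding sum_distrib_left sum_subtractf[symmetric] sum.distrib[symmetric]
      by (rule sum.cong) (simp_all add: u_def algebra_simps)
    also have "\<dots> \<simeq> \<alpha> * 1 + \<alpha> * 1" by (intro eqp_add eqp_mult eqp_refl f1)
    also have "\<dots> = 2 * half * csum t" by (simp add: \<alpha>_def)
    also have "\<dots> \<simeq> 1 * csum t" by (intro eqp_mult half eqp_refl)
    finally show ?thesis by simp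
  qed
  have sum1: "csum (\<lambda>j. j * T j) \<simeq> csum (\<lambda>j. j * t j)"
  proof -
    let ?S = "csum (\<lambda>j. f j * (j + 1))" and ?S' = "csum (\<lambda>j. j * f (j + 1))"
    have 1: "csum (\<lambda>j. j * T j) = \<alpha> * ?S' - csum (\<lambda>j. (f j - f (j - 1)) * (j * u (j + 1)))"
      unfolding T by (simp add: sum_subtractf[symmetric] sum_distrib_left algebra_simps)
    have 2: "csum (\<lambda>j. (f j - f (j - 1)) * (j * u (j + 1))) \<simeq> csum (\<lambda>j. f j * (j * u (j + 1) - (j + 1) * u (j + 1 + 1)))"
      by (intro csum_parts[where w = "\<lambda>j. j * u (j + 1)"] f cyc_mult cyc_id u)
    have "f j * (j * u (j + 1) - (j + 1) * u (j + 1 + 1)) = - (2 * \<alpha>) * (f j * (j + 1)) - \<beta> * f j" for j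
      unfolding u_def by algebra
    hence 3: "csum (\<lambda>j. f j * (j * u (j + 1) - (j + 1) * u (j + 1 + 1))) = - (2 * \<alpha>) * ?S - \<beta> * csum f"
      by (simp only: sum_subtractf sum_distrib_left)
    have 4: "\<alpha> * ?S' - (- (2 * \<alpha>) * ?S - \<beta> * csum f) = \<alpha> * Q + \<beta> * csum f"
      unfolding Q_def by algebra
    have "csum (\<lambda>j. j * T j) \<simeq> \<alpha> * Q + \<beta> * csum f"
      unfolding 1 4[symmetric] 3[symmetric] by (rule eqp_diff[OF eqp_refl 2])
    also have "\<dots> \<simeq> \<alpha> * Q + \<beta> * 1" by (rule eqp_add[OF eqp_refl eqp_mult[OF eqp_refl f1]])
    finally show ?thesis by (simp add: \<beta>_def)
  qed
  obtain k where k: "k \<in> Gam" "rot k \<simeq> 0" "\<And>j. evec k j \<simeq> u j" using evec_ex[OF u(1)] by blast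
  have "csum u = \<alpha> * csum (\<lambda>j. j) + csum (\<lambda>j. \<beta>)"
    by (simp add: u_def sum.distrib sum_distrib_left)
  also have "\<dots> \<simeq> \<alpha> * 0 + 0" by (intro eqp_add eqp_mult eqp_refl csum_id csum_1)
  finally have kK: "k \<in> K" by (intro K_evecI[OF k]) simp
  show "\<exists>k\<in>K. \<forall>k'\<in>carrier G. inv\<^sub>A k' \<cdot> k \<in> D K \<longrightarrow> inv\<^sub>A (cmt k' g) \<cdot> x \<in> U"
  proof (intro bexI[OF _ kK] ballI impI)
    fix k' assume k': "k' \<in> carrier G" "inv\<^sub>A k' \<cdot> k \<in> D K"
    let ?y = "inv\<^sub>A (cmt k' g) \<cdot> x"
    have y: "?y \<in> D K" "\<And>j. lam (sc ?y j) \<simeq> t j - T j"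
      unfolding t_def T_def using cmt_sections[OF k(1,2) gG x k' k(3), of f] by (simp_all add: f_def)
    have "csum (\<lambda>j. lam (sc ?y j)) \<simeq> csum (\<lambda>j. t j - T j)" by (intro csum_cong y)
    also have "\<dots> = csum t - csum T" by (rule sum_subtractf)
    also have "\<dots> \<simeq> csum t - csum t" by (intro eqp_diff eqp_refl sum0)
    finally have 0: "csum (\<lambda>j. lam (sc ?y j)) \<simeq> 0" by simp
    have "csum (\<lambda>j. j * lam (sc ?y j)) \<simeq> csum (\<lambda>j. j * (t j - T j))" by (intro csum_cong eqp_mult eqp_refl y)
    also have "\<dots> = csum (\<lambda>j. j * t j) - csum (\<lambda>j. j * T j)" by (simp add: sum_subtractf algebra_simps)
    also have "\<dots> \<simeq> csum (\<lambda>j. j * t j) - csum (\<lambda>j. j * t j)" by (intro eqp_diff eqp_refl sum1)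
    finally show "?y \<in> U" using y(1) 0 by (simp add: U_def)
  qed
qed

lemma K_subset_Wf: "K \<subseteq> Wf 0"
proof
  fix x assume x: "x \<in> K"
  hence G: "x \<in> Gam" "rot x \<simeq> 0" "expb x \<simeq> 0" by (auto simp: K_def)
  have "csum (evec x) \<simeq> 0" using csum_evec[OF G(1)] G(3) by (rule eqp_trans)
  from antidifference[OF cyc_evec this] obtain u where u: "cyc u" "\<And>j. u j - u (j - 1) \<simeq> evec x j" by blast
  have "evec x j \<simeq> (nab ^^ Suc 0) u j" for j using eqp_sym[OF u(2)] by (simp add: nab_def)
  thus "x \<in> Wf 0" using G u(1) unfolding Wf_def by blast
qed

text \<open>If \<open>lam x\<close> vanishes then so does the sum of the antidifference of the exponent vector, which
therefore has an antidifference itself.\<close>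
lemma lam_zero_Wf: assumes x: "x \<in> K" and l: "lam x \<simeq> 0" shows "x \<in> Wf 1"
proof -
  have G: "x \<in> Gam" "rot x \<simeq> 0" "expb x \<simeq> 0" using x by (auto simp: K_def)
  have "csum (evec x) \<simeq> 0" using csum_evec[OF G(1)] G(3) by (rule eqp_trans)
  from antidifference[OF cyc_evec this] obtain u where u: "cyc u" "\<And>j. u j - u (j - 1) \<simeq> evec x j" "csum u \<simeq> - lam x"
    by (auto simp: lam_def)
  have "0 - lam x \<simeq> 0 - 0" by (intro eqp_diff eqp_refl l)
  hence "csum u \<simeq> 0" using u(3) eqp_trans by simp
  from antidifference[OF u(1) this] obtain v where v: "cyc v" "\<And>j. v j - v (j - 1) \<simeq> u j" by blast
  have "evec x j \<simeq> (nab ^^ Suc 1) v j" for j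
  proof -
    have "evec x j \<simeq> nab u j" unfolding nab_def by (rule eqp_sym[OF u(2)])
    also have "\<dots> \<simeq> nab (nab v) j" unfolding nab_def[of v] by (rule nab_cong) (rule eqp_sym[OF v(2)])
    finally show ?thesis by simp
  qed
  thus ?thesis using G v(1) by (auto simp: Wf_def)
qed

text \<open>The exponent vector is a \<open>p\<close>-th difference and vanishes, so all coordinates lie in \<open>K\<close>.\<close>
lemma Wf_subset: "Wf (p - 1) \<subseteq> D K"
proof
  fix x assume "x \<in> Wf (p - 1)"
  moreover have "Suc (p - 1) = p" using p_ge_3 by simp
  ultimately obtain u where x: "x \<in> Gam" "rot x \<simeq> 0" and u: "cyc u" "\<And>j. evec x j \<simeq> (nab ^^ p) u j"
    unfolding Wf_def by auto
  have e: "evec x j \<simeq> 0" for j using eqp_trans[OF u(2) nab_pow_p[OF u(1)]] .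
  have "sc x j \<in> K" for j
  proof -
    have "rot (sc x j) \<simeq> evec x j - evec x (j - 1)" by (rule rot_sc_evec[OF x(1)])
    also have "\<dots> \<simeq> 0 - 0" by (intro eqp_diff e)
    finally have "rot (sc x j) \<simeq> 0" by simp
    moreover have "expb (sc x j) \<simeq> 0" using e[of "j + 1"] by (simp add: evec_def)
    ultimately show ?thesis using x by (simp add: K_def)
  qed
  thus "x \<in> D K" unfolding tree_prod_iff[OF K_carrier] using Gam_Stab[OF x] by blast
qed

text \<open>The coordinates of these elements lie in \<open>b K\<close>, as the hypothesis of \<open>covers_top\<close> on the next level asks.\<close>
definition ones where "ones = {g \<in> K. \<forall>j. evec g j \<simeq> 1}"
text \<open>These elements have all coordinates in \<open>Gam1\<close>: the differences of \<open>j\<close> are constantly \<open>1\<close>,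
also from \<open>p - 1\<close> back to \<open>0\<close>.\<close>
definition steps where "steps = {g \<in> K. \<forall>j. evec g j \<simeq> j}"

lemma evec_saturated: "saturated {g \<in> K. \<forall>j. evec g j \<simeq> u j} (D K)"
  unfolding saturated_def
proof (intro ballI impI)
  fix g z assume g: "g \<in> {g \<in> K. \<forall>j. evec g j \<simeq> u j}" and z: "z \<in> carrier G" "inv\<^sub>A z \<cdot> g \<in> D K"
  have gG: "g \<in> Gam" "rot g \<simeq> 0" "expb g \<simeq> 0" using g by (auto simp: K_def)
  have d: "inv\<^sub>A z \<cdot> g \<in> Gam" "rot (inv\<^sub>A z \<cdot> g) \<simeq> 0"
    using tree_prod_K_Gam[OF z(2)] D_K_rot[OF z(2)] by simp_all
  note q = quot_evec[OF gG(1,2) z(1) d]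
  have ez: "evec z j \<simeq> evec g j" for j
  proof -
    have "evec z j + 0 \<simeq> evec z j + evec (inv\<^sub>A z \<cdot> g) j" by (intro eqp_add eqp_refl eqp_sym[OF D_K_evec[OF z(2)]])
    also have "\<dots> \<simeq> evec g j" by (rule eqp_sym[OF q(3)])
    finally show ?thesis by simp
  qed
  have "z \<in> K" by (rule K_evecI[OF q(1,2) ez]) (rule eqp_trans[OF csum_evec[OF gG(1)] gG(3)])
  thus "z \<in> {g \<in> K. \<forall>j. evec g j \<simeq> u j}" using g eqp_trans[OF ez] by blast
qed

lemma ones_saturated: "saturated ones (D K)" unfolding ones_def by (rule evec_saturated)
lemma steps_saturated: "saturated steps (D K)" unfolding steps_def by (rule evec_saturated)

lemma ones_nonempty: "ones \<noteq> {}"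
proof -
  obtain k where k: "k \<in> Gam" "rot k \<simeq> 0" "\<And>j. evec k j \<simeq> 1" using evec_ex[OF cyc_const[of 1]] by blast
  hence "k \<in> K" using K_evecI[OF k csum_1] by simp
  thus ?thesis using k by (auto simp: ones_def)
qed

lemma steps_nonempty: "steps \<noteq> {}"
proof -
  obtain k where k: "k \<in> Gam" "rot k \<simeq> 0" "\<And>j. evec k j \<simeq> j" using evec_ex[OF cyc_id] by blast
  hence "k \<in> K" using K_evecI[OF k csum_id] by simp
  thus ?thesis using k by (auto simp: steps_def)
qed

lemma Gam01_carrier: "Gam01 \<subseteq> carrier G" and Gam1_carrier: "Gam1 \<subseteq> carrier G"
  and Wf_carrier: "Wf i \<subseteq> carrier G" and U_carrier: "U \<subseteq> carrier G"
  and ones_carrier: "ones \<subseteq> carrier G" and steps_carrier: "steps \<subseteq> carrier G"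
  using Gam_carrier tree_prod_K_Gam K_Gam by (auto simp: Gam01_def Gam1_def Wf_def U_def ones_def steps_def)

lemma ones_subset: "ones \<subseteq> D Gam01"
proof
  fix g assume g: "g \<in> ones"
  hence gG: "g \<in> Gam" "rot g \<simeq> 0" and e: "\<And>j. evec g j \<simeq> 1" by (auto simp: ones_def K_def)
  have "sc g j \<in> Gam01" for j
  proof -
    have "rot (sc g j) \<simeq> evec g j - evec g (j - 1)" by (rule rot_sc_evec[OF gG(1)])
    also have "\<dots> \<simeq> 1 - 1" by (intro eqp_diff e)
    finally have "rot (sc g j) \<simeq> 0" by simp
    thus ?thesis using e[of "j + 1"] gG by (simp add: Gam01_def evec_def)
  qed
  thus "g \<in> D Gam01" unfolding tree_prod_iff[OF Gam01_carrier] using Gam_Stab[OF gG] by blast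
qed

lemma steps_subset: "steps \<subseteq> D Gam1"
proof
  fix g assume g: "g \<in> steps"
  hence gG: "g \<in> Gam" "rot g \<simeq> 0" and e: "\<And>j. evec g j \<simeq> j" by (auto simp: steps_def K_def)
  have "sc g j \<in> Gam1" for j
  proof -
    have "rot (sc g j) \<simeq> evec g j - evec g (j - 1)" by (rule rot_sc_evec[OF gG(1)])
    also have "\<dots> \<simeq> j - (j - 1)" by (intro eqp_diff e)
    finally show ?thesis using gG by (simp add: Gam1_def)
  qed
  thus "g \<in> D Gam1" unfolding tree_prod_iff[OF Gam1_carrier] using Gam_Stab[OF gG] by blast
qed

text \<open>For the constant vector \<open>f = 1\<close> the commutator has the \<open>lam\<close>-values \<open>u j - u (j - 1)\<close>. The
two conditions in the definition of \<open>U\<close> provide an antidifference \<open>u\<close> of sum zero.\<close>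
lemma covers_middle: "cmt_covers U ones K (D K) (D (Wf 1))"
  unfolding cmt_covers_def
proof (intro ballI)
  fix x g assume x: "x \<in> U" and g: "g \<in> ones"
  define t where "t j = lam (sc x j)" for j
  have xD: "x \<in> D K" and t: "cyc t" "csum t \<simeq> 0" "csum (\<lambda>j. j * t j) \<simeq> 0"
    using x cyc_lam_sc[of x] by (simp_all add: U_def t_def[abs_def])
  have gG: "g \<in> Gam" "rot g \<simeq> 0" and e: "\<And>j. evec g j \<simeq> 1" using g by (auto simp: ones_def K_def)
  obtain u where u: "cyc u" "\<And>j. u j - u (j - 1) \<simeq> t j" "csum u \<simeq> - csum (\<lambda>j. j * t j)"
    using antidifference[OF t(1,2)] by blast
  have "0 - csum (\<lambda>j. j * t j) \<simeq> 0 - 0" by (intro eqp_diff eqp_refl t)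
  hence u0: "csum u \<simeq> 0" using u(3) eqp_trans by simp
  obtain k where k: "k \<in> Gam" "rot k \<simeq> 0" "\<And>j. evec k j \<simeq> u j" using evec_ex[OF u(1)] by blast
  have kK: "k \<in> K" by (rule K_evecI[OF k u0])
  show "\<exists>k\<in>K. \<forall>k'\<in>carrier G. inv\<^sub>A k' \<cdot> k \<in> D K \<longrightarrow> inv\<^sub>A (cmt k' g) \<cdot> x \<in> D (Wf 1)"
  proof (intro bexI[OF _ kK] ballI impI)
    fix k' assume k': "k' \<in> carrier G" "inv\<^sub>A k' \<cdot> k \<in> D K"
    let ?y = "inv\<^sub>A (cmt k' g) \<cdot> x"
    note y = cmt_sections[OF k(1,2) gG xD k' k(3) e]
    have yS: "?y \<in> St" and yK: "\<And>j. sc ?y j \<in> K" using y(1) tree_prod_iff[OF K_carrier] by auto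
    have "sc ?y j \<in> Wf 1" for j
    proof (rule lam_zero_Wf[OF yK])
      have "lam (sc ?y j) \<simeq> t j - (u j - u (j - 1))" using y(2)[of j] by (simp add: t_def)
      also have "\<dots> \<simeq> t j - t j" by (intro eqp_diff eqp_refl u)
      finally show "lam (sc ?y j) \<simeq> 0" by simp
    qed
    thus "?y \<in> D (Wf 1)" unfolding tree_prod_iff[OF Wf_carrier] using yS by blast
  qed
qed

text \<open>Commutation with an element that rotates by one applies \<open>nab\<close> to exponent vectors. If \<open>k'\<close>
differs from \<open>k\<close> by an element of \<open>Wf (i + 1)\<close>, the commutator changes by one of \<open>Wf (i + 2)\<close>.\<close>
lemma covers_descend: "cmt_covers (Wf (Suc i)) Gam1 (Wf i) (Wf (Suc i)) (Wf (Suc (Suc i)))"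
  unfolding cmt_covers_def
proof (intro ballI)
  fix x g assume x: "x \<in> Wf (Suc i)" and g: "g \<in> Gam1"
  obtain u where u: "cyc u" "\<And>j. evec x j \<simeq> (nab ^^ Suc (Suc i)) u j" and xG: "x \<in> Gam" "rot x \<simeq> 0"
    using x unfolding Wf_def by blast
  have gG: "g \<in> Gam" "rot g \<simeq> 1" using g by (auto simp: Gam1_def)
  obtain k where k: "k \<in> Gam" "rot k \<simeq> 0" "\<And>j. evec k j \<simeq> (nab ^^ Suc i) u j"
    using evec_ex[OF cyc_nab_pow[OF u(1)]] by blast
  have kW: "k \<in> Wf i" using k u(1) unfolding Wf_def by blast
  show "\<exists>k\<in>Wf i. \<forall>k'\<in>carrier G. inv\<^sub>A k' \<cdot> k \<in> Wf (Suc i) \<longrightarrow>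
      inv\<^sub>A (cmt k' g) \<cdot> x \<in> Wf (Suc (Suc i))"
  proof (intro bexI[OF _ kW] ballI impI)
    fix k' assume k': "k' \<in> carrier G" and d: "inv\<^sub>A k' \<cdot> k \<in> Wf (Suc i)"
    let ?d = "inv\<^sub>A k' \<cdot> k"
    obtain v where v: "cyc v" "\<And>j. evec ?d j \<simeq> (nab ^^ Suc (Suc i)) v j" and dG: "?d \<in> Gam" "rot ?d \<simeq> 0"
      using d unfolding Wf_def by blast
    note q = quot_evec[OF k(1,2) k' dG]
    let ?z = "cmt k' g" and ?y = "inv\<^sub>A (cmt k' g) \<cdot> x"
    have z: "?z \<in> Gam" "rot ?z = 0" using cmt_K[OF q(1) gG(1)] rot_neg by (auto simp: K_def)
    have yG: "?y \<in> Gam" using z xG by simp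
    have "rot ?y \<simeq> - rot ?z + 0" using z xG by (intro eqp_trans[OF rot_mult] eqp_add rot_inv) auto
    hence y0: "rot ?y \<simeq> 0" using z by simp
    have ek': "evec k' j \<simeq> (nab ^^ Suc i) u j - (nab ^^ Suc (Suc i)) v j" for j
    proof -
      have "evec k' j + evec ?d j - evec ?d j \<simeq> (nab ^^ Suc i) u j - (nab ^^ Suc (Suc i)) v j"
        by (intro eqp_diff v eqp_trans[OF eqp_sym[OF q(3)] k(3)])
      thus ?thesis by simp
    qed
    have ez: "evec ?z j \<simeq> nab (evec k') j" for j
    proof -
      let ?j = "j - 1"
      have r: "rot (g \<cdot> k') \<simeq> 1 + 0" using gG q by (intro eqp_trans[OF rot_mult] eqp_add) auto
      have "evec k' j + evec g ?j \<simeq> evec k' (?j + rot g) + evec g ?j"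
        using gG by (intro eqp_add eqp_refl cyc_cong[OF cyc_evec]) (simp add: eqp_dvd dvd_diff_commute)
      also have "\<dots> \<simeq> evec (k' \<cdot> g) ?j" by (rule eqp_sym[OF evec_mult[OF q(1) gG(1)]])
      also have "\<dots> = evec (?z \<cdot> (g \<cdot> k')) ?j" using q gG by (simp add: cmt_mult)
      also have "\<dots> \<simeq> evec ?z (?j + rot (g \<cdot> k')) + evec (g \<cdot> k') ?j" using z gG q by (intro evec_mult) auto
      also have "\<dots> \<simeq> evec ?z j + (evec g ?j + evec k' ?j)"
        using r by (intro eqp_add evec_mult0 gG q cyc_cong[OF cyc_evec]) (simp add: eqp_dvd)
      finally have "evec k' j + evec g ?j - (evec g ?j + evec k' ?j) \<simeq> evec ?z j + (evec g ?j + evec k' ?j) - (evec g ?j + evec k' ?j)"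
        by (intro eqp_diff eqp_refl)
      thus ?thesis by (simp add: nab_def eqp_sym)
    qed
    have "evec ?y j \<simeq> (nab ^^ Suc (Suc (Suc i))) v j" for j
    proof -
      have "evec ?z j + evec ?y j \<simeq> evec (?z \<cdot> ?y) j" by (rule eqp_sym[OF evec_mult0[OF z(1) yG y0]])
      also have "?z \<cdot> ?y = x" using z xG by (simp add: G.m_assoc[symmetric])
      also have "evec x j \<simeq> (nab ^^ Suc (Suc i)) u j" by (rule u)
      finally have "evec ?z j + evec ?y j - evec ?z j \<simeq> (nab ^^ Suc (Suc i)) u j - nab (\<lambda>j. (nab ^^ Suc i) u j - (nab ^^ Suc (Suc i)) v j) j"
        by (intro eqp_diff eqp_trans[OF ez nab_cong[OF ek']])
      thus ?thesis by (simp add: nab_diff)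
    qed
    thus "?y \<in> Wf (Suc (Suc i))" unfolding Wf_def using yG y0 v(1) by blast
  qed
qed

end

section \<open>Balls in finite groups\<close>

context group
begin

lemma foldr_closed: "set xs \<subseteq> carrier G \<Longrightarrow> foldr (\<otimes>) xs \<one> \<in> carrier G"
  by (induction xs) auto

lemma foldr_mult_append: "set xs \<subseteq> carrier G \<Longrightarrow> set ys \<subseteq> carrier G \<Longrightarrow>
    foldr (\<otimes>) (xs @ ys) \<one> = foldr (\<otimes>) xs \<one> \<otimes> foldr (\<otimes>) ys \<one>"
  by (induction xs) (auto simp: m_assoc foldr_closed  simp del: foldr_append)

lemma foldr_inv: "set xs \<subseteq> carrier G \<Longrightarrow> inv (foldr (\<otimes>) xs \<one>) = foldr (\<otimes>) (rev (map (m_inv G) xs)) \<one>"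
proof (induction xs)
  case (Cons x xs)
  hence x: "x \<in> carrier G" and xs: "set xs \<subseteq> carrier G" by auto
  have "foldr (\<otimes>) (rev (map (m_inv G) xs) @ [inv x]) \<one> = foldr (\<otimes>) (rev (map (m_inv G) xs)) \<one> \<otimes> foldr (\<otimes>) [inv x] \<one>"
    by (rule foldr_mult_append) (use x xs in auto)
  thus ?case using Cons.IH[OF xs] x foldr_closed[OF xs] by (simp add: inv_mult_group del: foldr_append)
qed simp

lemma word_ball_carrier: "S \<subseteq> carrier G \<Longrightarrow> word_ball G S n \<subseteq> carrier G"
  unfolding word_ball_def by (auto intro!: foldr_closed)

lemma word_ball_mono: "m \<le> n \<Longrightarrow> word_ball G S m \<subseteq> word_ball G S n"
  unfolding word_ball_def by force

lemma word_ball_one: "\<one> \<in> word_ball G S n"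
  unfolding word_ball_def by (auto intro!: exI[of _ "[]"])

lemma word_ball_gen: assumes "S \<subseteq> carrier G" "s \<in> S" shows "s \<in> word_ball G S 1"
  unfolding word_ball_def using assms by (auto intro!: exI[of _ "[s]"])

lemma word_ball_mult:
  assumes S: "S \<subseteq> carrier G" and "x \<in> word_ball G S m" "y \<in> word_ball G S n"
  shows "x \<otimes> y \<in> word_ball G S (m + n)"
proof -
  obtain xs ys where *: "x = foldr (\<otimes>) xs \<one>" "set xs \<subseteq> S \<union> m_inv G ` S" "length xs \<le> m"
      "y = foldr (\<otimes>) ys \<one>" "set ys \<subseteq> S \<union> m_inv G ` S" "length ys \<le> n"
    using assms unfolding word_ball_def by auto
  have "S \<union> m_inv G ` S \<subseteq> carrier G" using S by auto
  hence "set xs \<subseteq> carrier G" "set ys \<subseteq> carrier G" using * by blast+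
  hence "x \<otimes> y = foldr (\<otimes>) (xs @ ys) \<one>" using * foldr_mult_append[of xs ys] by (simp del: foldr_append)
  thus ?thesis using * unfolding word_ball_def by (auto intro!: exI[of _ "xs @ ys"] simp del: foldr_append)
qed

lemma word_ball_inv:
  assumes S: "S \<subseteq> carrier G" and "x \<in> word_ball G S m"
  shows "inv x \<in> word_ball G S m"
proof -
  obtain xs where *: "x = foldr (\<otimes>) xs \<one>" "set xs \<subseteq> S \<union> m_inv G ` S" "length xs \<le> m"
    using assms unfolding word_ball_def by auto
  have "S \<union> m_inv G ` S \<subseteq> carrier G" using S by auto
  hence "set xs \<subseteq> carrier G" using * by blast
  hence "inv x = foldr (\<otimes>) (rev (map (m_inv G) xs)) \<one>" using * foldr_inv[of xs] by (simp del: foldr_append)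
  moreover have "set (rev (map (m_inv G) xs)) \<subseteq> S \<union> m_inv G ` S" using *(2) S by fastforce
  ultimately show ?thesis using * unfolding word_ball_def by (intro CollectI exI[of _ "rev (map (m_inv G) xs)"]) auto
qed

lemma word_ball_generate:
  assumes S: "S \<subseteq> carrier G" and "x \<in> generate G S"
  shows "\<exists>n. x \<in> word_ball G S n"
  using assms(2)
proof (induction rule: generate.induct)
  case one show ?case using word_ball_one by blast
next
  case (incl h) show ?case using word_ball_gen[OF S incl] by blast
next
  case (inv h) show ?case using word_ball_inv[OF S word_ball_gen[OF S inv]] by blast
next
  case (eng x y) thus ?case using word_ball_mult[OF S] by blast
qed

text \<open>In a finite group the least radius in the definition exists, because every element lies in
some ball.\<close>
lemma diam_wrt_ball:
  assumes fin: "finite (carrier G)" and S: "S \<subseteq> carrier G" "generate G S = carrier G"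
  shows "word_ball G S (diam_wrt G S) = carrier G"
  unfolding diam_wrt_def
proof (rule LeastI_ex)
  have "\<forall>x\<in>carrier G. \<exists>n. x \<in> word_ball G S n" using word_ball_generate[OF S(1)] S(2) by blast
  then obtain f where f: "\<And>x. x \<in> carrier G \<Longrightarrow> x \<in> word_ball G S (f x)" by metis
  have "x \<in> word_ball G S (Max (f ` carrier G))" if "x \<in> carrier G" for x
    using f[OF that] word_ball_mono[of "f x" "Max (f ` carrier G)" S] fin that by auto
  hence "word_ball G S (Max (f ` carrier G)) = carrier G" using word_ball_carrier[OF S(1)] by blast
  thus "\<exists>n. word_ball G S n = carrier G" ..
qed

lemma diam_set_finite: "finite (carrier G) \<Longrightarrow> finite {diam_wrt G S | S. S \<subseteq> carrier G \<and> generate G S = carrier G}"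
  by (rule finite_subset[of _ "diam_wrt G ` Pow (carrier G)"]) auto

lemma diam_wrt_le_group_diam:
  assumes "finite (carrier G)" "S \<subseteq> carrier G" "generate G S = carrier G"
  shows "diam_wrt G S \<le> group_diam G"
  unfolding group_diam_def using assms by (intro Max_ge diam_set_finite) auto

lemma group_diam_le:
  assumes fin: "finite (carrier G)"
    and le: "\<And>S. S \<subseteq> carrier G \<Longrightarrow> generate G S = carrier G \<Longrightarrow> word_ball G S n = carrier G"
  shows "group_diam G \<le> n"
  unfolding group_diam_def
proof (rule Max.boundedI[OF diam_set_finite[OF fin]])
  have "generate G (carrier G) = carrier G"
    using generate_incl[of "carrier G"] generate.incl[of _ "carrier G" G] by blast
  thus "{diam_wrt G S | S. S \<subseteq> carrier G \<and> generate G S = carrier G} \<noteq> {}" by blast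
  fix d assume "d \<in> {diam_wrt G S | S. S \<subseteq> carrier G \<and> generate G S = carrier G}"
  then obtain S where "d = diam_wrt G S" "word_ball G S n = carrier G" using le by blast
  thus "d \<le> n" by (simp add: diam_wrt_def Least_le)
qed

end

context gupta_sidki
begin

section \<open>Covering one level from the previous one\<close>

text \<open>Preimages in the group of the balls of some quotient. Working with them avoids computations
with cosets.\<close>
definition ball_family :: "(nat \<Rightarrow> (nat list \<Rightarrow> nat list) set) \<Rightarrow> bool" where
  "ball_family E \<longleftrightarrow> (\<forall>n. E n \<subseteq> Gam) \<and> (\<forall>m n. m \<le> n \<longrightarrow> E m \<subseteq> E n) \<and>
     (\<forall>n. \<forall>x\<in>E n. inv\<^sub>A x \<in> E n) \<and> (\<forall>m n. \<forall>x\<in>E m. \<forall>y\<in>E n. x \<cdot> y \<in> E (m + n))"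

definition reaches where
  "reaches E X Y l \<longleftrightarrow> (\<forall>x\<in>X. \<exists>z\<in>E l. inv\<^sub>A z \<cdot> x \<in> Y)" for E :: "nat \<Rightarrow> (nat list \<Rightarrow> nat list) set" and l :: nat

lemma reaches_mono:
  assumes "ball_family E" "reaches E X Y l" "X' \<subseteq> X" "Y \<subseteq> Y'" "l \<le> l'" shows "reaches E X' Y' l'"
proof -
  have "E l \<subseteq> E l'" using assms(1,5) by (simp add: ball_family_def)
  thus ?thesis using assms(2-4) unfolding reaches_def by blast
qed

lemma reaches_trans:
  assumes E: "ball_family E" and X: "X \<subseteq> carrier G" and 1: "reaches E X Y l" and 2: "reaches E Y Z l'"
  shows "reaches E X Z (l + l')"
  unfolding reaches_def
proof
  fix x assume x: "x \<in> X"
  then obtain z where z: "z \<in> E l" "inv\<^sub>A z \<cdot> x \<in> Y" using 1 unfolding reaches_def by blast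
  then obtain w where w: "w \<in> E l'" "inv\<^sub>A w \<cdot> (inv\<^sub>A z \<cdot> x) \<in> Z" using 2 unfolding reaches_def by blast
  have c: "z \<in> carrier G" "w \<in> carrier G" "x \<in> carrier G"
    using E z w x X Gam_carrier unfolding ball_family_def by (meson subsetD)+
  have "inv\<^sub>A (z \<cdot> w) \<cdot> x \<in> Z" using w c by (simp add: G.inv_mult_group G.m_assoc)
  moreover have "z \<cdot> w \<in> E (l + l')" using E z w by (simp add: ball_family_def)
  ultimately show "\<exists>z\<in>E (l + l'). inv\<^sub>A z \<cdot> x \<in> Z" by blast
qed

lemma reaches_cmt:
  assumes E: "ball_family E" and c: "cmt_covers X A B N Y" and g: "g \<in> A" "g \<in> E l1" and B: "reaches E B N l2"
  shows "reaches E X Y (2 * l1 + 2 * l2)"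
  unfolding reaches_def
proof
  fix x assume "x \<in> X"
  then obtain k where k: "k \<in> B" "\<And>k'. k' \<in> carrier G \<Longrightarrow> inv\<^sub>A k' \<cdot> k \<in> N \<Longrightarrow> inv\<^sub>A (cmt k' g) \<cdot> x \<in> Y"
    using c g(1) unfolding cmt_covers_def by blast
  obtain k' where k': "k' \<in> E l2" "inv\<^sub>A k' \<cdot> k \<in> N" using B k(1) unfolding reaches_def by blast
  have "k' \<in> carrier G" using E k'(1) Gam_carrier unfolding ball_family_def by (meson subsetD)
  hence "inv\<^sub>A (cmt k' g) \<cdot> x \<in> Y" using k(2) k'(2) by simp
  moreover have "cmt k' g \<in> E (l2 + l1 + l2 + l1)"
    using E k'(1) g(2) unfolding cmt_def ball_family_def by simp
  moreover have "l2 + l1 + l2 + l1 = 2 * l1 + 2 * l2" by simp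
  ultimately show "\<exists>z\<in>E (2 * l1 + 2 * l2). inv\<^sub>A z \<cdot> x \<in> Y" by metis
qed

lemma saturated_meets:
  assumes E: "ball_family E" and "saturated A N" "A \<noteq> {}" "A \<subseteq> B" "reaches E B N l"
  shows "\<exists>z\<in>A. z \<in> E l"
proof -
  obtain g where g: "g \<in> A" using assms by blast
  then obtain z where z: "z \<in> E l" "inv\<^sub>A z \<cdot> g \<in> N" using assms unfolding reaches_def by blast
  have "z \<in> carrier G" using E z(1) Gam_carrier unfolding ball_family_def by (meson subsetD)
  thus ?thesis using assms(2) g z unfolding saturated_def by blast
qed

lemma Wf_0: "Wf 0 = K"
proof
  show "Wf 0 \<subseteq> K"
  proof
    fix x assume "x \<in> Wf 0"
    then obtain u where x: "x \<in> Gam" "rot x \<simeq> 0" and u: "cyc u" "\<And>j. evec x j \<simeq> nab u j"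
      unfolding Wf_def by auto
    have "csum (nab u) = csum u - csum (\<lambda>j. u (j + (-1)))" by (simp add: nab_def sum_subtractf)
    also have "\<dots> \<simeq> csum u - csum u" by (rule eqp_diff[OF eqp_refl csum_shift[OF u(1)]])
    finally have "csum (nab u) \<simeq> 0" by simp
    thus "x \<in> K" by (rule K_evecI[OF x u(2)])
  qed
qed (rule K_subset_Wf)

text \<open>The induction hypothesis at level \<open>m\<close>. Its first part is needed for \<open>covers_top\<close>: some word of
length at most \<open>L\<close> lies in \<open>b K\<close> at every vertex of level \<open>m\<close>.\<close>
definition level_reached where
  "level_reached E m L \<longleftrightarrow> (\<exists>g\<in>(D ^^ m) Gam01. g \<in> E L) \<and> reaches E (V m) (V (Suc m)) L"

lemma level_step:
  assumes E: "ball_family E" and H: "level_reached E m L"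
  shows "level_reached E (Suc m) (5 * 2 ^ p * L)"
proof -
  have Vm: "V m = (D ^^ m) K" and VS: "V (Suc m) = (D ^^ m) (D K)"
    and VSS: "V (Suc (Suc m)) = (D ^^ Suc m) (D K)"
    by (simp_all add: V_def funpow_swap1)
  have KC: "K \<subseteq> carrier G" "D K \<subseteq> carrier G" by (rule K_carrier, rule tree_prod_carrier)
  have down: "reaches E ((D ^^ m) K) ((D ^^ m) (D K)) L" using H Vm VS by (simp add: level_reached_def)
  obtain g where g: "g \<in> (D ^^ m) Gam01" "g \<in> E L" using H by (auto simp: level_reached_def)
  \<comment> \<open>Both types of auxiliary elements are found among the words that approximate \<open>V m\<close>.\<close>
  obtain z where z: "z \<in> (D ^^ m) ones" "z \<in> E L"
    using saturated_meets[OF E saturated_lift_pow[OF ones_saturated ones_carrier KC(2)] D_pow_nonempty[OF ones_nonempty ones_carrier]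
        D_pow_mono down] by (auto simp: ones_def)
  obtain s where s: "s \<in> (D ^^ m) steps" "s \<in> E L"
    using saturated_meets[OF E saturated_lift_pow[OF steps_saturated steps_carrier KC(2)] D_pow_nonempty[OF steps_nonempty steps_carrier]
        D_pow_mono down] by (auto simp: steps_def)
  have "z \<in> (D ^^ Suc m) Gam01" using z(1) D_pow_mono[OF ones_subset, of m] by (auto simp: funpow_swap1)
  moreover have "L \<le> 5 * 2 ^ p * L" by simp
  hence "E L \<subseteq> E (5 * 2 ^ p * L)" using E unfolding ball_family_def by blast
  ultimately have meet: "\<exists>g\<in>(D ^^ Suc m) Gam01. g \<in> E (5 * 2 ^ p * L)" using z(2) by blast
  \<comment> \<open>Seen from the next level, the approximations of \<open>steps\<close> rotate every vertex by one.\<close>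
  have s1: "s \<in> (D ^^ Suc m) Gam1" using s(1) D_pow_mono[OF steps_subset, of m] by (auto simp: funpow_swap1)
  let ?W = "\<lambda>i. (D ^^ Suc m) (Wf i)"
  have "reaches E ((D ^^ m) (D K)) ((D ^^ m) U) (2 * L + 2 * L)"
    by (rule reaches_cmt[OF E cmt_covers_lift_pow[OF covers_top KC(2) Gam01_carrier KC(1) KC(2) U_carrier] g down])
  moreover have "reaches E ((D ^^ m) U) ((D ^^ m) (D (Wf 1))) (2 * L + 2 * L)"
    by (rule reaches_cmt[OF E cmt_covers_lift_pow[OF covers_middle U_carrier ones_carrier KC(1) KC(2) tree_prod_carrier] z down])
  ultimately have "reaches E ((D ^^ m) (D K)) ((D ^^ m) (D (Wf 1))) ((2 * L + 2 * L) + (2 * L + 2 * L))"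
    by (rule reaches_trans[OF E D_pow_carrier[OF KC(2)]])
  hence top: "reaches E (?W 0) (?W 1) (8 * L)" by (simp add: Wf_0 funpow_swap1)
  \<comment> \<open>The lengths satisfy \<open>d (i + 1) = 2 * d i + 2 * L\<close> with \<open>d 0 = 8 * L\<close>.\<close>
  have layer: "reaches E (?W i) (?W (Suc i)) ((10 * 2 ^ i - 2) * L)" for i
  proof (induction i)
    case 0 thus ?case using top by simp
  next
    case (Suc i)
    have "cmt_covers (?W (Suc i)) ((D ^^ Suc m) Gam1) (?W i) (?W (Suc i)) (?W (Suc (Suc i)))"
      by (rule cmt_covers_lift_pow[OF covers_descend Wf_carrier Gam1_carrier Wf_carrier Wf_carrier Wf_carrier])
    from reaches_cmt[OF E this s1 s(2) Suc]
    have "reaches E (?W (Suc i)) (?W (Suc (Suc i))) (2 * L + 2 * ((10 * 2 ^ i - 2) * L))" .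
    moreover have "2 * L + 2 * ((10 * 2 ^ i - 2) * L) = (10 * 2 ^ Suc i - 2) * L"
    proof -
      have "(2::nat) \<le> 10 * 2 ^ i" using one_le_power[of "2::nat" i] by linarith
      moreover have "10 * 2 ^ Suc i = 2 * (10 * (2::nat) ^ i)" by simp
      ultimately have "(2::nat) + 2 * (10 * 2 ^ i - 2) = 10 * 2 ^ Suc i - 2" by linarith
      thus ?thesis by (metis distrib_right mult.assoc)
    qed
    ultimately show ?case by simp
  qed
  have total: "reaches E (?W 0) (?W (Suc i)) (10 * 2 ^ Suc i * L)" for i
  proof (induction i)
    case 0 show ?case by (rule reaches_mono[OF E top]) simp_all
  next
    case (Suc i)
    show ?case
    proof (rule reaches_mono[OF E reaches_trans[OF E D_pow_carrier[OF Wf_carrier] Suc layer] order_refl order_refl])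
      have "(10 * 2 ^ Suc i - 2) * L \<le> 10 * 2 ^ Suc i * L" by (rule mult_right_mono) simp_all
      thus "10 * 2 ^ Suc i * L + (10 * 2 ^ Suc i - 2) * L \<le> 10 * 2 ^ Suc (Suc i) * L" by simp
    qed
  qed
  have p1: "Suc (p - 2) = p - 1" using p_ge_3 by simp
  have e: "10 * 2 ^ (p - 1) = 5 * (2::nat) ^ p" using power_Suc[of "2::nat" "p - 1"] p_ge_3 by simp
  have "reaches E (?W 0) (?W (p - 1)) (5 * 2 ^ p * L)" using total[of "p - 2"] unfolding p1 e .
  from reaches_mono[OF E this order_refl D_pow_mono[OF Wf_subset] order_refl]
  have "reaches E (V (Suc m)) (V (Suc (Suc m))) (5 * 2 ^ p * L)"
    unfolding VSS Wf_0 by (simp only: V_def)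
  thus ?thesis using meet by (simp only: level_reached_def)
qed

lemma b_Gam01: "b \<in> Gam01" using expb_b by (simp add: Gam01_def)

lemma Gam01_saturated: "saturated Gam01 K"
  unfolding saturated_def
proof (intro ballI impI)
  fix g z assume g: "g \<in> Gam01" and z: "z \<in> carrier G" "inv\<^sub>A z \<cdot> g \<in> K"
  have gG: "g \<in> Gam" "rot g \<simeq> 0" "expb g \<simeq> 1" using g by (auto simp: Gam01_def)
  have d: "inv\<^sub>A z \<cdot> g \<in> Gam" "rot (inv\<^sub>A z \<cdot> g) \<simeq> 0" "expb (inv\<^sub>A z \<cdot> g) \<simeq> 0"
    using z(2) by (auto simp: K_def)
  note q = quot_evec[OF gG(1,2) z(1) d(1,2)]
  have "expb z + 0 \<simeq> expb z + expb (inv\<^sub>A z \<cdot> g)" by (rule eqp_add[OF eqp_refl eqp_sym[OF d(3)]])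
  also have "\<dots> \<simeq> expb (z \<cdot> (inv\<^sub>A z \<cdot> g))" by (rule eqp_sym[OF expb_mult[OF q(1) d(1)]])
  also have "z \<cdot> (inv\<^sub>A z \<cdot> g) = g" using z gG by (simp add: G.m_assoc[symmetric])
  also have "expb g \<simeq> 1" by (rule gG(3))
  finally show "z \<in> Gam01" using q by (simp add: Gam01_def)
qed

lemma V_1: "V (Suc 0) = D K" by (simp add: V_def)

lemma V_Suc_subset: "V (Suc n) \<subseteq> V (Suc 0)"
  unfolding V_Suc V_0 by (rule tree_prod_mono[OF V_subset])

text \<open>The lengths at the successive levels form a geometric progression of ratio at least two, so
their sum is at most twice the last one.\<close>
lemma reaches_all:
  assumes E: "ball_family E" and base: "reaches E Gam (V (Suc 0)) l"
  shows "reaches E Gam (V (Suc m)) (2 * l * (5 * 2 ^ p) ^ m)"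
proof -
  let ?c = "5 * 2 ^ p :: nat"
  have "V (Suc 0) \<subseteq> K" by (rule V_subset)
  hence gk: "reaches E Gam K l" using reaches_mono[OF E base] by blast
  have "Gam01 \<noteq> {}" "Gam01 \<subseteq> Gam" using b_Gam01 by (blast, simp add: Gam01_def subset_iff)
  then obtain z where "z \<in> Gam01" "z \<in> E l"
    using saturated_meets[OF E Gam01_saturated _ _ gk] by blast
  moreover have "reaches E (V 0) (V (Suc 0)) l"
    using reaches_mono[OF E base] K_Gam by (simp add: V_0 subset_iff)
  ultimately have H0: "level_reached E 0 l" by (auto simp: level_reached_def)
  have H: "level_reached E m (l * ?c ^ m)" for m
  proof (induction m)
    case (Suc m)
    have "?c * (l * ?c ^ m) = l * ?c ^ Suc m" by simp
    thus ?case using level_step[OF E Suc] by metis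
  qed (use H0 in simp)
  show ?thesis
  proof (induction m)
    case 0
    have "l \<le> 2 * l * ?c ^ 0" by simp
    thus ?case using reaches_mono[OF E base order_refl order_refl, of "2 * l * ?c ^ 0"] by simp
  next
    case (Suc m)
    have GG: "Gam \<subseteq> carrier G" using Gam_carrier by blast
    have "reaches E (V (Suc m)) (V (Suc (Suc m))) (l * ?c ^ Suc m)" using H[of "Suc m"] by (simp add: level_reached_def)
    from reaches_trans[OF E GG Suc this]
    have "reaches E Gam (V (Suc (Suc m))) (2 * l * ?c ^ m + l * ?c ^ Suc m)" .
    moreover have "2 * l * ?c ^ m + l * ?c ^ Suc m \<le> 2 * l * ?c ^ Suc m"
    proof -
      have "(2::nat) \<le> ?c" using one_le_power[of "2::nat" p] by linarith
      hence "l * ?c ^ m * 2 \<le> l * ?c ^ m * ?c" by (rule mult_left_mono) simp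
      thus ?thesis by (simp add: algebra_simps)
    qed
    ultimately show ?case using reaches_mono[OF E _ order_refl order_refl] by blast
  qed
qed

section \<open>The finite quotients\<close>

lemma V_GS_normal: "V n \<lhd> GS"
proof (rule GS.normal_invI[OF GS_subgroupI[OF V_subgroup V_Gam]])
  fix x h assume "x \<in> carrier GS" "h \<in> V n"
  thus "x \<otimes>\<^bsub>GS\<^esub> h \<otimes>\<^bsub>GS\<^esub> inv\<^bsub>GS\<^esub> x \<in> V n" using V_normal by simp
qed

abbreviation Q where "Q n \<equiv> GS Mod V n"

definition pr where "pr n x = V n #>\<^bsub>GS\<^esub> x"

lemma group_Q: "group (Q n)" by (rule normal.factorgroup_is_group[OF V_GS_normal])

lemma pr_hom: "group_hom GS (Q n) (pr n)"
proof -
  interpret N: normal "V n" GS by (rule V_GS_normal)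
  interpret Q: group "Q n" by (rule group_Q)
  have "pr n = (\<lambda>x. V n #>\<^bsub>GS\<^esub> x)" by (simp add: pr_def fun_eq_iff)
  thus ?thesis by unfold_locales (simp add: N.r_coset_hom_Mod)
qed

lemma pr_mult: "x \<in> Gam \<Longrightarrow> y \<in> Gam \<Longrightarrow> pr n (x \<cdot> y) = pr n x \<otimes>\<^bsub>Q n\<^esub> pr n y"
  using group_hom.hom_mult[OF pr_hom, of x y n] by simp
lemma pr_inv: "x \<in> Gam \<Longrightarrow> pr n (inv\<^sub>A x) = inv\<^bsub>Q n\<^esub> (pr n x)"
  using group_hom.hom_inv[OF pr_hom, of x n] by simp
lemma pr_one: "pr n \<one>\<^sub>A = \<one>\<^bsub>Q n\<^esub>"
  using group_hom.hom_one[OF pr_hom, of n] by simp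
lemma Q_carrier: "carrier (Q n) = pr n ` Gam"
  by (simp add: carrier_FactGroup pr_def[abs_def])

lemma pr_eq_one: "x \<in> Gam \<Longrightarrow> pr n x = \<one>\<^bsub>Q n\<^esub> \<longleftrightarrow> x \<in> V n"
  using GS.rcos_self[of x "V n"] GS.coset_join2[of x "V n"] GS_subgroupI[OF V_subgroup V_Gam, of n]
  by (auto simp: pr_def)

lemma pr_eq: assumes "x \<in> Gam" "y \<in> Gam" shows "pr n x = pr n y \<longleftrightarrow> inv\<^sub>A x \<cdot> y \<in> V n"
proof -
  interpret Q: group "Q n" by (rule group_Q)
  have c: "pr n x \<in> carrier (Q n)" "pr n y \<in> carrier (Q n)" using assms by (auto simp: Q_carrier)
  have "inv\<^sub>A x \<cdot> y \<in> V n \<longleftrightarrow> pr n (inv\<^sub>A x \<cdot> y) = \<one>\<^bsub>Q n\<^esub>"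
    using assms by (intro pr_eq_one[symmetric]) simp
  also have "\<dots> \<longleftrightarrow> inv\<^bsub>Q n\<^esub> pr n x \<otimes>\<^bsub>Q n\<^esub> pr n y = \<one>\<^bsub>Q n\<^esub>" using assms by (simp only: pr_mult pr_inv Gam_inv)
  also have "\<dots> \<longleftrightarrow> pr n x = pr n y"
    using c Q.inv_equality[of "inv\<^bsub>Q n\<^esub> pr n x" "pr n y"] Q.inv_inv[of "pr n x"] Q.l_inv[of "pr n x"] Q.inv_inv[of "pr n y"]
    by (metis Q.inv_closed)
  finally show ?thesis ..
qed

lemma balls_family:
  assumes S: "S \<subseteq> carrier (Q n)"
  shows "ball_family (\<lambda>l. {x \<in> Gam. pr n x \<in> word_ball (Q n) S l})"
proof -
  interpret Q: group "Q n" by (rule group_Q)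
  show ?thesis
    unfolding ball_family_def
    using Q.word_ball_mono Q.word_ball_inv[OF S] Q.word_ball_mult[OF S] by (auto simp: pr_mult pr_inv simp del: mult_FactGroup)
qed

definition has_finite_reps where
  "has_finite_reps X Y \<longleftrightarrow> (\<exists>F. finite F \<and> F \<subseteq> carrier G \<and> (\<forall>x\<in>X. \<exists>z\<in>F. inv\<^sub>A z \<cdot> x \<in> Y))"

lemma tree_prod_finite: assumes F: "finite F" "F \<subseteq> carrier G" shows "finite (D F)"
proof (rule inj_on_finite[of "\<lambda>x. \<lambda>j\<in>{0..<int p}. sc x j" _ "{0..<int p} \<rightarrow>\<^sub>E F"])
  show "inj_on (\<lambda>x. \<lambda>j\<in>{0..<int p}. sc x j) (D F)"
  proof (rule inj_onI)
    fix x y assume xy: "x \<in> D F" "y \<in> D F" and e: "(\<lambda>j\<in>{0..<int p}. sc x j) = (\<lambda>j\<in>{0..<int p}. sc y j)"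
    have "sc x j = sc y j" for j
    proof -
      have "sc x (j mod int p) = sc y (j mod int p)" using fun_cong[OF e, of "j mod int p"] p_pos by simp
      thus ?thesis by (simp add: sc_def)
    qed
    moreover have "x \<in> St" "y \<in> St" using xy tree_prod_iff[OF F(2)] by simp_all
    ultimately show "x = y" by (intro Stab_ext[of x y])
  qed
  show "(\<lambda>x. \<lambda>j\<in>{0..<int p}. sc x j) ` D F \<subseteq> {0..<int p} \<rightarrow>\<^sub>E F" using tree_prod_iff[OF F(2)] by auto
  show "finite ({0..<int p} \<rightarrow>\<^sub>E F)" using F by (intro finite_PiE) auto
qed

lemma finite_reps_lift:
  assumes "has_finite_reps X Y" "X \<subseteq> carrier G" "Y \<subseteq> carrier G" shows "has_finite_reps (D X) (D Y)"
proof -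
  obtain F where F: "finite F" "F \<subseteq> carrier G" "\<forall>x\<in>X. \<exists>z\<in>F. inv\<^sub>A z \<cdot> x \<in> Y"
    using assms unfolding has_finite_reps_def by blast
  have "\<exists>z\<in>D F. inv\<^sub>A z \<cdot> x \<in> D Y" if x: "x \<in> D X" for x
  proof -
    have xS: "x \<in> St" and xX: "\<And>j. sc x j \<in> X" using x tree_prod_iff[OF assms(2)] by auto
    have "\<forall>j. \<exists>z. z \<in> F \<and> inv\<^sub>A z \<cdot> sc x j \<in> Y" using F(3) xX by blast
    from choice[OF this] obtain \<zeta> where \<zeta>: "\<And>j. \<zeta> j \<in> F" "\<And>j. inv\<^sub>A (\<zeta> j) \<cdot> sc x j \<in> Y" by blast
    obtain z where z: "z \<in> D F" "\<And>j. sc z j = \<zeta> (j mod int p)" using tree_prod_ex[OF F(2), of \<zeta>] \<zeta>(1) by blast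
    have zS: "z \<in> St" using z tree_prod_iff[OF F(2)] by auto
    have "sc (inv\<^sub>A z \<cdot> x) j \<in> Y" for j
    proof -
      have "sc x j = sc x (j mod int p)" by (simp add: sc_def)
      thus ?thesis using \<zeta>(2)[of "j mod int p"] z(2)[of j] by (simp add: Stab_sc_mult Stab_sc_inv Stab_inv zS xS)
    qed
    hence "inv\<^sub>A z \<cdot> x \<in> D Y" unfolding tree_prod_iff[OF assms(3)] using Stab_mult[OF Stab_inv[OF zS] xS] by blast
    thus ?thesis using z(1) by blast
  qed
  thus ?thesis unfolding has_finite_reps_def using tree_prod_finite[OF F(1,2)] tree_prod_carrier by blast
qed

lemma finite_reps_trans:
  assumes "has_finite_reps X Y" "has_finite_reps Y Z" "X \<subseteq> carrier G" shows "has_finite_reps X Z"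
proof -
  obtain F where F: "finite F" "F \<subseteq> carrier G" "\<forall>x\<in>X. \<exists>z\<in>F. inv\<^sub>A z \<cdot> x \<in> Y"
    using assms unfolding has_finite_reps_def by blast
  obtain F' where F': "finite F'" "F' \<subseteq> carrier G" "\<forall>x\<in>Y. \<exists>z\<in>F'. inv\<^sub>A z \<cdot> x \<in> Z"
    using assms unfolding has_finite_reps_def by blast
  let ?F = "(\<lambda>(u, v). u \<cdot> v) ` (F \<times> F')"
  have "\<exists>z\<in>?F. inv\<^sub>A z \<cdot> x \<in> Z" if x: "x \<in> X" for x
  proof -
    obtain z where z: "z \<in> F" "inv\<^sub>A z \<cdot> x \<in> Y" using F x by blast
    obtain w where w: "w \<in> F'" "inv\<^sub>A w \<cdot> (inv\<^sub>A z \<cdot> x) \<in> Z" using F' z by blast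
    have c: "z \<in> carrier G" "w \<in> carrier G" "x \<in> carrier G" using z w x F F' assms(3) by auto
    have "inv\<^sub>A (z \<cdot> w) \<cdot> x \<in> Z" using w c by (simp add: G.inv_mult_group G.m_assoc)
    moreover have "z \<cdot> w \<in> ?F" using z w by force
    ultimately show ?thesis by blast
  qed
  moreover have "finite ?F" using F F' by simp
  moreover have "?F \<subseteq> carrier G" using F F' by auto
  ultimately show ?thesis unfolding has_finite_reps_def by blast
qed

text \<open>An element is determined modulo \<open>V 1\<close> by its rotation and its exponent vector modulo \<open>p\<close>.\<close>
lemma finite_reps_Gam: "has_finite_reps Gam (V (Suc 0))"
proof -
  define c where "c x = (rot x mod int p, \<lambda>j\<in>{0..<int p}. evec x j mod int p)" for x
  have "finite (c ` Gam)"
  proof (rule finite_subset)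
    show "c ` Gam \<subseteq> {0..<int p} \<times> ({0..<int p} \<rightarrow>\<^sub>E {0..<int p})" using p_pos by (auto simp: c_def)
    show "finite ({0..<int p} \<times> ({0..<int p} \<rightarrow>\<^sub>E {0..<int p}))" by (intro finite_cartesian_product finite_PiE) auto
  qed
  then obtain F where F: "F \<subseteq> Gam" "finite F" "c ` Gam = c ` F" using finite_subset_image[of "c ` Gam" c Gam] by auto
  have "\<exists>z\<in>F. inv\<^sub>A z \<cdot> x \<in> V (Suc 0)" if x: "x \<in> Gam" for x
  proof -
    obtain z where z: "z \<in> F" "c z = c x" using F x by force
    hence zG: "z \<in> Gam" using F by blast
    have r: "rot z \<simeq> rot x" using z by (simp add: c_def eqp_mod)
    have e: "evec z j \<simeq> evec x j" for j
    proof -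
      have "evec z (j mod int p) mod int p = evec x (j mod int p) mod int p"
        using z(2) p_pos unfolding c_def prod.inject by (auto dest: fun_cong[of _ _ "j mod int p"])
      hence "evec z (j mod int p) \<simeq> evec x (j mod int p)" by (simp add: eqp_mod)
      thus ?thesis using cyc_mod[OF cyc_evec, of z j] cyc_mod[OF cyc_evec, of x j] by (simp add: eqp_mod)
    qed
    let ?d = "inv\<^sub>A z \<cdot> x"
    have d: "?d \<in> Gam" using zG x by simp
    have xd: "z \<cdot> ?d = x" using zG x by (simp add: G.m_assoc[symmetric])
    have "rot ?d \<simeq> - rot z + rot x" by (rule eqp_trans[OF rot_mult eqp_add[OF rot_inv eqp_refl]]) (use zG x in auto)
    also have "\<dots> \<simeq> - rot x + rot x" using r by (simp add: eqp_dvd dvd_diff_commute)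
    finally have rd: "rot ?d \<simeq> 0" by simp
    have "evec ?d j \<simeq> (nab ^^ Suc (p - 1)) (\<lambda>_. 0) j" for j
    proof -
      have "evec z j + evec ?d j \<simeq> evec x j" using eqp_sym[OF evec_mult0[OF zG d rd, of j]] xd by simp
      hence "evec z j + evec ?d j - evec z j \<simeq> evec x j - evec x j" by (intro eqp_diff e)
      hence "evec ?d j \<simeq> 0" by simp
      moreover have "(nab ^^ n) (\<lambda>_. 0) = (\<lambda>_. 0)" for n by (induction n) (simp_all add: nab_def)
      ultimately show ?thesis by (simp only:)
    qed
    hence "?d \<in> Wf (p - 1)" unfolding Wf_def using d rd cyc_const[of 0] by blast
    thus ?thesis using z(1) Wf_subset by (auto simp: V_1)
  qed
  thus ?thesis unfolding has_finite_reps_def using F Gam_carrier by blast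
qed

lemma finite_reps_V: "has_finite_reps Gam (V n)"
proof -
  have GG: "Gam \<subseteq> carrier G" using Gam_carrier by blast
  have VG: "V n \<subseteq> carrier G" for n using V_Gam GG by blast
  have "has_finite_reps (V n) (V (Suc n))" for n
  proof (induction n)
    case 0 show ?case using finite_reps_Gam V_Gam[of 0] unfolding has_finite_reps_def by (simp add: subset_iff) blast
  next
    case (Suc n) thus ?case using finite_reps_lift[OF Suc VG VG] by (simp add: V_Suc)
  qed
  note step = this
  have "has_finite_reps Gam (V (Suc n))" for n
    by (induction n) (use finite_reps_Gam finite_reps_trans[OF _ step GG] in auto)
  moreover have "has_finite_reps Gam (V 0)"
    using finite_reps_Gam V_subset[of "Suc 0"] unfolding has_finite_reps_def V_0 by (meson subsetD)
  ultimately show ?thesis by (cases n) auto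
qed

lemma Q_finite: "finite (carrier (Q n))"
proof -
  obtain F where F: "finite F" "F \<subseteq> carrier G" "\<forall>x\<in>Gam. \<exists>z\<in>F. inv\<^sub>A z \<cdot> x \<in> V n"
    using finite_reps_V[of n] unfolding has_finite_reps_def by blast
  have "pr n x \<in> pr n ` F" if x: "x \<in> Gam" for x
  proof -
    obtain z where z: "z \<in> F" "inv\<^sub>A z \<cdot> x \<in> V n" using F x by blast
    have zc: "z \<in> carrier G" using z F by blast
    have "inv\<^sub>A z \<cdot> x \<in> Gam" using z V_Gam by blast
    hence "x \<cdot> inv\<^sub>A (inv\<^sub>A z \<cdot> x) \<in> Gam" using x by simp
    moreover have "x \<cdot> inv\<^sub>A (inv\<^sub>A z \<cdot> x) = z" using x zc by (simp add: G.inv_mult_group G.m_assoc[symmetric])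
    ultimately have "z \<in> Gam" by simp
    thus ?thesis using pr_eq[of z x n] x z by blast
  qed
  hence "carrier (Q n) \<subseteq> pr n ` F" unfolding Q_carrier by blast
  thus ?thesis using F(1) finite_surj by blast
qed

section \<open>The diameter bound\<close>

text \<open>The images in the smallest quotient of the elements in the cosets of \<open>S\<close> generate it. Their
words lift to words in \<open>S\<close> of the same length, so the diameter of this quotient is a radius that
serves all \<open>n\<close> and all generating sets.\<close>
lemma reaches_base:
  assumes S: "S \<subseteq> carrier (Q n)" "generate (Q n) S = carrier (Q n)" and Vn: "V n \<subseteq> V (Suc 0)"
  shows "reaches (\<lambda>l. {x \<in> Gam. pr n x \<in> word_ball (Q n) S l}) Gam (V (Suc 0)) (group_diam (Q (Suc 0)))"
proof -
  interpret Qn: group "Q n" by (rule group_Q)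
  interpret Q1: group "Q (Suc 0)" by (rule group_Q)
  note [simp del] = mult_FactGroup one_FactGroup
  let ?E = "\<lambda>l. {x \<in> Gam. pr n x \<in> word_ball (Q n) S l}"
  have E: "ball_family ?E" by (rule balls_family[OF S(1)])
  define A where "A = pr (Suc 0) ` {x \<in> Gam. pr n x \<in> S}"
  have A: "A \<subseteq> carrier (Q (Suc 0))" by (auto simp: A_def Q_carrier)
  have gen: "X \<in> generate (Q n) S \<Longrightarrow> \<forall>x\<in>Gam. pr n x = X \<longrightarrow> pr (Suc 0) x \<in> generate (Q (Suc 0)) A" for X
  proof (induction rule: generate.induct)
    case one
    show ?case
    proof (intro ballI impI)
      fix x assume x: "x \<in> Gam" "pr n x = \<one>\<^bsub>Q n\<^esub>"
      hence "x \<in> V (Suc 0)" using pr_eq_one[OF x(1), of n] Vn by blast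
      hence "pr (Suc 0) x = \<one>\<^bsub>Q (Suc 0)\<^esub>" using pr_eq_one[OF x(1), of "Suc 0"] by simp
      thus "pr (Suc 0) x \<in> generate (Q (Suc 0)) A" by (simp only: generate.one)
    qed
  next
    case (incl h) thus ?case by (auto simp: A_def intro: generate.incl)
  next
    case (inv h)
    show ?case
    proof (intro ballI impI)
      fix x assume x: "x \<in> Gam" "pr n x = inv\<^bsub>Q n\<^esub> h"
      have "pr n (inv\<^sub>A x) = h" using x inv S(1) by (simp add: pr_inv subset_iff)
      hence "pr (Suc 0) (inv\<^sub>A x) \<in> A" using x inv unfolding A_def by (intro imageI) simp
      from generate.inv[OF this, of "Q (Suc 0)"] have "pr (Suc 0) (inv\<^sub>A (inv\<^sub>A x)) \<in> generate (Q (Suc 0)) A" using x by (subst pr_inv) auto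
      thus "pr (Suc 0) x \<in> generate (Q (Suc 0)) A" using x by simp
    qed
  next
    case (eng h1 h2)
    show ?case
    proof (intro ballI impI)
      fix x assume x: "x \<in> Gam" "pr n x = h1 \<otimes>\<^bsub>Q n\<^esub> h2"
      have h: "h1 \<in> carrier (Q n)" "h2 \<in> carrier (Q n)" using eng Qn.generate_in_carrier[OF S(1)] by auto
      then obtain x1 where x1: "x1 \<in> Gam" "pr n x1 = h1" by (auto simp: Q_carrier)
      let ?x2 = "inv\<^sub>A x1 \<cdot> x"
      have "pr n ?x2 = inv\<^bsub>Q n\<^esub> h1 \<otimes>\<^bsub>Q n\<^esub> (h1 \<otimes>\<^bsub>Q n\<^esub> h2)" using x x1 by (simp add: pr_mult pr_inv)
      also have "\<dots> = h2" using h by (simp add: Qn.m_assoc[symmetric])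
      finally have "pr (Suc 0) ?x2 \<in> generate (Q (Suc 0)) A" using eng x x1 by simp
      moreover have "pr (Suc 0) x1 \<in> generate (Q (Suc 0)) A" using eng x1 by simp
      ultimately have "pr (Suc 0) x1 \<otimes>\<^bsub>Q (Suc 0)\<^esub> pr (Suc 0) ?x2 \<in> generate (Q (Suc 0)) A" by (intro generate.eng)
      moreover have "pr (Suc 0) x1 \<otimes>\<^bsub>Q (Suc 0)\<^esub> pr (Suc 0) ?x2 = pr (Suc 0) (x1 \<cdot> ?x2)" using x x1 by (simp only: pr_mult Gam_mult Gam_inv)
      moreover have "x1 \<cdot> ?x2 = x" using x x1 by (simp add: G.m_assoc[symmetric])
      ultimately show "pr (Suc 0) x \<in> generate (Q (Suc 0)) A" by simp
    qed
  qed
  have genA: "generate (Q (Suc 0)) A = carrier (Q (Suc 0))"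
  proof
    show "generate (Q (Suc 0)) A \<subseteq> carrier (Q (Suc 0))" by (rule Q1.generate_incl[OF A])
    show "carrier (Q (Suc 0)) \<subseteq> generate (Q (Suc 0)) A"
    proof
      fix X assume "X \<in> carrier (Q (Suc 0))"
      then obtain x where x: "x \<in> Gam" "X = pr (Suc 0) x" by (auto simp: Q_carrier)
      have "pr n x \<in> generate (Q n) S" using x S(2) by (auto simp: Q_carrier)
      thus "X \<in> generate (Q (Suc 0)) A" using gen x by blast
    qed
  qed
  have lift: "set xs \<subseteq> A \<union> m_inv (Q (Suc 0)) ` A \<Longrightarrow> \<exists>z\<in>?E (length xs). pr (Suc 0) z = foldr (\<otimes>\<^bsub>Q (Suc 0)\<^esub>) xs \<one>\<^bsub>Q (Suc 0)\<^esub>" for xs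
  proof (induction xs)
    case Nil show ?case using Qn.word_ball_one by (intro bexI[of _ "\<one>\<^sub>A"]) (simp_all add: pr_one)
  next
    case (Cons s xs)
    obtain z where z: "z \<in> ?E (length xs)" "pr (Suc 0) z = foldr (\<otimes>\<^bsub>Q (Suc 0)\<^esub>) xs \<one>\<^bsub>Q (Suc 0)\<^esub>" using Cons by auto
    have "\<exists>y\<in>?E 1. pr (Suc 0) y = s"
    proof (cases "s \<in> A")
      case True
      then obtain y where y: "y \<in> Gam" "pr n y \<in> S" "s = pr (Suc 0) y" by (auto simp: A_def)
      thus ?thesis using Qn.word_ball_gen[OF S(1) y(2)] by blast
    next
      case False
      then obtain y where y: "y \<in> Gam" "pr n y \<in> S" "s = inv\<^bsub>Q (Suc 0)\<^esub> (pr (Suc 0) y)" using Cons.prems by (auto simp: A_def)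
      have "pr n (inv\<^sub>A y) \<in> word_ball (Q n) S 1"
        using Qn.word_ball_inv[OF S(1) Qn.word_ball_gen[OF S(1) y(2)]] y(1) by (simp add: pr_inv)
      thus ?thesis using y by (intro bexI[of _ "inv\<^sub>A y"]) (simp_all add: pr_inv)
    qed
    then obtain y where y: "y \<in> ?E 1" "pr (Suc 0) y = s" by blast
    have "y \<cdot> z \<in> ?E (1 + length xs)" using E y(1) z(1) unfolding ball_family_def by blast
    moreover have "pr (Suc 0) (y \<cdot> z) = foldr (\<otimes>\<^bsub>Q (Suc 0)\<^esub>) (s # xs) \<one>\<^bsub>Q (Suc 0)\<^esub>" using y z by (simp add: pr_mult)
    ultimately show ?case by (intro bexI[of _ "y \<cdot> z"]) simp_all
  qed
  show ?thesis
    unfolding reaches_def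
  proof
    fix x assume x: "x \<in> Gam"
    have "pr (Suc 0) x \<in> word_ball (Q (Suc 0)) A (diam_wrt (Q (Suc 0)) A)"
      using Q1.diam_wrt_ball[OF Q_finite A genA] x by (auto simp: Q_carrier)
    then obtain xs where xs: "pr (Suc 0) x = foldr (\<otimes>\<^bsub>Q (Suc 0)\<^esub>) xs \<one>\<^bsub>Q (Suc 0)\<^esub>" "set xs \<subseteq> A \<union> m_inv (Q (Suc 0)) ` A" "length xs \<le> diam_wrt (Q (Suc 0)) A"
      unfolding word_ball_def by blast
    obtain z where z: "z \<in> ?E (length xs)" "pr (Suc 0) z = pr (Suc 0) x" using lift[OF xs(2)] xs(1) by auto
    have "length xs \<le> group_diam (Q (Suc 0))" using xs(3) Q1.diam_wrt_le_group_diam[OF Q_finite A genA] by linarith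
    hence "z \<in> ?E (group_diam (Q (Suc 0)))" using E z(1) unfolding ball_family_def by blast
    moreover have "inv\<^sub>A z \<cdot> x \<in> V (Suc 0)" using pr_eq[of z x "Suc 0"] z x by simp
    ultimately show "\<exists>z\<in>?E (group_diam (Q (Suc 0))). inv\<^sub>A z \<cdot> x \<in> V (Suc 0)" by blast
  qed
qed

lemma diam_bound: "group_diam (Q (Suc m)) \<le> 2 * group_diam (Q (Suc 0)) * (5 * 2 ^ p) ^ m"
proof (rule group.group_diam_le[OF group_Q Q_finite])
  fix S assume S: "S \<subseteq> carrier (Q (Suc m))" "generate (Q (Suc m)) S = carrier (Q (Suc m))"
  interpret Q: group "Q (Suc m)" by (rule group_Q)
  let ?n = "Suc m" and ?l = "2 * group_diam (Q (Suc 0)) * (5 * 2 ^ p) ^ m"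
  have "reaches (\<lambda>l. {x \<in> Gam. pr ?n x \<in> word_ball (Q ?n) S l}) Gam (V ?n) ?l"
    by (rule reaches_all[OF balls_family[OF S(1)] reaches_base[OF S V_Suc_subset]])
  hence "\<forall>x\<in>Gam. \<exists>z\<in>Gam. pr ?n z \<in> word_ball (Q ?n) S ?l \<and> inv\<^sub>A z \<cdot> x \<in> V ?n"
    unfolding reaches_def by blast
  hence "carrier (Q ?n) \<subseteq> word_ball (Q ?n) S ?l" using pr_eq[of _ _ ?n] unfolding Q_carrier by fastforce
  thus "word_ball (Q ?n) S ?l = carrier (Q ?n)" using Q.word_ball_carrier[OF S(1)] by blast
qed

section \<open>The index\<close>

text \<open>At level zero take the identity and an element of \<open>K\<close> outside \<open>D K\<close>; each further level
raises the number of elements to the power \<open>p\<close>, since coordinates are chosen independently.\<close>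
lemma separated_sets:
  "\<exists>A. finite A \<and> A \<subseteq> V m \<and> 2 ^ (p ^ m) \<le> card A \<and> (\<forall>x\<in>A. \<forall>y\<in>A. inv\<^sub>A x \<cdot> y \<in> V (Suc m) \<longrightarrow> x = y)"
proof (induction m)
  case 0
  obtain k where k: "k \<in> ones" using ones_nonempty by blast
  have kK: "k \<in> K" and ek: "evec k 0 \<simeq> 1" using k by (auto simp: ones_def)
  have n1: "\<not> (1::int) \<simeq> 0" using p_ge_3 by (simp add: eqp_dvd)
  have kD: "k \<notin> D K"
  proof
    assume "k \<in> D K"
    from eqp_trans[OF eqp_sym[OF ek] D_K_evec[OF this]] show False using n1 by simp
  qed
  have D: "subgroup (D K) G" by (rule tree_prod_subgroup[OF K_subgroup])
  have kG: "k \<in> carrier G" using kK K_carrier by blast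
  have ikD: "inv\<^sub>A k \<notin> D K" using subgroup.m_inv_closed[OF D, of "inv\<^sub>A k"] kD kG by auto
  have k1: "k \<noteq> \<one>\<^sub>A" using kD subgroup.one_closed[OF D] by blast
  have sub: "{\<one>\<^sub>A, k} \<subseteq> V 0" unfolding V_0 using kK subgroup.one_closed[OF K_subgroup] by simp
  have card: "2 ^ p ^ 0 \<le> card {\<one>\<^sub>A, k}" using k1 by simp
  have sep: "\<forall>x\<in>{\<one>\<^sub>A, k}. \<forall>y\<in>{\<one>\<^sub>A, k}. inv\<^sub>A x \<cdot> y \<in> V (Suc 0) \<longrightarrow> x = y"
    using kD ikD kG by (simp add: V_Suc V_0)
  have fin: "finite {\<one>\<^sub>A, k}" by simp
  show ?case by (rule exI[of _ "{\<one>\<^sub>A, k}"], rule conjI[OF fin conjI[OF sub conjI[OF card sep]]])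
next
  case (Suc m)
  then obtain A where A: "finite A" "A \<subseteq> V m" "2 ^ (p ^ m) \<le> card A"
    "\<forall>x\<in>A. \<forall>y\<in>A. inv\<^sub>A x \<cdot> y \<in> V (Suc m) \<longrightarrow> x = y" by blast
  have VG: "V n \<subseteq> carrier G" for n using V_Gam[of n] Gam_carrier by blast
  have AG: "A \<subseteq> carrier G" using A(2) VG by blast
  have fin: "finite (D A)" by (rule tree_prod_finite[OF A(1) AG])
  have "{0..<int p} \<rightarrow>\<^sub>E A \<subseteq> (\<lambda>x. \<lambda>j\<in>{0..<int p}. sc x j) ` D A"
  proof
    fix f assume f: "f \<in> {0..<int p} \<rightarrow>\<^sub>E A"
    obtain x where x: "x \<in> D A" "\<And>j. sc x j = f (j mod int p)" using tree_prod_ex[OF AG, of f] f by (auto simp: PiE_iff)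
    have "f = (\<lambda>j\<in>{0..<int p}. sc x j)" using f x(2) by (intro extensionalityI[of f "{0..<int p}"]) (auto simp: PiE_iff)
    thus "f \<in> (\<lambda>x. \<lambda>j\<in>{0..<int p}. sc x j) ` D A" using x(1) by blast
  qed
  hence "card ({0..<int p} \<rightarrow>\<^sub>E A) \<le> card (D A)" by (rule surj_card_le[OF fin])
  moreover have "card ({0..<int p} \<rightarrow>\<^sub>E A) = card A ^ p" by (simp add: card_PiE)
  moreover have "(2 ^ (p ^ m)) ^ p \<le> card A ^ p" by (rule power_mono[OF A(3)]) simp
  moreover have "(2::nat) ^ (p ^ Suc m) = (2 ^ (p ^ m)) ^ p" by (simp add: power_mult[symmetric] mult.commute)
  ultimately have card: "2 ^ (p ^ Suc m) \<le> card (D A)" by linarith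
  have sep: "x = y" if xy: "x \<in> D A" "y \<in> D A" and q: "inv\<^sub>A x \<cdot> y \<in> V (Suc (Suc m))" for x y
  proof -
    have xS: "x \<in> St" "\<And>j. sc x j \<in> A" and yS: "y \<in> St" "\<And>j. sc y j \<in> A" using xy tree_prod_iff[OF AG] by auto
    have "sc (inv\<^sub>A x \<cdot> y) j \<in> V (Suc m)" for j
      using q tree_prod_iff[OF VG[of "Suc m"]] V_Suc[of "Suc m"] by auto
    hence "inv\<^sub>A (sc x j) \<cdot> sc y j \<in> V (Suc m)" for j
      by (simp add: Stab_sc_mult Stab_sc_inv Stab_inv xS yS)
    hence "sc x j = sc y j" for j using A(4) xS yS by blast
    thus "x = y" by (rule Stab_ext[OF xS(1) yS(1)])
  qed
  have sub: "D A \<subseteq> V (Suc m)" unfolding V_Suc by (rule tree_prod_mono[OF A(2)])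
  show ?case by (intro exI[of _ "D A"] conjI ballI impI fin card sub) (rule sep)
qed

lemma index_bound: "2 ^ (p ^ m) \<le> card (rcosets\<^bsub>GS\<^esub> (V (Suc m)))"
proof -
  obtain A where A: "finite A" "A \<subseteq> V m" "2 ^ (p ^ m) \<le> card A"
    "\<forall>x\<in>A. \<forall>y\<in>A. inv\<^sub>A x \<cdot> y \<in> V (Suc m) \<longrightarrow> x = y" using separated_sets[of m] by blast
  have AG: "A \<subseteq> Gam" using A(2) V_Gam by blast
  have "inj_on (pr (Suc m)) A"
  proof (rule inj_onI)
    fix x y assume "x \<in> A" "y \<in> A" "pr (Suc m) x = pr (Suc m) y"
    thus "x = y" using A(4) pr_eq[of x y "Suc m"] AG by (simp add: subset_iff)
  qed
  hence "card A = card (pr (Suc m) ` A)" by (simp add: card_image)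
  also have "\<dots> \<le> card (carrier (Q (Suc m)))" by (rule card_mono[OF Q_finite]) (use AG in \<open>auto simp: Q_carrier\<close>)
  also have "carrier (Q (Suc m)) = rcosets\<^bsub>GS\<^esub> (V (Suc m))" by (simp add: FactGroup_def)
  finally show ?thesis using A(3) by linarith
qed

text \<open>The inequality reduces to \<open>p + 13 \<le> 3 * 2 ^ p\<close>.\<close>
lemma C_const_ge: "5 * 2 ^ p \<le> C_const p"
proof -
  have "p \<ge> 3 \<Longrightarrow> real p + 13 \<le> 3 * 2 ^ p"
  proof (induction p rule: dec_induct)
    case (step n)
    have "(1::real) \<le> 3 * 2 ^ n" using one_le_power[of "2::real" n] by linarith
    thus ?case using step by simp
  qed simp
  hence "2 ^ p * (real p + 13) \<le> 2 ^ p * (3 * 2 ^ p)" using p_ge_3 by (intro mult_left_mono) auto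
  also have "\<dots> = 3 * 4 ^ p" by (simp add: power_mult_distrib[symmetric])
  finally show ?thesis by (simp add: C_const_def algebra_simps)
qed

lemma diam_exp_bound:
  assumes "n \<ge> 1"
  shows "real (group_diam (Q n)) \<le> 2 * real (group_diam (Q (Suc 0))) * exp (ln (C_const p) * real n)"
proof -
  obtain m where n: "n = Suc m" using assms by (cases n) auto
  let ?C = "C_const p"
  have c1: "(1::real) \<le> 5 * 2 ^ p" using one_le_power[of "2::real" p] by linarith
  hence C: "1 \<le> ?C" using C_const_ge by linarith
  have "real (group_diam (Q n)) \<le> real (2 * group_diam (Q (Suc 0)) * (5 * 2 ^ p) ^ m)"
    unfolding n using diam_bound[of m] by (simp only: of_nat_le_iff)
  also have "\<dots> = 2 * real (group_diam (Q (Suc 0))) * (5 * 2 ^ p) ^ m" by simp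
  also have "\<dots> \<le> 2 * real (group_diam (Q (Suc 0))) * ?C ^ n"
  proof (rule mult_left_mono)
    have "(5 * 2 ^ p) ^ m \<le> ?C ^ m" by (rule power_mono[OF C_const_ge]) simp
    also have "\<dots> \<le> ?C ^ n" unfolding n using C by (intro power_increasing) auto
    finally show "(5 * 2 ^ p) ^ m \<le> ?C ^ n" .
  qed simp
  also have "?C ^ n = exp (ln ?C * real n)" using C by (simp add: exp_of_nat2_mult)
  finally show ?thesis .
qed

lemma diam_index_bound:
  assumes "n \<ge> 1"
  defines "\<alpha> \<equiv> ln (C_const p) / ln (real p)"
  shows "real (group_diam (Q n)) \<le> (2 * real (group_diam (Q (Suc 0))) * (ln 2 / real p) powr (- \<alpha>)) *
     ln (real (card (rcosets\<^bsub>GS\<^esub> (V n)))) powr \<alpha>"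
proof -
  obtain m where n: "n = Suc m" using assms by (cases n) auto
  let ?C = "C_const p" and ?N = "real (card (rcosets\<^bsub>GS\<^esub> (V n)))"
  have "(1::real) \<le> 5 * 2 ^ p" using one_le_power[of "2::real" p] by linarith
  hence C: "1 \<le> ?C" using C_const_ge by linarith
  have p: "real p > 0" "ln (real p) > 0" using p_ge_3 by auto
  have \<alpha>: "0 \<le> \<alpha>" using C p by (simp add: \<alpha>_def)
  have "(2::real) ^ (p ^ m) \<le> ?N"
    using index_bound[of m] unfolding n by (metis of_nat_le_iff of_nat_numeral of_nat_power)
  hence "ln ((2::real) ^ (p ^ m)) \<le> ln ?N" by (intro ln_mono) (auto intro: less_le_trans[of 0 "2 ^ (p ^ m)"])
  moreover have "ln ((2::real) ^ (p ^ m)) = real p ^ n * (ln 2 / real p)" using p by (simp add: n ln_realpow)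
  ultimately have "(real p ^ n * (ln 2 / real p)) powr \<alpha> \<le> ln ?N powr \<alpha>" using \<alpha> by (intro powr_mono2) auto
  moreover have "(real p ^ n * (ln 2 / real p)) powr \<alpha> = exp (ln ?C * real n) * (ln 2 / real p) powr \<alpha>"
  proof -
    have "(real p ^ n) powr \<alpha> = exp (ln ?C * real n)" using p by (simp add: powr_def ln_realpow \<alpha>_def mult.commute)
    thus ?thesis by (simp add: powr_mult del: times_divide_eq_right)
  qed
  ultimately have "exp (ln ?C * real n) * (ln 2 / real p) powr \<alpha> \<le> ln ?N powr \<alpha>" by simp
  hence "exp (ln ?C * real n) * (ln 2 / real p) powr \<alpha> * (ln 2 / real p) powr (- \<alpha>) \<le> ln ?N powr \<alpha> * (ln 2 / real p) powr (- \<alpha>)"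
    by (rule mult_right_mono) simp
  moreover have "(ln 2 / real p) powr \<alpha> * (ln 2 / real p) powr (- \<alpha>) = 1"
    using p by (simp add: powr_add[symmetric])
  ultimately have "exp (ln ?C * real n) \<le> ln ?N powr \<alpha> * (ln 2 / real p) powr (- \<alpha>)" by (simp add: mult.assoc)
  hence "2 * real (group_diam (Q (Suc 0))) * exp (ln ?C * real n) \<le> 2 * real (group_diam (Q (Suc 0))) * (ln ?N powr \<alpha> * (ln 2 / real p) powr (- \<alpha>))"
    by (rule mult_left_mono) simp
  with diam_exp_bound[OF assms(1)] show ?thesis by (simp add: mult_ac)
qed

end

theorem theorem1p4:
  fixes p :: nat
  assumes "prime p" and "odd p"
  shows
    "(\<exists>M::real. \<forall>n::nat. n \<ge> 1 \<longrightarrow>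
        real (group_diam (GS_group p Mod tree_prod_pow p n (GS_derived p)))
          \<le> M * exp (ln (C_const p) * real n)) \<and>
     (\<exists>M::real. \<forall>n::nat. n \<ge> 1 \<longrightarrow>
        real (group_diam (GS_group p Mod tree_prod_pow p n (GS_derived p)))
          \<le> M * ln (real (card (rcosets\<^bsub>GS_group p\<^esub> (tree_prod_pow p n (GS_derived p)))))
                  powr (ln (C_const p) / ln (real p)))"
proof -
  interpret gupta_sidki p by unfold_locales (fact assms)+
  have V: "tree_prod_pow p n (GS_derived p) = V n" for n
    by (simp add: tree_prod_pow_def V_def GS_derived_eq)
  show ?thesis
    unfolding V using diam_exp_bound diam_index_bound by blast
qed

end
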